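(* For every $n\ge2$, the set $\mathcal A^s_n$ of signed arc permutations, endowed with the map $w\mapsto\mathrm{sDes}(w)$, is a fine set for the $B_n$-character induced from the $B_{n-1}$-representation on the exterior algebra $\bigwedge V_{n-1}$. Equivalently, $$\sum_{w\in\mathcal A^s_n}F_{\mathrm{sDes}(w)}(x,y)=\mathrm{ch}\Big(\sum_{k=0}^{n-1}\chi^{(k),(1^{n-k-1})}\big\uparrow^{B_n}_{B_{n-1}}\Big).$$
   Context: $B_n$: signed permutations $w=(w(1),\dots,w(n))$; $|a|$ denotes the absolute value (bar removed). $w\in B_n$ is a signed arc permutation if for each $i\in\{2,\dots,n-1\}$: the set $\{|w(1)|,\dots,|w(i-1)|\}$ is an interval in $\mathbb Z_n$ (cyclically consecutive residues, $n$ identified with $0$), and $w(i)$ is unbarred if $|w(i)|-1\in\{|w(1)|,\dots,|w(i-1)|\}$ and barred if $|w(i)|+1\in\{|w(1)|,\dots,|w(i-1)|\}$ (arithmetic in $\mathbb Z_n$). $V_{n-1}$ is an $(n-1)$-dimensional complex vector space on which $B_{n-1}$ acts by permuting coordinates and switching their signs; $B_{n-1}\le B_n$ is the subgroup fixing $n$; $\uparrow^{B_n}_{B_{n-1}}$ is induction. $\chi^{\lambda,\mu}$ is the irreducible $B_{n-1}$-character with Frobenius characteristic $s_\lambda(x)s_\mu(y)$; $\mathrm{ch}(\chi)=\frac{1}{2^nn!}\sum_w\chi(w)p^+_\alpha p^-_\beta$ with $(\alpha,\beta)$ the signed cycle type of $w$ (lengths of positive cycles — pairs of disjoint cycles $c,\bar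 c$ on $\{1,\dots,n,\bar1,\dots,\bar n\}$ — and negative cycles $c=\bar c$, counted with half length), $p^\pm_j=\sum_i(x_i^j\pm y_i^j)$. $\mathrm{sDes}(w)=(S,\varepsilon)$: with $\bar1<_r\cdots<_r\bar n<_r1<_r\cdots<_rn$, $S$ consists of $n$ and all $s\in[n-1]$ with $w(s)>_rw(s+1)$ or with $w(s)$ barred and $w(s+1)$ unbarred; $\varepsilon(s)=-$ iff $w(s)$ barred. For $\sigma=(S,\varepsilon)$ with $S=\{s_1<\dots<s_m=n\}$, $s_0=0$: sign vector $\tilde\varepsilon(j)=\varepsilon(s_i)$ for $s_{i-1}<j\le s_i$; ${\rm wDes}(\sigma)$ the set of $s_i$, $i<m$, with $\varepsilon(s_i)=\varepsilon(s_{i+1})$ or ($\varepsilon(s_i)=+$, $\varepsilon(s_{i+1})=-$); $F_\sigma(x,y)=\sum z_{i_1}\cdots z_{i_n}$ over $i_1\le\dots\le i_n$ with $i_j<i_{j+1}$ for $j\in{\rm wDes}(\sigma)$, $z_{i_j}=x_{i_j}$ if $\tilde\varepsilon(j)=+$, else $y_{i_j}$. Fine sets: for a signed composition $\gamma=(\gamma_1,\dots,\gamma_m)$ of $n$ (some parts barred), partial sums $r_i$, $r_0=0$, $S(\gamma)=\{r_1,\dots,r_m\}$, blocks $I_i=\{r_{i-1}+1,\dots,r_i\}$: $\mathrm{wt}_\gamma(\sigma)=0$ if for some $i$, $S\cap\{r_{i-1}+1,\dots,r_i-1\}$ is not an initial segment of $\{r_{i-1}+1,\dots,r_i-1\}$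 or $\tilde\varepsilon$ is not constant on $I_i$; else $(-1)^{|S\setminus S(\gamma)|+n_\gamma(\sigma)}$, $n_\gamma(\sigma)$ the number of $i$ with $\tilde\varepsilon=-$ on $I_i$ and $\gamma_i$ barred. A finite set $\mathcal B$ with map $\mathrm{sDes}$ is fine for a class function $\chi$ of $B_n$ if $\chi(\gamma)=\sum_{b\in\mathcal B}\mathrm{wt}_\gamma(\mathrm{sDes}(b))$ for all $\gamma$, $\chi(\gamma)$ being the value at elements of signed cycle type (sorted unbarred parts; sorted barred parts of $\gamma$). *)

theory Defs
  imports
    "HOL-Library.Multiset"
    "HOL-Library.FuncSet"
    "HOL-Number_Theory.Cong"
    "HOL-Combinatorics.Permutations"
    "HOL-Combinatorics.Orbits"
    "Jordan_Normal_Form.Matrix"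
begin

section \<open>Formal power series in an arbitrary set of variables\<close>

text \<open>A monomial is the finite multiset of its variables; a series is its coefficient function.\<close>

typedef 'v mseries = "UNIV :: ('v multiset \<Rightarrow> complex) set"
  morphisms mcoeff Abs_mseries
  by simp

setup_lifting type_definition_mseries

lemma mseries_eqI: "(\<And>M. mcoeff f M = mcoeff g M) \<Longrightarrow> f = g"
  by transfer auto

instantiation mseries :: (type) comm_ring_1
begin

lift_definition zero_mseries :: "'a mseries" is "\<lambda>_. 0" .
lift_definition one_mseries :: "'a mseries" is "\<lambda>M. if M = {#} then 1 else 0" .
lift_definition plus_mseries :: "'a mseries \<Rightarrow> 'a mseries \<Rightarrow> 'a mseries"
  is "\<lambda>f g M. f M + g M" .
lift_definition uminus_mseries :: "'a mseries \<Rightarrow> 'a mseries" is "\<lambda>f M. - f M" .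
lift_definition minus_mseries :: "'a mseries \<Rightarrow> 'a mseries \<Rightarrow> 'a mseries"
  is "\<lambda>f g M. f M - g M" .
lift_definition times_mseries :: "'a mseries \<Rightarrow> 'a mseries \<Rightarrow> 'a mseries"
  is "\<lambda>f g M. \<Sum>A | A \<subseteq># M. f A * g (M - A)" .

instance
proof
  have fin: "finite {A. A \<subseteq># M}" for M :: "'a multiset"
  proof -
    have "{A. A \<subseteq># M} \<subseteq> mset ` {xs. set xs \<subseteq> set_mset M \<and> length xs \<le> size M}"
    proof
      fix A assume "A \<in> {A. A \<subseteq># M}"
      then have A: "A \<subseteq># M" by simp
      obtain xs where xs: "mset xs = A" using ex_mset by blast
      have "set xs \<subseteq> set_mset M" using A xs by (metis set_mset_mono set_mset_mset)
      moreover have "length xs \<le> size M" using A xs by (metis size_mset size_mset_mono)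
      ultimately show "A \<in> mset ` {xs. set xs \<subseteq> set_mset M \<and> length xs \<le> size M}"
        using xs by blast
    qed
    moreover have "finite (mset ` {xs. set xs \<subseteq> set_mset M \<and> length xs \<le> size M})"
      by (intro finite_imageI finite_lists_length_le finite_set_mset)
    ultimately show ?thesis by (rule finite_subset)
  qed
  fix a b c :: "'a mseries"
  show "a * b * c = a * (b * c)"
  proof (transfer, rule ext)
    fix f g h :: "'a multiset \<Rightarrow> complex" and M
    have "(\<Sum>A | A \<subseteq># M. (\<Sum>B | B \<subseteq># A. f B * g (A - B)) * h (M - A))
      = (\<Sum>(A, B) \<in> (SIGMA A:{A. A \<subseteq># M}. {B. B \<subseteq># A}). f B * g (A - B) * h (M - A))"
      by (subst sum.Sigma[symmetric]) (auto simp: fin sum_distrib_right)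
    also have "\<dots> = (\<Sum>(B, C) \<in> (SIGMA B:{B. B \<subseteq># M}. {C. C \<subseteq># M - B}).
        f B * g C * h (M - B - C))"
    proof (rule sum.reindex_bij_witness[of _ "\<lambda>(B, C). (B + C, B)" "\<lambda>(A, B). (B, A - B)"], goal_cases)
      case (1 p)
      then show ?case by (cases p) (simp add: subset_mset.add_diff_inverse)
    next
      case (2 p)
      then obtain A B where p: "p = (A, B)" "A \<subseteq># M" "B \<subseteq># A" by (cases p) simp
      then have "B \<subseteq># M" by (meson subset_mset.order_trans)
      moreover have "A - B \<subseteq># M - B"
        using p(2) by (simp add: subseteq_mset_def diff_le_mono)
      ultimately show ?case using p(1) by simp
    next
      case (3 p)
      then show ?case by (cases p) simp
    next
      case (4 p)
      then obtain B C where p: "p = (B, C)" "B \<subseteq># M" "C \<subseteq># M - B" by (cases p) simp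
      have "B + C \<subseteq># M"
      proof (rule mset_subset_eqI)
        fix a
        have "count B a \<le> count M a" "count C a \<le> count M a - count B a"
          using p(2,3) by (simp_all add: subseteq_mset_def)
        then show "count (B + C) a \<le> count M a" by simp
      qed
      then show ?case using p(1) by simp
    next
      case (5 p)
      then obtain A B where p: "p = (A, B)" "A \<subseteq># M" "B \<subseteq># A" by (cases p) simp
      have "M - B - (A - B) = M - A"
        using p(3) by (simp add: subset_mset.add_diff_inverse)
      then show ?case using p(1) by simp
    qed
    also have "\<dots> = (\<Sum>A | A \<subseteq># M. f A * (\<Sum>B | B \<subseteq># M - A. g B * h (M - A - B)))"
      by (subst sum.Sigma[symmetric]) (auto simp: fin sum_distrib_left mult.assoc)
    finally show "(\<Sum>A | A \<subseteq># M. (\<Sum>B | B \<subseteq># A. f B * g (A - B)) * h (M - A))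
      = (\<Sum>A | A \<subseteq># M. f A * (\<Sum>B | B \<subseteq># M - A. g B * h (M - A - B)))" .
  qed
  show "a * b = b * a"
  proof (transfer, rule ext)
    fix f g :: "'a multiset \<Rightarrow> complex" and M
    show "(\<Sum>A | A \<subseteq># M. f A * g (M - A)) = (\<Sum>A | A \<subseteq># M. g A * f (M - A))"
    proof (rule sum.reindex_bij_witness[of _ "\<lambda>A. M - A" "\<lambda>A. M - A"], goal_cases)
      case (3 A)
      then have "M - (M - A) = A" by (simp add: multiset_eq_iff subseteq_mset_def)
      then show ?case by simp
    next
      case (5 A)
      then have "M - (M - A) = A" by (simp add: multiset_eq_iff subseteq_mset_def)
      then show ?case by (simp add: mult.commute)
    qed (simp_all add: multiset_eq_iff subseteq_mset_def)
  qed
  show "1 * a = a"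
  proof (transfer, rule ext)
    fix f :: "'a multiset \<Rightarrow> complex" and M
    have "(\<Sum>A | A \<subseteq># M. (if A = {#} then 1 else 0) * f (M - A))
      = (\<Sum>A \<in> {{#}}. (if A = {#} then 1 else 0) * f (M - A))"
      by (rule sum.mono_neutral_right) (auto simp: fin)
    then show "(\<Sum>A | A \<subseteq># M. (if A = {#} then 1 else 0) * f (M - A)) = f M" by simp
  qed
  show "a + b + c = a + (b + c)" by transfer (simp add: add.assoc)
  show "a + b = b + a" by transfer (simp add: add.commute)
  show "0 + a = a" by transfer simp
  show "- a + a = 0" by transfer simp
  show "a - b = a + - b" by transfer simp
  show "(a + b) * c = a * c + b * c"
    by transfer (simp add: distrib_right sum.distrib)
  show "(0 :: 'a mseries) \<noteq> 1" by transfer (metis zero_neq_one)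
qed

end

lift_definition mconst :: "complex \<Rightarrow> 'v mseries" is "\<lambda>c M. if M = {#} then c else 0" .

datatype var = X nat | Y nat

lift_definition power_sum :: "(nat \<Rightarrow> var) \<Rightarrow> nat \<Rightarrow> var mseries"
  is "\<lambda>z j M. if \<exists>i. M = replicate_mset j (z i) then 1 else 0" .

definition p_plus :: "nat \<Rightarrow> var mseries" where
  "p_plus j = power_sum X j + power_sum Y j"

definition p_minus :: "nat \<Rightarrow> var mseries" where
  "p_minus j = power_sum X j - power_sum Y j"

text \<open>Rows and columns are numbered from 0; a partition may have trailing zeros, so that
  \<open>[0]\<close> is the empty partition.\<close>

definition young_diagram :: "nat list \<Rightarrow> (nat \<times> nat) set" where
  "young_diagram lam = {(i, j). i < length lam \<and> j < lam ! i}"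

definition ssyt :: "nat list \<Rightarrow> (nat \<times> nat \<Rightarrow> nat) set" where
  "ssyt lam = {T \<in> young_diagram lam \<rightarrow>\<^sub>E UNIV.
     (\<forall>i j. (i, Suc j) \<in> young_diagram lam \<longrightarrow> T (i, j) \<le> T (i, Suc j)) \<and>
     (\<forall>i j. (Suc i, j) \<in> young_diagram lam \<longrightarrow> T (i, j) < T (Suc i, j))}"

lift_definition schur :: "(nat \<Rightarrow> var) \<Rightarrow> nat list \<Rightarrow> var mseries"
  is "\<lambda>z lam M. of_nat (card {T \<in> ssyt lam.
        image_mset (\<lambda>c. z (T c)) (mset_set (young_diagram lam)) = M})" .


section \<open>Signed permutations\<close>

text \<open>The barred letter \<open>i\<close> is \<open>- i\<close>. Elements of all the groups are functions on the integers,
  so the subgroup of \<open>signed_perms n\<close> fixing \<open>n\<close> is literally \<open>signed_perms (n - 1)\<close>.\<close>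

definition signed_perms :: "nat \<Rightarrow> (int \<Rightarrow> int) set" where
  "signed_perms n = {w. w permutes ({- int n..int n} - {0}) \<and> (\<forall>i. w (- i) = - w i)}"

definition cycles :: "nat \<Rightarrow> (int \<Rightarrow> int) \<Rightarrow> int set set" where
  "cycles n w = orbit w ` ({- int n..int n} - {0})"

text \<open>A positive pair of cycles is represented by the union of the two cycles, so that half of the
  cardinality is the length for both kinds.\<close>

definition pos_cycles :: "nat \<Rightarrow> (int \<Rightarrow> int) \<Rightarrow> int set set" where
  "pos_cycles n w = {c \<union> uminus ` c | c. c \<in> cycles n w \<and> uminus ` c \<noteq> c}"

definition neg_cycles :: "nat \<Rightarrow> (int \<Rightarrow> int) \<Rightarrow> int set set" where
  "neg_cycles n w = {c \<in> cycles n w. uminus ` c = c}"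

definition signed_cycle_type :: "nat \<Rightarrow> (int \<Rightarrow> int) \<Rightarrow> nat multiset \<times> nat multiset" where
  "signed_cycle_type n w =
     (image_mset (\<lambda>c. card c div 2) (mset_set (pos_cycles n w)),
      image_mset (\<lambda>c. card c div 2) (mset_set (neg_cycles n w)))"

definition cyclic_interval :: "nat \<Rightarrow> int set \<Rightarrow> bool" where
  "cyclic_interval n A \<longleftrightarrow>
     (\<exists>a::int. \<exists>k::nat. (\<lambda>x. x mod int n) ` A = (\<lambda>j. (a + int j) mod int n) ` {..<k})"

definition signed_arc_perms :: "nat \<Rightarrow> (int \<Rightarrow> int) set" where
  "signed_arc_perms n = {w \<in> signed_perms n. \<forall>i \<in> {2..int n - 1}.
     (let A = (\<lambda>j. \<bar>w j\<bar>) ` {1..i - 1} in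
        cyclic_interval n A \<and>
        ((\<exists>a\<in>A. [\<bar>w i\<bar> - 1 = a] (mod int n)) \<longrightarrow> w i > 0) \<and>
        ((\<exists>a\<in>A. [\<bar>w i\<bar> + 1 = a] (mod int n)) \<longrightarrow> w i < 0))}"


section \<open>Signed descent sets, quasisymmetric functions and fine sets\<close>

definition less_r :: "int \<Rightarrow> int \<Rightarrow> bool" where
  "less_r a b \<longleftrightarrow> (a < 0 \<and> b < 0 \<and> \<bar>a\<bar> < \<bar>b\<bar>) \<or> (a < 0 \<and> 0 < b) \<or> (0 < a \<and> 0 < b \<and> a < b)"

text \<open>A signed set is a pair of a set and a sign function with values \<open>1\<close> and \<open>-1\<close>;
  only the values on the set are ever used.\<close>

type_synonym signed_set = "nat set \<times> (nat \<Rightarrow> int)"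

definition sDes :: "nat \<Rightarrow> (int \<Rightarrow> int) \<Rightarrow> signed_set" where
  "sDes n w =
     ({n} \<union> {s \<in> {1..n - 1}. less_r (w (int s + 1)) (w (int s)) \<or>
                              (w (int s) < 0 \<and> w (int s + 1) > 0)},
      \<lambda>s. if w (int s) < 0 then - 1 else 1)"

definition sign_vector :: "signed_set \<Rightarrow> nat \<Rightarrow> int" where
  "sign_vector \<sigma> j = snd \<sigma> (LEAST s. s \<in> fst \<sigma> \<and> j \<le> s)"

definition wDes :: "signed_set \<Rightarrow> nat set" where
  "wDes \<sigma> = {s \<in> fst \<sigma>. (\<exists>t \<in> fst \<sigma>. s < t) \<and>
     (let t = (LEAST t. t \<in> fst \<sigma> \<and> s < t) in
        snd \<sigma> s = snd \<sigma> t \<or> (snd \<sigma> s = 1 \<and> snd \<sigma> t = - 1))}"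

text \<open>The set of sequences counted here is finite, since the monomial bounds the indices.\<close>

lift_definition F_fun :: "nat \<Rightarrow> signed_set \<Rightarrow> var mseries"
  is "\<lambda>n \<sigma> M. of_nat (card {i \<in> {1..n} \<rightarrow>\<^sub>E (UNIV :: nat set).
        (\<forall>j \<in> {1..<n}. i j \<le> i (j + 1)) \<and>
        (\<forall>j \<in> wDes \<sigma>. i j < i (j + 1)) \<and>
        image_mset (\<lambda>j. if sign_vector \<sigma> j = 1 then X (i j) else Y (i j)) (mset_set {1..n}) = M})" .

text \<open>Barred parts are negative.\<close>

definition signed_compositions :: "nat \<Rightarrow> int list set" where
  "signed_compositions n = {\<gamma>. 0 \<notin> set \<gamma> \<and> (\<Sum>c\<leftarrow>\<gamma>. \<bar>c\<bar>) = int n}"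

definition composition_type :: "int list \<Rightarrow> nat multiset \<times> nat multiset" where
  "composition_type \<gamma> =
     (mset (map nat (filter (\<lambda>c. c > 0) \<gamma>)), mset (map (\<lambda>c. nat \<bar>c\<bar>) (filter (\<lambda>c. c < 0) \<gamma>)))"

text \<open>In the following, blocks are numbered from 0: the block \<open>i\<close> is
  \<open>{partial_sum \<gamma> i + 1..partial_sum \<gamma> (i + 1)}\<close>.\<close>

definition partial_sum :: "int list \<Rightarrow> nat \<Rightarrow> nat" where
  "partial_sum \<gamma> i = (\<Sum>c\<leftarrow>take i \<gamma>. nat \<bar>c\<bar>)"

definition block :: "int list \<Rightarrow> nat \<Rightarrow> nat set" where
  "block \<gamma> i = {partial_sum \<gamma> i + 1..partial_sum \<gamma> (i + 1)}"

definition initial_segment :: "nat set \<Rightarrow> nat set \<Rightarrow> bool" where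
  "initial_segment A B \<longleftrightarrow> A \<subseteq> B \<and> (\<forall>a \<in> A. \<forall>b \<in> B. b < a \<longrightarrow> b \<in> A)"

definition wt :: "int list \<Rightarrow> signed_set \<Rightarrow> int" where
  "wt \<gamma> \<sigma> =
     (if \<exists>i < length \<gamma>.
           (let J = {partial_sum \<gamma> i + 1..<partial_sum \<gamma> (i + 1)} in
             \<not> initial_segment (fst \<sigma> \<inter> J) J) \<or>
           \<not> (\<exists>e. \<forall>j \<in> block \<gamma> i. sign_vector \<sigma> j = e)
      then 0
      else (- 1) ^ (card (fst \<sigma> - partial_sum \<gamma> ` {1..length \<gamma>}) +
             card {i. i < length \<gamma> \<and> (\<forall>j \<in> block \<gamma> i. sign_vector \<sigma> j = - 1) \<and> \<gamma> ! i < 0}))"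

definition fine_set :: "nat \<Rightarrow> 'b set \<Rightarrow> ('b \<Rightarrow> signed_set) \<Rightarrow> ((int \<Rightarrow> int) \<Rightarrow> complex) \<Rightarrow> bool" where
  "fine_set n \<B> D \<chi> \<longleftrightarrow> finite \<B> \<and>
     (\<forall>\<gamma> \<in> signed_compositions n. \<forall>w \<in> signed_perms n.
        signed_cycle_type n w = composition_type \<gamma> \<longrightarrow>
        \<chi> w = of_int (\<Sum>b\<in>\<B>. wt \<gamma> (D b)))"


section \<open>Characters\<close>

text \<open>Characters of a group \<open>G\<close> of permutations are functions that vanish outside \<open>G\<close>.\<close>

definition representation ::
    "('a \<Rightarrow> 'a) set \<Rightarrow> nat \<Rightarrow> (('a \<Rightarrow> 'a) \<Rightarrow> complex mat) \<Rightarrow> bool" where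
  "representation G d \<rho> \<longleftrightarrow>
     (\<forall>u \<in> G. \<rho> u \<in> carrier_mat d d) \<and> \<rho> id = 1\<^sub>m d \<and>
     (\<forall>u \<in> G. \<forall>v \<in> G. \<rho> (u \<circ> v) = \<rho> u * \<rho> v)"

definition invariant_subspace ::
    "('a \<Rightarrow> 'a) set \<Rightarrow> nat \<Rightarrow> (('a \<Rightarrow> 'a) \<Rightarrow> complex mat) \<Rightarrow> complex vec set \<Rightarrow> bool" where
  "invariant_subspace G d \<rho> W \<longleftrightarrow>
     W \<subseteq> carrier_vec d \<and> 0\<^sub>v d \<in> W \<and>
     (\<forall>v \<in> W. \<forall>v' \<in> W. v + v' \<in> W) \<and> (\<forall>c. \<forall>v \<in> W. c \<cdot>\<^sub>v v \<in> W) \<and>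
     (\<forall>u \<in> G. \<forall>v \<in> W. \<rho> u *\<^sub>v v \<in> W)"

definition irreducible_representation ::
    "('a \<Rightarrow> 'a) set \<Rightarrow> nat \<Rightarrow> (('a \<Rightarrow> 'a) \<Rightarrow> complex mat) \<Rightarrow> bool" where
  "irreducible_representation G d \<rho> \<longleftrightarrow> representation G d \<rho> \<and> d > 0 \<and>
     (\<forall>W. invariant_subspace G d \<rho> W \<longrightarrow> W = {0\<^sub>v d} \<or> W = carrier_vec d)"

definition irreducible_character :: "('a \<Rightarrow> 'a) set \<Rightarrow> (('a \<Rightarrow> 'a) \<Rightarrow> complex) \<Rightarrow> bool" where
  "irreducible_character G \<chi> \<longleftrightarrow> (\<exists>d \<rho>. irreducible_representation G d \<rho> \<and>
     \<chi> = (\<lambda>u. if u \<in> G then \<Sum>i<d. \<rho> u $$ (i, i) else 0))"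

text \<open>The induced class function, by the Frobenius formula.\<close>

definition induced ::
    "('a \<Rightarrow> 'a) set \<Rightarrow> ('a \<Rightarrow> 'a) set \<Rightarrow> (('a \<Rightarrow> 'a) \<Rightarrow> complex) \<Rightarrow> ('a \<Rightarrow> 'a) \<Rightarrow> complex" where
  "induced H G \<chi> g =
     (if g \<in> G
      then (\<Sum>u | u \<in> G \<and> inv_into UNIV u \<circ> g \<circ> u \<in> H. \<chi> (inv_into UNIV u \<circ> g \<circ> u)) / of_nat (card H)
      else 0)"

definition ch :: "nat \<Rightarrow> ((int \<Rightarrow> int) \<Rightarrow> complex) \<Rightarrow> var mseries" where
  "ch n \<chi> = mconst (1 / (2 ^ n * fact n)) *
     (\<Sum>w \<in> signed_perms n. case signed_cycle_type n w of (\<alpha>, \<beta>) \<Rightarrow>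
        mconst (\<chi> w) * prod_mset (image_mset p_plus \<alpha>) * prod_mset (image_mset p_minus \<beta>))"

definition irr_char :: "nat \<Rightarrow> nat list \<Rightarrow> nat list \<Rightarrow> (int \<Rightarrow> int) \<Rightarrow> complex" where
  "irr_char n lam mu =
     (THE \<chi>. irreducible_character (signed_perms n) \<chi> \<and> ch n \<chi> = schur X lam * schur Y mu)"


section \<open>The exterior algebra\<close>

text \<open>An element of the exterior algebra of the space with basis \<open>e 1, \<dots>, e m\<close> is given by its
  coordinates with respect to the basis elements \<open>e I = e i\<^sub>1 \<and> \<dots> \<and> e i\<^sub>k\<close>, where
  \<open>I = {i\<^sub>1 < \<dots> < i\<^sub>k}\<close> is a subset of \<open>{1..m}\<close>; the sign in the product counts the
  inversions between the two factors.\<close>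

type_synonym ext = "int set \<Rightarrow> complex"

definition ext_basis :: "int set \<Rightarrow> ext" where
  "ext_basis I = (\<lambda>J. if J = I then 1 else 0)"

definition wedge :: "ext \<Rightarrow> ext \<Rightarrow> ext" where
  "wedge f g = (\<lambda>K. \<Sum>I \<in> Pow K.
     (- 1) ^ card {(i, j). i \<in> I \<and> j \<in> K - I \<and> j < i} * f I * g (K - I))"

text \<open>The image of the basis vector \<open>e i\<close> under a signed permutation.\<close>

definition vec_act :: "(int \<Rightarrow> int) \<Rightarrow> int \<Rightarrow> ext" where
  "vec_act w i = (\<lambda>J. of_int (sgn (w i)) * ext_basis {\<bar>w i\<bar>} J)"

definition ext_act :: "nat \<Rightarrow> (int \<Rightarrow> int) \<Rightarrow> ext \<Rightarrow> ext" where
  "ext_act m w f = (\<lambda>J. \<Sum>I \<in> Pow {1..int m}.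
     f I * foldr wedge (map (vec_act w) (sorted_list_of_set I)) (ext_basis {}) J)"

definition ext_char :: "nat \<Rightarrow> (int \<Rightarrow> int) \<Rightarrow> complex" where
  "ext_char m w =
     (if w \<in> signed_perms m then \<Sum>I \<in> Pow {1..int m}. ext_act m w (ext_basis I) I else 0)"

end

theory Submission
  imports Defs "HOL-Combinatorics.Cycles" "HOL-Library.Disjoint_Sets"
begin

text \<open>
  A signed arc permutation is determined by its sign vector \<open>\<epsilon>\<close> and a residue modulo \<open>n\<close>: the
  unbarred letters increase cyclically, the barred ones decrease cyclically. Hence for every \<open>\<epsilon>\<close> the
  \<open>n\<close> signed descent sets are obtained from one basic signed set (descents exactly at the sign changes and
  at the pairs of adjacent barred letters) by toggling, for \<open>s = 1, \<dots>, n\<close>, the position \<open>s\<close> if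
  \<open>\<epsilon>(s) = \<epsilon>(s + 1)\<close>, and doing nothing otherwise. Both generating functions are evaluated from this
  description. The weights sum up to the number of unbarred parts \<open>1\<close> of \<open>\<gamma>\<close> times the product over
  all parts of \<open>1 \<plusminus> (-1)\<^bsup>r-1\<^esup>\<close> (\<open>r\<close> the length of the part, with the minus sign for barred parts), which is the
  induced character, because the character of the exterior algebra is \<open>det (1 + w)\<close>. The quasisymmetric
  functions sum up to the sum of all variables times \<open>\<Sum>\<^sub>k h\<^sub>k(x) e\<^sub>n\<^sub>-\<^sub>1\<^sub>-\<^sub>k(y)\<close>.

  On the other side, the power sum product of \<open>w\<close> is a signed count of the colourings of
  \<open>{1, \<dots>, n}\<close> by variables that are constant on the cycles of \<open>w\<close>. Hence a coefficient of the
  characteristic of a class function is an average over the stabilizer of a single colouring. This gives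
  the characteristic \<open>h\<^sub>k(x) e\<^sub>j(y)\<close> of the \<open>j\<close>-th exterior power of \<open>V\<^sub>k\<^sub>+\<^sub>j\<close>, which is irreducible because
  the sign changes separate the basis vectors and the permutations act transitively on them, and it shows
  that class functions are determined by their characteristics.
\<close>

unbundle no m_inv_syntax

section \<open>Sums over families of functions\<close>

lemma sum_fibres_inj_on:
  fixes g :: "'a set \<Rightarrow> 'c :: comm_semiring_1"
  assumes "finite B" "inj_on c Q" "c ` Q \<subseteq> B"
  shows "(\<Sum>b\<in>B. g {s \<in> Q. c s = b}) = (\<Sum>s\<in>Q. g {s}) + of_nat (card B - card Q) * g {}"
proof -
  have "(\<Sum>b\<in>B. g {s \<in> Q. c s = b})
      = (\<Sum>b\<in>B - c ` Q. g {s \<in> Q. c s = b}) + (\<Sum>b\<in>c ` Q. g {s \<in> Q. c s = b})"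
    using assms(1,3) by (rule sum.subset_diff[rotated])
  also have "(\<Sum>b\<in>B - c ` Q. g {s \<in> Q. c s = b}) = (\<Sum>b\<in>B - c ` Q. g {})"
    by (intro sum.cong refl arg_cong[of _ _ g]) auto
  also have "\<dots> = of_nat (card B - card Q) * g {}"
    using assms by (simp add: card_Diff_subset finite_subset card_image)
  also have "(\<Sum>b\<in>c ` Q. g {s \<in> Q. c s = b}) = (\<Sum>s\<in>Q. g {t \<in> Q. c t = c s})"
    by (simp add: sum.reindex[OF assms(2)])
  also have "\<dots> = (\<Sum>s\<in>Q. g {s})"
    using assms(2) by (intro sum.cong refl arg_cong[of _ _ g]) (auto dest: inj_onD)
  finally show ?thesis by (simp add: add.commute)
qed

lemma sum_prod_disjoint_supports:
  fixes f :: "'i \<Rightarrow> 's \<Rightarrow> 'c :: comm_semiring_1"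
  assumes "finite I" "finite S" "\<And>i. i \<in> I \<Longrightarrow> J i \<subseteq> S" "disjoint_family_on J I"
    and outside: "\<And>i s. i \<in> I \<Longrightarrow> s \<notin> J i \<Longrightarrow> f i s = 1"
  shows "(\<Sum>s\<in>S. \<Prod>i\<in>I. f i s) = of_nat (card (S - (\<Union>i\<in>I. J i))) + (\<Sum>i\<in>I. \<Sum>s\<in>J i. f i s)"
proof -
  have "(\<Sum>s\<in>S. \<Prod>i\<in>I. f i s)
      = (\<Sum>s\<in>S - (\<Union>i\<in>I. J i). \<Prod>i\<in>I. f i s) + (\<Sum>s\<in>(\<Union>i\<in>I. J i). \<Prod>i\<in>I. f i s)"
    using assms(2,3) by (intro sum.subset_diff) auto
  also have "(\<Sum>s\<in>S - (\<Union>i\<in>I. J i). \<Prod>i\<in>I. f i s) = of_nat (card (S - (\<Union>i\<in>I. J i)))"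
    using outside by (simp add: prod.neutral)
  also have "(\<Sum>s\<in>(\<Union>i\<in>I. J i). \<Prod>i\<in>I. f i s) = (\<Sum>i\<in>I. \<Sum>s\<in>J i. \<Prod>k\<in>I. f k s)"
    using assms(1-4) by (intro sum.UNION_disjoint_family ballI finite_subset[OF assms(3) assms(2)])
  also have "\<dots> = (\<Sum>i\<in>I. \<Sum>s\<in>J i. f i s)"
  proof (intro sum.cong refl)
    fix i s assume "i \<in> I" "s \<in> J i"
    then have "f k s = 1" if "k \<in> I - {i}" for k
      using that assms(4) by (intro outside) (auto simp: disjoint_family_on_def)
    then have "(\<Prod>k\<in>I. f k s) = (\<Prod>k\<in>{i}. f k s)"
      using assms(1) \<open>i \<in> I\<close> by (intro prod.mono_neutral_right) auto
    then show "(\<Prod>k\<in>I. f k s) = f i s" by simp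
  qed
  finally show ?thesis .
qed

lemma bij_betw_PiE_comp_surj:
  assumes "h ` D = I"
  shows "bij_betw (\<lambda>E. \<lambda>j\<in>D. E (h j)) (I \<rightarrow>\<^sub>E U)
    {e \<in> D \<rightarrow>\<^sub>E U. \<forall>j\<in>D. \<forall>k\<in>D. h j = h k \<longrightarrow> e j = e k}"
proof (rule bij_betw_byWitness[where f' = "\<lambda>e. \<lambda>i\<in>I. e (inv_into D h i)"])
  have inv: "inv_into D h i \<in> D" "h (inv_into D h i) = i" if "i \<in> I" for i
    using that assms by (auto intro: inv_into_into f_inv_into_f)
  then show "\<forall>E\<in>I \<rightarrow>\<^sub>E U. (\<lambda>i\<in>I. (\<lambda>j\<in>D. E (h j)) (inv_into D h i)) = E"
    by (auto intro!: ext simp: PiE_def extensional_def)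
  show "\<forall>e\<in>{e \<in> D \<rightarrow>\<^sub>E U. \<forall>j\<in>D. \<forall>k\<in>D. h j = h k \<longrightarrow> e j = e k}.
      (\<lambda>j\<in>D. (\<lambda>i\<in>I. e (inv_into D h i)) (h j)) = e"
  proof
    fix e assume "e \<in> {e \<in> D \<rightarrow>\<^sub>E U. \<forall>j\<in>D. \<forall>k\<in>D. h j = h k \<longrightarrow> e j = e k}"
    then have e: "e \<in> D \<rightarrow>\<^sub>E U" and fibres: "\<And>j k. j \<in> D \<Longrightarrow> k \<in> D \<Longrightarrow> h j = h k \<Longrightarrow> e j = e k"
      by blast+
    have eq: "(\<lambda>i\<in>I. e (inv_into D h i)) (h j) = e j" if "j \<in> D" for j
    proof -
      have "h j \<in> I" using that assms by blast
      then show ?thesis using fibres[OF _ that] inv by simp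
    qed
    show "(\<lambda>j\<in>D. (\<lambda>i\<in>I. e (inv_into D h i)) (h j)) = e"
    proof
      fix j show "(\<lambda>j\<in>D. (\<lambda>i\<in>I. e (inv_into D h i)) (h j)) j = e j"
        using eq PiE_arb[OF e]
        by (cases "j \<in> D") (simp_all only: restrict_apply if_True if_False simp_thms)
    qed
  qed
  show "(\<lambda>E. \<lambda>j\<in>D. E (h j)) ` (I \<rightarrow>\<^sub>E U)
      \<subseteq> {e \<in> D \<rightarrow>\<^sub>E U. \<forall>j\<in>D. \<forall>k\<in>D. h j = h k \<longrightarrow> e j = e k}"
    using assms by (auto simp: PiE_iff)
  show "(\<lambda>e. \<lambda>i\<in>I. e (inv_into D h i))
      ` {e \<in> D \<rightarrow>\<^sub>E U. \<forall>j\<in>D. \<forall>k\<in>D. h j = h k \<longrightarrow> e j = e k} \<subseteq> I \<rightarrow>\<^sub>E U"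
    using inv by (intro image_subsetI iffD2[OF restrict_PiE] Pi_I) (blast dest: PiE_mem)
qed

text \<open>The characters \<open>d \<mapsto> \<Prod>b\<in>T. d b\<close> of the group of sign patterns on \<open>P\<close> separate the sign patterns.\<close>

lemma sum_sign_pattern_eq_0:
  fixes f :: "'w \<Rightarrow> 'c :: {idom, ring_char_0}"
  assumes "finite P" "finite S" "\<And>b. b \<in> P \<Longrightarrow> \<delta> b = 1 \<or> \<delta> b = - 1"
    and sign: "\<And>w b. w \<in> S \<Longrightarrow> b \<in> P \<Longrightarrow> d w b = 1 \<or> d w b = - 1"
    and sum: "\<And>T. T \<subseteq> P \<Longrightarrow> (\<Sum>w\<in>S. f w * (\<Prod>b\<in>T. d w b)) = 0"
  shows "(\<Sum>w | w \<in> S \<and> (\<forall>b\<in>P. d w b = \<delta> b). f w) = 0"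
proof -
  have "0 = (\<Sum>T\<in>Pow P. (\<Prod>b\<in>T. \<delta> b) * (\<Sum>w\<in>S. f w * (\<Prod>b\<in>T. d w b)))"
    using sum by simp
  also have "\<dots> = (\<Sum>T\<in>Pow P. \<Sum>w\<in>S. f w * (\<Prod>b\<in>T. \<delta> b * d w b))"
    by (simp add: sum_distrib_left prod.distrib mult_ac)
  also have "\<dots> = (\<Sum>w\<in>S. f w * (\<Sum>T\<in>Pow P. \<Prod>b\<in>T. \<delta> b * d w b))"
    unfolding sum_distrib_left by (rule sum.swap)
  also have "\<dots> = (\<Sum>w\<in>S. f w * (\<Prod>b\<in>P. \<delta> b * d w b + 1))"
    by (simp add: prod_add[OF assms(1)])
  also have "\<dots> = (\<Sum>w\<in>S. if \<forall>b\<in>P. d w b = \<delta> b then f w * 2 ^ card P else 0)"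
  proof (intro sum.cong refl)
    fix w assume "w \<in> S"
    show "f w * (\<Prod>b\<in>P. \<delta> b * d w b + 1) = (if \<forall>b\<in>P. d w b = \<delta> b then f w * 2 ^ card P else 0)"
    proof (cases "\<forall>b\<in>P. d w b = \<delta> b")
      case True
      then have "(\<Prod>b\<in>P. \<delta> b * d w b + 1) = (\<Prod>b\<in>P. 2)"
        using assms(3) by (intro prod.cong refl) fastforce
      then show ?thesis using True by simp
    next
      case False
      then obtain b where "b \<in> P" "d w b \<noteq> \<delta> b" by blast
      then have "\<delta> b * d w b + 1 = 0" using assms(3) sign[OF \<open>w \<in> S\<close>] by fastforce
      then have "(\<Prod>b\<in>P. \<delta> b * d w b + 1) = 0" using assms(1) \<open>b \<in> P\<close> by (intro prod_zero) blast+
      then show ?thesis unfolding if_not_P[OF False] by simp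
    qed
  qed
  also have "\<dots> = (\<Sum>w | w \<in> S \<and> (\<forall>b\<in>P. d w b = \<delta> b). f w) * 2 ^ card P"
    unfolding sum_distrib_right by (rule sum.inter_filter[OF assms(2), symmetric])
  finally show ?thesis by simp
qed

lemma card_le_refines_imp_eq:
  assumes "finite A" "refines A P Q" "card P \<le> card Q"
  shows "P = Q"
proof -
  have parts: "partition_on A P" "partition_on A Q" using assms(2) by (simp_all add: refines_def)
  then have fin: "finite P" "finite Q" using assms(1) finite_elements by blast+
  have refine: "\<exists>q\<in>Q. p \<subseteq> q" if "p \<in> P" for p using assms(2) that by (simp add: refines_def)
  define h where "h p = (SOME q. q \<in> Q \<and> p \<subseteq> q)" for p
  have h: "h p \<in> Q" "p \<subseteq> h p" if "p \<in> P" for p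
    unfolding h_def using someI_ex[of "\<lambda>q. q \<in> Q \<and> p \<subseteq> q"] refine[OF that] by blast+
  have h_eq: "h p = q" if "p \<in> P" "q \<in> Q" "x \<in> p" "x \<in> q" for p q x
  proof -
    have "h p \<inter> q \<noteq> {}" using h[OF that(1)] that(3,4) by blast
    then show ?thesis
      using partition_onD2[OF parts(2)] h(1)[OF that(1)] that(2) by (auto dest: disjointD)
  qed
  have "h ` P = Q"
  proof (intro equalityI subsetI)
    fix q assume "q \<in> Q"
    then obtain x where "x \<in> q" "x \<in> A"
      using parts(2) by (metis UnionI all_not_in_conv partition_onD1 partition_onD3)
    then obtain p where "p \<in> P" "x \<in> p" using partition_onD1[OF parts(1)] by blast
    then show "q \<in> h ` P" using h_eq \<open>q \<in> Q\<close> \<open>x \<in> q\<close> by blast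
  qed (use h in blast)
  then have "card (h ` P) = card P" using assms(3) card_image_le[OF fin(1), of h] by simp
  then have inj: "inj_on h P" using fin(1) by (intro eq_card_imp_inj_on)
  have "h p = p" if "p \<in> P" for p
  proof
    show "h p \<subseteq> p"
    proof
      fix x assume "x \<in> h p"
      then have "x \<in> A" using h(1)[OF that] partition_onD1[OF parts(2)] by blast
      then obtain p' where "p' \<in> P" "x \<in> p'" using partition_onD1[OF parts(1)] by blast
      then have "h p' = h p" using h_eq h(1)[OF that] \<open>x \<in> h p\<close> by blast
      then show "x \<in> p" using inj_onD[OF inj] \<open>p' \<in> P\<close> that \<open>x \<in> p'\<close> by blast
    qed
  qed (rule h(2)[OF that])
  then show ?thesis using \<open>h ` P = Q\<close> by force
qed

lemma finite_submultisets: "finite {A. A \<subseteq># M}"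
proof (induction M)
  case (add x M)
  have "{A. A \<subseteq># add_mset x M} \<subseteq> {A. A \<subseteq># M} \<union> add_mset x ` {A. A \<subseteq># M}"
  proof
    fix A assume "A \<in> {A. A \<subseteq># add_mset x M}"
    then have "A - {#x#} \<subseteq># M" by (simp add: subset_eq_diff_conv)
    then show "A \<in> {A. A \<subseteq># M} \<union> add_mset x ` {A. A \<subseteq># M}"
      by (cases "x \<in># A") (auto intro: rev_image_eqI)
  qed
  then show ?case using add finite_subset by blast
qed simp

section \<open>Functions with prescribed content\<close>

definition fillings :: "'i set \<Rightarrow> 'v multiset \<Rightarrow> ('i \<Rightarrow> 'v) set" where
  "fillings D M = {c \<in> D \<rightarrow>\<^sub>E UNIV. image_mset c (mset_set D) = M}"

lemma finite_fillings: "finite D \<Longrightarrow> finite (fillings D M)"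
  by (rule finite_subset[of _ "D \<rightarrow>\<^sub>E set_mset M"]) (auto simp: fillings_def intro: finite_PiE)

lemma size_filling: "c \<in> fillings D M \<Longrightarrow> size M = card D"
  by (auto simp: fillings_def)

lemma count_filling: "finite D \<Longrightarrow> c \<in> fillings D M \<Longrightarrow> count M x = card {j \<in> D. c j = x}"
  by (auto simp: fillings_def count_image_mset_eq_card_vimage)

lemma filling_mem: "finite D \<Longrightarrow> c \<in> fillings D M \<Longrightarrow> x \<in># M \<longleftrightarrow> (\<exists>j\<in>D. c j = x)"
  by (auto simp: fillings_def)

lemma restrict_mem_fillings_iff:
  assumes "finite D" shows "restrict c D \<in> fillings D M \<longleftrightarrow> image_mset c (mset_set D) = M"
proof -
  have "image_mset (restrict c D) (mset_set D) = image_mset c (mset_set D)"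
    using assms by (intro image_mset_cong) simp
  then show ?thesis by (simp add: fillings_def)
qed

lemma fillings_eq_permuted:
  assumes "finite D" "c \<in> fillings D M" "c' \<in> fillings D M"
  obtains p where "p permutes D" "\<And>i. i \<in> D \<Longrightarrow> c' i = c (p i)"
proof -
  have "image_mset c' (mset_set D) = image_mset c (mset_set D)" using assms by (simp add: fillings_def)
  then obtain p where "p permutes D" "\<forall>i\<in>D. c' i = c (p i)"
    using image_mset_eq_implies_permutes[OF assms(1)] by blast
  then show ?thesis using that by blast
qed

lemma bij_betw_fillings_lists:
  assumes "bij_betw g {..<k} D" "size M = k"
  shows "bij_betw (\<lambda>c. map (\<lambda>j. c (g j)) [0..<k]) (fillings D M) {xs. mset xs = M}"
proof (rule bij_betw_byWitness[where f' = "\<lambda>xs. \<lambda>i\<in>D. xs ! (inv_into {..<k} g i)"])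
  let ?inv = "inv_into {..<k} g"
  have inv: "?inv i < k" "g (?inv i) = i" if "i \<in> D" for i
    using that assms(1) inv_into_into[of i g "{..<k}"] f_inv_into_f[of i g "{..<k}"]
    by (auto simp: bij_betw_def)
  have inv_g: "?inv (g j) = j" and g: "g j \<in> D" if "j < k" for j
    using that assms(1) by (auto simp: bij_betw_def)
  have content: "mset (map (\<lambda>j. c (g j)) [0..<k]) = image_mset c (mset_set D)" for c
    using assms(1) image_mset_mset_set[of g "{0..<k}", symmetric]
    by (simp add: bij_betw_def image_mset.compositionality comp_def lessThan_atLeast0)
  have map_inv: "map (\<lambda>j. (\<lambda>i\<in>D. xs ! ?inv i) (g j)) [0..<k] = xs" if "mset xs = M" for xs
    using that assms(2) g inv_g by (intro nth_equalityI) auto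
  show "\<forall>c\<in>fillings D M. (\<lambda>i\<in>D. map (\<lambda>j. c (g j)) [0..<k] ! ?inv i) = c"
    using inv by (auto simp: fillings_def PiE_def extensional_def)
  show "\<forall>xs\<in>{xs. mset xs = M}. map (\<lambda>j. (\<lambda>i\<in>D. xs ! ?inv i) (g j)) [0..<k] = xs"
    using map_inv by blast
  show "(\<lambda>c. map (\<lambda>j. c (g j)) [0..<k]) ` fillings D M \<subseteq> {xs. mset xs = M}"
    unfolding fillings_def content[symmetric] by blast
  show "(\<lambda>xs. \<lambda>i\<in>D. xs ! ?inv i) ` {xs. mset xs = M} \<subseteq> fillings D M"
  proof (rule image_subsetI)
    fix xs assume "xs \<in> {xs. mset xs = M}"
    then have "image_mset (\<lambda>i\<in>D. xs ! ?inv i) (mset_set D) = M"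
      using map_inv[of xs] by (simp only: mem_Collect_eq flip: content)
    then show "(\<lambda>i\<in>D. xs ! ?inv i) \<in> fillings D M" by (simp add: fillings_def)
  qed
qed

lemma fillings_eq_empty_iff:
  assumes "finite D" shows "fillings D M = {} \<longleftrightarrow> size M \<noteq> card D"
proof
  assume empty: "fillings D M = {}"
  show "size M \<noteq> card D"
  proof
    assume "size M = card D"
    obtain g where "bij_betw g {..<card D} D"
      using ex_bij_betw_nat_finite[OF assms] by (auto simp: lessThan_atLeast0)
    from bij_betw_fillings_lists[OF this \<open>size M = card D\<close>] empty ex_mset[of M]
    show False by (auto simp: bij_betw_def)
  qed
qed (auto dest: size_filling)

lemma card_chain_fillings:
  assumes "bij_betw g {..<k} D" "size M = k" "transp r"
  shows "card {c \<in> fillings D M. \<forall>j. Suc j < k \<longrightarrow> r (c (g j)) (c (g (Suc j)))}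
    = card {xs. mset xs = M \<and> sorted_wrt r xs}"
proof -
  let ?read = "\<lambda>c. map (\<lambda>j. c (g j)) [0..<k]"
  have chain: "(\<forall>j. Suc j < k \<longrightarrow> r (c (g j)) (c (g (Suc j)))) \<longleftrightarrow> sorted_wrt r (?read c)" for c
    by (auto simp: sorted_wrt_iff_nth_Suc_transp[OF assms(3)])
  have "bij_betw ?read {c \<in> fillings D M. sorted_wrt r (?read c)} {xs \<in> {xs. mset xs = M}. sorted_wrt r xs}"
    using bij_betw_fillings_lists[OF assms(1,2)] by (auto simp: bij_betw_def inj_on_def)
  then show ?thesis unfolding chain using bij_betw_same_card by auto
qed

lemma sorted_arrangements: "{xs. mset xs = M \<and> sorted xs} = {sorted_list_of_multiset M}"
  by (auto simp: sort_key_id_if_sorted)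

lemma card_strict_sorted_arrangements:
  fixes M :: "'a :: linorder multiset"
  shows "card {xs. mset xs = M \<and> sorted_wrt (<) xs} = (if \<forall>x. count M x \<le> 1 then 1 else 0)"
proof (cases "\<forall>x. count M x \<le> 1")
  case True
  have "{xs. mset xs = M \<and> sorted_wrt (<) xs} = {xs. mset xs = M \<and> sorted xs}"
    using True by (auto simp: strict_sorted_iff distinct_count_atmost_1 le_Suc_eq count_eq_zero_iff)
  then show ?thesis using True by (simp add: sorted_arrangements)
next
  case False
  have "\<forall>x. count M x \<le> 1" if "mset xs = M" "sorted_wrt (<) xs" for xs
    using that by (auto simp: strict_sorted_iff distinct_count_atmost_1)
  then have "{xs. mset xs = M \<and> sorted_wrt (<) xs} = {}" using False by blast
  then show ?thesis unfolding if_not_P[OF False] by (simp only: card.empty)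
qed

lemma ex1_sorted_filling:
  fixes M :: "'a :: linorder multiset"
  assumes "bij_betw g {..<k} D" "size M = k"
  obtains c where "{c \<in> fillings D M. \<forall>j. Suc j < k \<longrightarrow> c (g j) \<le> c (g (Suc j))} = {c}"
  using card_chain_fillings[OF assms, of "(\<le>)"]
  by (auto simp: sorted_arrangements card_1_singleton_iff transp_on_le)

section \<open>Orbits and signs of permutations\<close>

lemma orbit_eq_range: "permutation p \<Longrightarrow> orbit p x = range (\<lambda>k. (p ^^ k) x)"
  by (simp add: orbit_altdef_permutation full_SetCompr_eq)

lemma orbit_eq_of_mem: "permutation p \<Longrightarrow> y \<in> orbit p x \<Longrightarrow> orbit p y = orbit p x"
  by (rule orbit_cyclic_eq3[OF cyclic_on_orbit'])

lemma orbit_eq_set_support: "permutation p \<Longrightarrow> orbit p x = set (support p x)"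
  by (simp only: orbit_eq_range support_set)

lemma orbit_image: "permutation p \<Longrightarrow> p ` orbit p x = orbit p x"
proof -
  assume p: "permutation p"
  then have "inj_on p (orbit p x)" by (meson bij_is_inj inj_on_subset permutation_bijective subset_UNIV)
  moreover have "p ` orbit p x \<subseteq> orbit p x" by (auto intro: orbit.step)
  ultimately show ?thesis
    using p by (intro endo_inj_surj finite_orbit permutation_self_in_orbit)
qed

lemma least_power_eq_card_orbit:
  assumes "permutation p" shows "least_power p x = card (orbit p x)"
  using distinct_card[OF cycle_of_permutation[OF assms, of x]]
  by (simp only: orbit_eq_set_support[OF assms] length_map length_upt diff_zero)

lemma bij_betw_funpow_orbit:
  assumes "permutation p" shows "bij_betw (\<lambda>t. (p ^^ t) x) {..<card (orbit p x)} (orbit p x)"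
proof -
  have "inj_on (\<lambda>t. (p ^^ t) x) {..<least_power p x}"
    using cycle_of_permutation[OF assms, of x] by (simp add: distinct_map lessThan_atLeast0)
  moreover have "(\<lambda>t. (p ^^ t) x) ` {..<least_power p x} = orbit p x"
    by (simp add: orbit_eq_set_support[OF assms] lessThan_atLeast0)
  ultimately show ?thesis by (simp add: bij_betw_def least_power_eq_card_orbit[OF assms])
qed

lemma partition_on_orbits:
  assumes "finite A" "p permutes A" shows "partition_on A (orbit p ` A)"
proof (rule partition_onI)
  have p: "permutation p" using assms permutation_permutes by blast
  show "\<Union>(orbit p ` A) = A"
    using permutes_orbit_subset[OF assms(2)] permutation_self_in_orbit[OF p] by fast
  show "disjnt b c" if "b \<in> orbit p ` A" "c \<in> orbit p ` A" "b \<noteq> c" for b c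
    using that orbit_eq_of_mem[OF p] unfolding disjnt_def by (metis disjoint_iff imageE)
  show "{} \<notin> orbit p ` A" using orbit_nonempty by fastforce
qed

lemma bij_betw_Union_invariant:
  assumes "finite A" "p permutes A"
  shows "bij_betw Union (Pow (orbit p ` A)) {I. I \<subseteq> A \<and> p ` I = I}"
proof (rule bij_betw_byWitness[where f' = "\<lambda>I. {b \<in> orbit p ` A. b \<subseteq> I}"])
  have p: "permutation p" using assms permutation_permutes by blast
  note partition = partition_on_orbits[OF assms]
  have disjoint: "b = c" if "b \<in> orbit p ` A" "c \<in> orbit p ` A" "x \<in> b" "x \<in> c" for b c x
    using that partition_onD2[OF partition] by (auto dest: disjointD)
  show "\<forall>Q\<in>Pow (orbit p ` A). {b \<in> orbit p ` A. b \<subseteq> \<Union>Q} = Q"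
  proof (intro ballI equalityI subsetI)
    fix Q b assume Q: "Q \<in> Pow (orbit p ` A)" and b: "b \<in> {b \<in> orbit p ` A. b \<subseteq> \<Union>Q}"
    then have "b \<in> orbit p ` A" by blast
    then obtain x where "x \<in> b" using orbit_nonempty by fast
    then obtain c where "c \<in> Q" "x \<in> c" using b by blast
    then have "b = c" using disjoint \<open>b \<in> orbit p ` A\<close> Q \<open>x \<in> b\<close> by blast
    then show "b \<in> Q" using \<open>c \<in> Q\<close> by simp
  qed blast
  have "orbit p x \<subseteq> I" if "p ` I = I" "x \<in> I" for I x
  proof
    fix y assume "y \<in> orbit p x"
    then show "y \<in> I" by (induction rule: orbit.induct) (use that in blast)+
  qed
  then show "\<forall>I\<in>{I. I \<subseteq> A \<and> p ` I = I}. \<Union>{b \<in> orbit p ` A. b \<subseteq> I} = I"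
    using permutation_self_in_orbit[OF p] by (intro ballI equalityI subsetI) blast+
  show "Union ` Pow (orbit p ` A) \<subseteq> {I. I \<subseteq> A \<and> p ` I = I}"
  proof
    fix I assume "I \<in> Union ` Pow (orbit p ` A)"
    then obtain Q where Q: "Q \<subseteq> orbit p ` A" "I = \<Union>Q" by blast
    have "I \<subseteq> A" using Q partition_onD1[OF partition] by blast
    moreover have "p ` b = b" if "b \<in> Q" for b using that Q(1) orbit_image[OF p] by blast
    then have "p ` I = I" unfolding Q(2) image_Union by simp
    ultimately show "I \<in> {I. I \<subseteq> A \<and> p ` I = I}" by simp
  qed
qed blast

lemma sum_invariant_eq_prod_orbits:
  fixes f :: "'a set \<Rightarrow> 'c :: comm_semiring_1"
  assumes "finite A" "p permutes A"
    and mult: "\<And>Q. Q \<subseteq> orbit p ` A \<Longrightarrow> f (\<Union>Q) = (\<Prod>b\<in>Q. f b)"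
  shows "(\<Sum>I | I \<subseteq> A \<and> p ` I = I. f I) = (\<Prod>b\<in>orbit p ` A. 1 + f b)"
proof -
  have "(\<Sum>I | I \<subseteq> A \<and> p ` I = I. f I) = (\<Sum>Q\<in>Pow (orbit p ` A). f (\<Union>Q))"
    by (rule sum.reindex_bij_betw[OF bij_betw_Union_invariant[OF assms(1,2)], symmetric])
  also have "\<dots> = (\<Sum>Q\<in>Pow (orbit p ` A). \<Prod>b\<in>Q. f b)"
    using mult by (intro sum.cong refl) blast
  also have "\<dots> = (\<Prod>b\<in>orbit p ` A. f b + 1)"
    using assms(1) by (simp add: prod_add)
  finally show ?thesis by (simp add: add.commute)
qed

lemma sign_cycle_of_list:
  "distinct cs \<Longrightarrow> sign (cycle_of_list cs) = (- 1) ^ (length cs - 1)"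
  by (induction cs rule: cycle_of_list.induct)
    (simp_all add: sign_compose permutation_swap_id permutation_of_cycle sign_swap_id)

lemma sign_perm_restrict_orbit:
  assumes "permutation p"
  shows "sign (perm_restrict p (orbit p x)) = (- 1) ^ (card (orbit p x) - 1)"
proof -
  have "perm_restrict p (orbit p x) = cycle_of_list (support p x)"
  proof
    fix y show "perm_restrict p (orbit p x) y = cycle_of_list (support p x) y"
    proof (cases "y \<in> set (support p x)")
      case True
      then show ?thesis
        using cycle_restrict[OF assms True]
        by (simp only: orbit_eq_set_support[OF assms] perm_restrict_simps)
    next
      case False
      then show ?thesis
        by (simp only: orbit_eq_set_support[OF assms] perm_restrict_simps id_outside_supp not_False_eq_True)
    qed
  qed
  then show ?thesis
    using sign_cycle_of_list[OF cycle_of_permutation[OF assms]]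
    by (simp add: least_power_eq_card_orbit[OF assms])
qed

lemma perm_restrict_permutes:
  assumes "inj p" "p ` A = A" shows "perm_restrict p A permutes A"
proof (rule bij_imp_permutes)
  have "bij_betw p A A" using assms inj_on_subset[OF assms(1) subset_UNIV] by (simp add: bij_betw_def)
  then show "bij_betw (perm_restrict p A) A A"
    by (rule bij_betw_cong[THEN iffD1, rotated]) (simp add: perm_restrict_simps)
qed (simp add: perm_restrict_simps)

definition order_sign :: "('a :: linorder \<Rightarrow> 'b :: linorder) \<Rightarrow> 'a \<Rightarrow> 'a \<Rightarrow> int" where
  "order_sign a i j = (if i < j \<longleftrightarrow> a i < a j then 1 else - 1)"

definition inv_sign :: "('a :: linorder \<Rightarrow> 'b :: linorder) \<Rightarrow> 'a set \<Rightarrow> int" where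
  "inv_sign a I = (\<Prod>i\<in>I. \<Prod>j\<in>{j \<in> I. i < j}. order_sign a i j)"

lemma order_sign_comp: "order_sign (a \<circ> b) i j = order_sign a (b i) (b j) * order_sign b i j"
  by (simp add: order_sign_def)

lemma order_sign_commute: "i \<noteq> j \<Longrightarrow> a i \<noteq> a j \<Longrightarrow> order_sign a i j = order_sign a j i"
  by (auto simp: order_sign_def)

lemma inv_sign_empty [simp]: "inv_sign a {} = 1"
  by (simp add: inv_sign_def)

lemma inv_sign_cong: "(\<And>i. i \<in> I \<Longrightarrow> a i = b i) \<Longrightarrow> inv_sign a I = inv_sign b I"
  by (simp add: inv_sign_def order_sign_def)

lemma inv_sign_id: "(\<And>i. i \<in> I \<Longrightarrow> a i = i) \<Longrightarrow> inv_sign a I = 1"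
  unfolding inv_sign_def by (intro prod.neutral ballI) (simp add: order_sign_def)

lemma inv_sign_insert:
  assumes "finite I" "x \<notin> I" "inj_on a (insert x I)"
  shows "inv_sign a (insert x I) = inv_sign a I * (\<Prod>i\<in>I. order_sign a i x)"
proof -
  have "(\<Prod>j\<in>{j \<in> insert x I. i < j}. order_sign a i j)
      = (\<Prod>j\<in>{j \<in> I. i < j}. order_sign a i j) * (if i < x then order_sign a i x else 1)"
    if "i \<in> I" for i
  proof -
    have "{j \<in> insert x I. i < j} = (if i < x then insert x {j \<in> I. i < j} else {j \<in> I. i < j})"
      by auto
    then show ?thesis using assms(1,2) by (simp add: mult.commute)
  qed
  moreover have "{j \<in> insert x I. x < j} = {j \<in> I. x < j}" by auto
  ultimately have "inv_sign a (insert x I) = inv_sign a I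
      * ((\<Prod>j\<in>{j \<in> I. x < j}. order_sign a x j) * (\<Prod>i\<in>I. if i < x then order_sign a i x else 1))"
    using assms(1,2) by (simp add: inv_sign_def prod.distrib mult_ac)
  also have "(\<Prod>j\<in>{j \<in> I. x < j}. order_sign a x j) = (\<Prod>j\<in>I. if x < j then order_sign a j x else 1)"
    unfolding prod.inter_filter[OF assms(1)]
    using assms(2,3) by (intro prod.cong refl) (auto simp: inj_on_def intro: order_sign_commute)
  also have "(\<Prod>j\<in>I. if x < j then order_sign a j x else 1) * (\<Prod>i\<in>I. if i < x then order_sign a i x else 1)
      = (\<Prod>i\<in>I. order_sign a i x)"
    unfolding prod.distrib[symmetric] using assms(2) by (intro prod.cong refl) auto
  finally show ?thesis .
qed

lemma inv_sign_comp:
  assumes "finite I" "inj_on b I" "inj_on a (b ` I)"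
  shows "inv_sign (a \<circ> b) I = inv_sign a (b ` I) * inv_sign b I"
  using assms
proof (induction I rule: finite_induct)
  case (insert x I)
  have inj: "inj_on b I" "inj_on a (b ` I)" and "b x \<notin> b ` I" using insert.hyps insert.prems by auto
  have "inv_sign (a \<circ> b) (insert x I) = inv_sign (a \<circ> b) I * (\<Prod>i\<in>I. order_sign (a \<circ> b) i x)"
    using insert.hyps insert.prems by (intro inv_sign_insert comp_inj_on)
  also have "(\<Prod>i\<in>I. order_sign (a \<circ> b) i x)
      = (\<Prod>i\<in>b ` I. order_sign a i (b x)) * (\<Prod>i\<in>I. order_sign b i x)"
    unfolding order_sign_comp prod.distrib by (simp add: prod.reindex[OF inj(1)])
  also have "inv_sign (a \<circ> b) I * \<dots> = (inv_sign a (b ` I) * (\<Prod>i\<in>b ` I. order_sign a i (b x)))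
      * (inv_sign b I * (\<Prod>i\<in>I. order_sign b i x))"
    using insert.IH[OF inj] by (simp only: mult_ac)
  also have "\<dots> = inv_sign a (b ` insert x I) * inv_sign b (insert x I)"
    using inv_sign_insert[OF insert.hyps(1,2) insert.prems(1)]
      inv_sign_insert[OF finite_imageI[OF insert.hyps(1)] \<open>b x \<notin> b ` I\<close> insert.prems(2)[unfolded image_insert]]
    by (simp only: image_insert)
  finally show ?case .
qed simp

lemma inv_sign_transpose:
  assumes "finite I" "p \<in> I" "q \<in> I" "p \<noteq> q"
  shows "inv_sign (transpose p q) I = - 1"
proof -
  define J where "J = I - {p, q}"
  have I: "I = insert p (insert q J)" "p \<notin> insert q J" "q \<notin> J" "finite J"
    using assms by (auto simp: J_def)
  have inj: "inj_on (transpose p q) K" for K by (rule inj_on_subset[OF inj_transpose subset_UNIV])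
  have fixed: "transpose p q i = i" if "i \<in> J" for i
    using that by (intro transpose_apply_other) (auto simp: J_def)
  have "order_sign (transpose p q) i q = order_sign (transpose p q) i p" if "i \<in> J" for i
  proof -
    have "i \<noteq> p" "i \<noteq> q" using that by (auto simp: J_def)
    then show ?thesis using fixed[OF that] by (auto simp: order_sign_def)
  qed
  then have "inv_sign (transpose p q) I = inv_sign (transpose p q) J * order_sign (transpose p q) q p
      * (\<Prod>i\<in>J. order_sign (transpose p q) i p * order_sign (transpose p q) i p)"
    unfolding I(1) using I(2-4) by (simp add: inv_sign_insert[OF _ _ inj] prod.distrib)
  also have "inv_sign (transpose p q) J = 1" using fixed by (rule inv_sign_id)
  also have "order_sign (transpose p q) q p = - 1"
    using assms(4) by (auto simp: order_sign_def)
  also have "(\<Prod>i\<in>J. order_sign (transpose p q) i p * order_sign (transpose p q) i p) = 1"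
    by (intro prod.neutral) (simp add: order_sign_def)
  finally show ?thesis by simp
qed

lemma inv_sign_eq_sign:
  assumes "p permutes I" "finite I" shows "inv_sign p I = sign p"
  using assms
proof (induction rule: permutes_induct)
  case id
  show ?case unfolding sign_id by (rule inv_sign_id) simp
next
  case (swap a b p)
  have "inv_sign (transpose a b \<circ> p) I = inv_sign (transpose a b) (p ` I) * inv_sign p I"
    using swap.hyps assms(2) inj_on_subset[OF inj_transpose subset_UNIV]
      inj_on_subset[OF permutes_inj subset_UNIV]
    by (intro inv_sign_comp)
  also have "\<dots> = sign (transpose a b) * sign p"
    using swap inv_sign_transpose[OF assms(2)] by (simp add: permutes_image sign_swap_id)
  also have "\<dots> = sign (transpose a b \<circ> p)"
    using swap.hyps assms(2)
    by (intro sign_compose[symmetric]) (auto intro: permutes_imp_permutation permutation_swap_id)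
  finally show ?case .
qed

lemma inv_sign_invariant:
  assumes "inj p" "p ` I = I" "finite I" shows "inv_sign p I = sign (perm_restrict p I)"
proof -
  have "inv_sign p I = inv_sign (perm_restrict p I) I"
    by (rule inv_sign_cong) (simp add: perm_restrict_simps)
  then show ?thesis using inv_sign_eq_sign[OF perm_restrict_permutes[OF assms(1,2)] assms(3)] by simp
qed

lemma inv_sign_orbit:
  assumes "permutation p" shows "inv_sign p (orbit p x) = (- 1) ^ (card (orbit p x) - 1)"
  using assms inv_sign_invariant[OF _ orbit_image finite_orbit] permutation_self_in_orbit
  by (metis bij_is_inj permutation_bijective sign_perm_restrict_orbit)

lemma inv_sign_Un_invariant:
  assumes "inj p" "p ` A = A" "p ` B = B" "finite A" "finite B" "A \<inter> B = {}"
  shows "inv_sign p (A \<union> B) = inv_sign p A * inv_sign p B"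
proof -
  have restrict: "perm_restrict p A permutes A" "perm_restrict p B permutes B"
    using assms by (simp_all add: perm_restrict_permutes)
  then have "sign (perm_restrict p A \<circ> perm_restrict p B)
      = sign (perm_restrict p A) * sign (perm_restrict p B)"
    using assms by (intro sign_compose) (auto intro: permutes_imp_permutation)
  then show ?thesis
    using assms perm_restrict_union[OF restrict assms(6)] by (simp add: inv_sign_invariant image_Un)
qed

section \<open>Permutation groups and their characters\<close>

definition class_function :: "('a \<Rightarrow> 'a) set \<Rightarrow> (('a \<Rightarrow> 'a) \<Rightarrow> 'b) \<Rightarrow> bool" where
  "class_function G f \<longleftrightarrow> (\<forall>u\<in>G. \<forall>h\<in>G. f (u \<circ> h \<circ> inv u) = f h)"

lemma class_functionD:
  "class_function G f \<Longrightarrow> u \<in> G \<Longrightarrow> h \<in> G \<Longrightarrow> f (u \<circ> h \<circ> inv u) = f h"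
  by (simp add: class_function_def)

locale finite_permutation_group =
  fixes G :: "('a \<Rightarrow> 'a) set"
  assumes finite_group: "finite G"
    and id_mem: "id \<in> G"
    and comp_mem: "u \<in> G \<Longrightarrow> v \<in> G \<Longrightarrow> u \<circ> v \<in> G"
    and inv_mem: "u \<in> G \<Longrightarrow> inv u \<in> G"
    and bij_mem: "u \<in> G \<Longrightarrow> bij u"
begin

lemma inv_comp: "u \<in> G \<Longrightarrow> inv u \<circ> u = id" and comp_inv: "u \<in> G \<Longrightarrow> u \<circ> inv u = id"
  using bij_mem by (simp_all add: bij_is_inj bij_is_surj flip: surj_iff)

lemma inv_apply: "u \<in> G \<Longrightarrow> inv u (u x) = x" and apply_inv: "u \<in> G \<Longrightarrow> u (inv u x) = x"
  using bij_mem by (simp_all add: bij_is_inj bij_is_surj surj_f_inv_f)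

lemma inv_conj_conj:
  assumes "u \<in> G" shows "inv u \<circ> (u \<circ> h \<circ> inv u) \<circ> u = h" "u \<circ> (inv u \<circ> h \<circ> u) \<circ> inv u = h"
  using assms by (simp_all add: fun_eq_iff inv_apply apply_inv)

lemma conj_mem: "u \<in> G \<Longrightarrow> h \<in> G \<Longrightarrow> u \<circ> h \<circ> inv u \<in> G"
  and inv_conj_mem: "u \<in> G \<Longrightarrow> h \<in> G \<Longrightarrow> inv u \<circ> h \<circ> u \<in> G"
  by (simp_all add: comp_mem inv_mem)

lemma card_pos: "0 < card G"
  using finite_group id_mem by (auto simp: card_gt_0_iff)

lemma card_left_translate:
  assumes "u \<in> G" shows "card {w \<in> G. P (inv u \<circ> w)} = card {w \<in> G. P w}"
proof -
  have "bij_betw ((\<circ>) u) {w \<in> G. P w} {w \<in> G. P (inv u \<circ> w)}"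
    by (rule bij_betw_byWitness[where f' = "(\<circ>) (inv u)"])
      (use assms in \<open>auto simp: comp_mem inv_mem inv_comp comp_inv simp flip: comp_assoc\<close>)
  then show ?thesis by (simp add: bij_betw_same_card)
qed

lemma card_point_transporters:
  assumes "finite T" "\<And>a. a \<in> T \<Longrightarrow> \<exists>u\<in>G. u x = a"
  shows "card {u \<in> G. u x \<in> T} = card T * card {u \<in> G. u x = x}"
proof -
  have "card {v \<in> G. v x = a} = card {v \<in> G. v x = x}" if a: "a \<in> T" for a
  proof -
    obtain u where u: "u \<in> G" "u x = a" using assms(2)[OF a] by blast
    then have "(inv u \<circ> v) x = x \<longleftrightarrow> v x = a" for v by (metis apply_inv comp_apply inv_apply)
    then show ?thesis using card_left_translate[OF u(1), of "\<lambda>v. v x = x"] by simp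
  qed
  moreover have "{u \<in> G. u x \<in> T} = (\<Union>a\<in>T. {u \<in> G. u x = a})" by blast
  then have "card {u \<in> G. u x \<in> T} = (\<Sum>a\<in>T. card {u \<in> G. u x = a})"
    using assms(1) finite_group by (simp only:) (rule card_UN_disjoint, auto)
  ultimately show ?thesis by simp
qed

lemma card_eq_orbit_times_stabilizer:
  assumes "finite S" "\<And>a. a \<in> S \<Longrightarrow> \<exists>u\<in>G. u x = a" "\<And>u. u \<in> G \<Longrightarrow> u x \<in> S"
  shows "card G = card S * card {u \<in> G. u x = x}"
proof -
  have "{u \<in> G. u x \<in> S} = G" using assms(3) by blast
  then show ?thesis using card_point_transporters[OF assms(1,2)] by simp
qed

lemma induced_from_point_stabilizer:
  assumes "finite S" "\<And>a. a \<in> S \<Longrightarrow> \<exists>u\<in>G. u x = a" "\<And>u. u \<in> G \<Longrightarrow> u x \<in> S"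
    and "class_function G \<phi>" "\<And>h. h \<in> G \<Longrightarrow> h x = x \<Longrightarrow> f h = \<phi> h" "g \<in> G"
  shows "induced {h \<in> G. h x = x} G f g = of_nat (card {a \<in> S. g a = a}) * \<phi> g"
proof -
  let ?H = "{h \<in> G. h x = x}"
  have conj_mem_iff: "inv u \<circ> g \<circ> u \<in> ?H \<longleftrightarrow> u x \<in> {a \<in> S. g a = a}" if "u \<in> G" for u
    using that assms(3,6) by (auto simp: inv_conj_mem) (metis apply_inv, simp add: inv_apply)
  have conj_eq: "f (inv u \<circ> g \<circ> u) = \<phi> g" if "u \<in> G" "inv u \<circ> g \<circ> u \<in> ?H" for u
    using class_functionD[OF assms(4) that(1) inv_conj_mem[OF that(1) assms(6)]] that assms(5)
    by (simp add: inv_conj_conj)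
  have "{u. u \<in> G \<and> inv u \<circ> g \<circ> u \<in> ?H} = {u \<in> G. u x \<in> {a \<in> S. g a = a}}"
    using conj_mem_iff by blast
  then have card: "card {u. u \<in> G \<and> inv u \<circ> g \<circ> u \<in> ?H} = card {a \<in> S. g a = a} * card ?H"
    using assms(1,2) by (simp only:) (rule card_point_transporters, auto)
  have "induced ?H G f g = (\<Sum>u | u \<in> G \<and> inv u \<circ> g \<circ> u \<in> ?H. \<phi> g) / of_nat (card ?H)"
    unfolding induced_def if_P[OF assms(6)]
    using conj_eq by (intro arg_cong2[of _ _ _ _ "(/)"] sum.cong refl) blast
  also have "\<dots> = of_nat (card {a \<in> S. g a = a} * card ?H) * \<phi> g / of_nat (card ?H)"
    unfolding sum_constant card ..
  also have "\<dots> = of_nat (card {a \<in> S. g a = a}) * \<phi> g"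
  proof -
    have "card ?H \<noteq> 0" using finite_group id_mem by auto
    then show ?thesis by simp
  qed
  finally show ?thesis .
qed

lemma sum_induced_mult_class_function:
  assumes "H \<subseteq> G" "class_function G q"
  shows "(\<Sum>w\<in>G. induced H G f w * q w) = of_nat (card G) / of_nat (card H) * (\<Sum>h\<in>H. f h * q h)"
proof -
  let ?term = "\<lambda>u w. f (inv u \<circ> w \<circ> u) * q w / of_nat (card H)"
  have "(\<Sum>w\<in>G. induced H G f w * q w) = (\<Sum>w\<in>G. \<Sum>u\<in>G. if inv u \<circ> w \<circ> u \<in> H then ?term u w else 0)"
  proof (rule sum.cong[OF refl])
    fix w assume "w \<in> G"
    then have "induced H G f w * q w = (\<Sum>u\<in>{u \<in> G. inv u \<circ> w \<circ> u \<in> H}. ?term u w)"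
      by (simp add: induced_def sum_distrib_right sum_divide_distrib)
    then show "induced H G f w * q w = (\<Sum>u\<in>G. if inv u \<circ> w \<circ> u \<in> H then ?term u w else 0)"
      by (simp only: sum.inter_filter[OF finite_group])
  qed
  also have "\<dots> = (\<Sum>u\<in>G. \<Sum>w\<in>G. if inv u \<circ> w \<circ> u \<in> H then ?term u w else 0)"
    by (rule sum.swap)
  also have "\<dots> = (\<Sum>u\<in>G. \<Sum>h\<in>H. f h * q h / of_nat (card H))"
  proof (rule sum.cong[OF refl])
    fix u assume u: "u \<in> G"
    have "(\<Sum>w\<in>G. if inv u \<circ> w \<circ> u \<in> H then ?term u w else 0) = (\<Sum>w\<in>{w \<in> G. inv u \<circ> w \<circ> u \<in> H}. ?term u w)"
      by (rule sum.inter_filter[OF finite_group, symmetric])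
    also have "\<dots> = (\<Sum>h\<in>H. f h * q h / of_nat (card H))"
    proof (rule sum.reindex_bij_witness[of _ "\<lambda>h. u \<circ> h \<circ> inv u" "\<lambda>w. inv u \<circ> w \<circ> u"])
      fix w assume "w \<in> {w \<in> G. inv u \<circ> w \<circ> u \<in> H}"
      then show "f (inv u \<circ> w \<circ> u) * q (inv u \<circ> w \<circ> u) / of_nat (card H) = ?term u w"
        using class_functionD[OF assms(2) u, of "inv u \<circ> w \<circ> u"] u
        by (simp add: inv_conj_conj inv_conj_mem)
    qed (use u assms(1) in \<open>auto simp: inv_conj_conj conj_mem\<close>)
    finally show "(\<Sum>w\<in>G. if inv u \<circ> w \<circ> u \<in> H then ?term u w else 0)
        = (\<Sum>h\<in>H. f h * q h / of_nat (card H))" .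
  qed
  finally show ?thesis by (simp add: sum_divide_distrib[symmetric])
qed

lemma irreducible_character_class_function:
  assumes "irreducible_character G \<chi>" shows "class_function G \<chi>"
  unfolding class_function_def
proof (intro ballI)
  fix u h assume u: "u \<in> G" and h: "h \<in> G"
  obtain d \<rho> where rep: "representation G d \<rho>" and \<chi>: "\<chi> = (\<lambda>u. if u \<in> G then \<Sum>i<d. \<rho> u $$ (i, i) else 0)"
    using assms unfolding irreducible_character_def irreducible_representation_def by blast
  have trace_comp: "\<chi> (v \<circ> w) = (\<Sum>i<d. \<Sum>k<d. \<rho> v $$ (i, k) * \<rho> w $$ (k, i))" if "v \<in> G" "w \<in> G" for v w
  proof -
    have "\<chi> (v \<circ> w) = (\<Sum>i<d. (\<rho> v * \<rho> w) $$ (i, i))"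
      using rep that by (simp add: \<chi> comp_mem representation_def)
    also have "\<dots> = (\<Sum>i<d. \<Sum>k<d. \<rho> v $$ (i, k) * \<rho> w $$ (k, i))"
    proof (rule sum.cong[OF refl])
      have "\<rho> v \<in> carrier_mat d d" "\<rho> w \<in> carrier_mat d d"
        using rep that by (auto simp: representation_def)
      then show "(\<rho> v * \<rho> w) $$ (i, i) = (\<Sum>k<d. \<rho> v $$ (i, k) * \<rho> w $$ (k, i))" if "i \<in> {..<d}" for i
        using that by (simp add: scalar_prod_def lessThan_atLeast0)
    qed
    finally show ?thesis .
  qed
  have "\<chi> (u \<circ> h \<circ> inv u) = \<chi> (inv u \<circ> (u \<circ> h))"
    unfolding trace_comp[OF comp_mem[OF u h] inv_mem[OF u]] trace_comp[OF inv_mem[OF u] comp_mem[OF u h]]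
    by (subst sum.swap) (simp add: mult.commute)
  also have "inv u \<circ> (u \<circ> h) = h" using u by (simp add: inv_comp flip: comp_assoc)
  finally show "\<chi> (u \<circ> h \<circ> inv u) = \<chi> h" .
qed

end

lemma diagonal_mat_mult_vec:
  assumes "A \<in> carrier_mat d d" "diagonal_mat A" "x \<in> carrier_vec d" "p < d"
  shows "(A *\<^sub>v x) $ p = A $$ (p, p) * x $ p"
proof -
  have "(A *\<^sub>v x) $ p = (\<Sum>r\<in>{0..<d}. A $$ (p, r) * x $ r)"
    using assms by (simp add: scalar_prod_def)
  also have "\<dots> = (\<Sum>r\<in>{p}. A $$ (p, r) * x $ r)"
    using assms by (intro sum.mono_neutral_right) (auto simp: diagonal_mat_def)
  finally show ?thesis by simp
qed

lemma carrier_vec_subset_if_unit_vecs_mem: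
  assumes "0\<^sub>v d \<in> W" "\<And>x y. x \<in> W \<Longrightarrow> y \<in> W \<Longrightarrow> x + y \<in> W" "\<And>a x. x \<in> W \<Longrightarrow> a \<cdot>\<^sub>v x \<in> W"
    and units: "\<And>p. p < d \<Longrightarrow> unit_vec d p \<in> W"
  shows "carrier_vec d \<subseteq> (W :: complex vec set)"
proof
  fix y :: "complex vec" assume y: "y \<in> carrier_vec d"
  have "vec d (\<lambda>p. if p < k then y $ p else 0) \<in> W" if "k \<le> d" for k
    using that
  proof (induction k)
    case 0
    have "vec d (\<lambda>p. if p < 0 then y $ p else 0) = 0\<^sub>v d" by (intro eq_vecI) auto
    then show ?case using assms(1) by simp
  next
    case (Suc k)
    have "vec d (\<lambda>p. if p < Suc k then y $ p else 0)
        = vec d (\<lambda>p. if p < k then y $ p else 0) + y $ k \<cdot>\<^sub>v unit_vec d k"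
      using Suc.prems by (intro eq_vecI) (auto simp: less_Suc_eq)
    then show ?case using Suc units by (simp add: assms(2,3))
  qed
  moreover have "vec d (\<lambda>p. if p < d then y $ p else 0) = y" using y by (intro eq_vecI) auto
  ultimately show "y \<in> W" by (metis order_refl)
qed

text \<open>A nonzero vector of minimal support in an invariant subspace is a multiple of a basis vector: a
  diagonal operator with different eigenvalues on two basis vectors would allow one to shrink the support.\<close>

lemma unit_vec_mem_invariant_subspace:
  assumes "representation G d \<rho>" "invariant_subspace G d \<rho> W" "W \<noteq> {0\<^sub>v d}"
    and separated: "\<And>p q. p < d \<Longrightarrow> q < d \<Longrightarrow> p \<noteq> q \<Longrightarrow>
      \<exists>t\<in>G. diagonal_mat (\<rho> t) \<and> \<rho> t $$ (p, p) \<noteq> \<rho> t $$ (q, q)"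
  obtains p where "p < d" "unit_vec d p \<in> W"
proof -
  define supp where "supp x = {p. p < d \<and> x $ p \<noteq> 0}" for x :: "complex vec"
  have W: "W \<subseteq> carrier_vec d" "0\<^sub>v d \<in> W" "\<And>x y. x \<in> W \<Longrightarrow> y \<in> W \<Longrightarrow> x + y \<in> W"
    "\<And>a x. x \<in> W \<Longrightarrow> a \<cdot>\<^sub>v x \<in> W" "\<And>u x. u \<in> G \<Longrightarrow> x \<in> W \<Longrightarrow> \<rho> u *\<^sub>v x \<in> W"
    using assms(2) unfolding invariant_subspace_def by blast+
  have supp_empty: "supp x \<noteq> {}" if "x \<in> W" "x \<noteq> 0\<^sub>v d" for x
    using that W(1) by (auto simp: supp_def intro!: eq_vecI)
  obtain x where x: "x \<in> W" "supp x \<noteq> {}"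
    and minimal: "\<And>y. y \<in> W \<Longrightarrow> supp y \<noteq> {} \<Longrightarrow> card (supp x) \<le> card (supp y)"
  proof -
    obtain z where "z \<in> W \<and> supp z \<noteq> {}" using assms(3) W(2) supp_empty by blast
    from ex_has_least_nat[of "\<lambda>x. x \<in> W \<and> supp x \<noteq> {}", OF this, of "\<lambda>x. card (supp x)"]
    show ?thesis using that by blast
  qed
  have x_carrier: "x \<in> carrier_vec d" using x(1) W(1) by blast
  obtain p where p: "p < d" "x $ p \<noteq> 0" using x(2) by (auto simp: supp_def)
  have "x $ q = 0" if q: "q < d" "q \<noteq> p" for q
  proof (rule ccontr)
    assume "x $ q \<noteq> 0"
    obtain t where t: "t \<in> G" "diagonal_mat (\<rho> t)" "\<rho> t $$ (p, p) \<noteq> \<rho> t $$ (q, q)"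
      using separated[OF p(1) q(1)] q(2) by blast
    have \<rho>_carrier: "\<rho> t \<in> carrier_mat d d" using assms(1) t(1) by (simp add: representation_def)
    define y where "y = \<rho> t *\<^sub>v x + (- \<rho> t $$ (q, q)) \<cdot>\<^sub>v x"
    have y: "y $ r = (\<rho> t $$ (r, r) - \<rho> t $$ (q, q)) * x $ r" if "r < d" for r
      using that x_carrier \<rho>_carrier diagonal_mat_mult_vec[OF \<rho>_carrier t(2) x_carrier that]
      by (simp add: y_def algebra_simps)
    have "supp y \<subseteq> supp x - {q}" using y by (auto simp: supp_def)
    also have "\<dots> \<subset> supp x" using q(1) \<open>x $ q \<noteq> 0\<close> by (auto simp: supp_def)
    finally have "card (supp y) < card (supp x)" by (intro psubset_card_mono) (auto simp: supp_def)
    moreover have "y \<in> W" using W x(1) t(1) by (simp add: y_def)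
    moreover have "p \<in> supp y" using y[OF p(1)] p t(3) by (simp add: supp_def)
    ultimately show False using minimal[of y] by fastforce
  qed
  then have "unit_vec d p = (1 / x $ p) \<cdot>\<^sub>v x" using p x_carrier by (intro eq_vecI) auto
  then show ?thesis using that p(1) W(4)[OF x(1)] by metis
qed

lemma irreducible_representationI:
  assumes "representation G d \<rho>" "d > 0"
    and separated: "\<And>p q. p < d \<Longrightarrow> q < d \<Longrightarrow> p \<noteq> q \<Longrightarrow>
      \<exists>t\<in>G. diagonal_mat (\<rho> t) \<and> \<rho> t $$ (p, p) \<noteq> \<rho> t $$ (q, q)"
    and transitive: "\<And>p q. p < d \<Longrightarrow> q < d \<Longrightarrow>
      \<exists>u\<in>G. \<exists>a. a \<noteq> 0 \<and> \<rho> u *\<^sub>v unit_vec d p = a \<cdot>\<^sub>v unit_vec d q"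
  shows "irreducible_representation G d \<rho>"
  unfolding irreducible_representation_def
proof (intro conjI allI impI disjCI)
  fix W assume inv: "invariant_subspace G d \<rho> W" and "W \<noteq> carrier_vec d"
  have W: "W \<subseteq> carrier_vec d" "0\<^sub>v d \<in> W" "\<And>x y. x \<in> W \<Longrightarrow> y \<in> W \<Longrightarrow> x + y \<in> W"
    "\<And>a x. x \<in> W \<Longrightarrow> a \<cdot>\<^sub>v x \<in> W" "\<And>u x. u \<in> G \<Longrightarrow> x \<in> W \<Longrightarrow> \<rho> u *\<^sub>v x \<in> W"
    using inv unfolding invariant_subspace_def by blast+
  show "W = {0\<^sub>v d}"
  proof (rule ccontr)
    assume "W \<noteq> {0\<^sub>v d}"
    then obtain p where p: "p < d" "unit_vec d p \<in> W"
      using unit_vec_mem_invariant_subspace[OF assms(1) inv _ separated] by blast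
    have "unit_vec d q \<in> W" if q: "q < d" for q
    proof -
      obtain u a where u: "u \<in> G" "a \<noteq> 0" "\<rho> u *\<^sub>v unit_vec d p = a \<cdot>\<^sub>v unit_vec d q"
        using transitive[OF p(1) q] by blast
      then have "unit_vec d q = (1 / a) \<cdot>\<^sub>v (\<rho> u *\<^sub>v unit_vec d p)" by (simp add: smult_smult_assoc)
      then show ?thesis using W(4) W(5)[OF u(1) p(2)] by simp
    qed
    then have "carrier_vec d \<subseteq> W" using W(2-4) by (intro carrier_vec_subset_if_unit_vecs_mem)
    then show False using W(1) \<open>W \<noteq> carrier_vec d\<close> by blast
  qed
qed (use assms in blast)+

section \<open>The hyperoctahedral group\<close>

abbreviation signed_letters :: "nat \<Rightarrow> int set" where
  "signed_letters n \<equiv> {- int n..int n} - {0}"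

lemma signed_letters_iff: "i \<in> signed_letters n \<longleftrightarrow> \<bar>i\<bar> \<in> {1..int n}"
  by auto

lemma signed_perms_permutes: "w \<in> signed_perms n \<Longrightarrow> w permutes signed_letters n"
  and signed_perms_uminus: "w \<in> signed_perms n \<Longrightarrow> w (- i) = - w i"
  by (simp_all add: signed_perms_def)

lemma signed_perms_inj: "w \<in> signed_perms n \<Longrightarrow> inj w"
  by (rule permutes_inj[OF signed_perms_permutes])

lemma signed_perms_0: "w \<in> signed_perms n \<Longrightarrow> w 0 = 0"
  by (rule permutes_not_in[OF signed_perms_permutes]) auto

lemma signed_perms_eq_0_iff: "w \<in> signed_perms n \<Longrightarrow> w i = 0 \<longleftrightarrow> i = 0"
  using inj_eq[OF signed_perms_inj, of w n i 0] by (simp add: signed_perms_0)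

lemma abs_sgn_signed_perms: "w \<in> signed_perms n \<Longrightarrow> i \<noteq> 0 \<Longrightarrow> \<bar>sgn (w i)\<bar> = 1"
  by (simp add: abs_sgn_eq signed_perms_eq_0_iff)

lemma signed_perms_abs_mem_iff: "w \<in> signed_perms n \<Longrightarrow> \<bar>w i\<bar> \<in> {1..int n} \<longleftrightarrow> \<bar>i\<bar> \<in> {1..int n}"
  using permutes_in_image[OF signed_perms_permutes] unfolding signed_letters_iff .

lemma signed_perms_outside: "w \<in> signed_perms n \<Longrightarrow> \<bar>i\<bar> \<notin> {1..int n} \<Longrightarrow> w i = i"
  unfolding signed_letters_iff[symmetric] by (rule permutes_not_in[OF signed_perms_permutes])

lemma signed_perms_sign_mult: "w \<in> signed_perms n \<Longrightarrow> \<bar>s\<bar> = 1 \<Longrightarrow> w (s * i) = s * w i"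
  using signed_perms_uminus by (auto simp: abs_if split: if_splits)

lemma signed_perms_abs_eq_iff:
  assumes "w \<in> signed_perms n" shows "\<bar>w i\<bar> = \<bar>w j\<bar> \<longleftrightarrow> \<bar>i\<bar> = \<bar>j\<bar>"
  unfolding abs_eq_iff signed_perms_uminus[OF assms, symmetric] inj_eq[OF signed_perms_inj[OF assms]] ..

lemma signed_perms_eqI:
  assumes "u \<in> signed_perms n" "v \<in> signed_perms n" "\<And>i. i \<in> {1..int n} \<Longrightarrow> u i = v i"
  shows "u = v"
proof
  fix i show "u i = v i"
  proof (cases "\<bar>i\<bar> \<in> {1..int n}")
    case True
    then have "u \<bar>i\<bar> = v \<bar>i\<bar>" by (rule assms(3))
    then show ?thesis
      using signed_perms_uminus[OF assms(1), of i] signed_perms_uminus[OF assms(2), of i]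
      by (cases "0 \<le> i") simp_all
  qed (use assms signed_perms_outside in metis)
qed

interpretation signed_perms: finite_permutation_group "signed_perms n" for n
proof
  show "finite (signed_perms n)"
    by (rule finite_subset[of _ "{w. w permutes signed_letters n}"])
      (auto simp: signed_perms_permutes finite_permutations)
  show "id \<in> signed_perms n" by (simp add: signed_perms_def permutes_id)
  show "u \<circ> v \<in> signed_perms n" if "u \<in> signed_perms n" "v \<in> signed_perms n" for u v
    using that by (auto simp: signed_perms_def intro: permutes_compose)
  fix u assume u: "u \<in> signed_perms n"
  note p = signed_perms_permutes[OF u]
  show "bij u" by (rule permutes_bij[OF p])
  have "inv u (- i) = - inv u i" for i
    using signed_perms_uminus[OF u] permutes_inverses[OF p] by (simp add: permutes_inv_eq[OF p])
  then show "inv u \<in> signed_perms n" using permutes_inv[OF p] by (simp add: signed_perms_def)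
qed

definition unsigned :: "(int \<Rightarrow> int) \<Rightarrow> int \<Rightarrow> int" where
  "unsigned w i = (if 0 < i then \<bar>w i\<bar> else i)"

definition odd_extension :: "nat \<Rightarrow> (int \<Rightarrow> int) \<Rightarrow> int \<Rightarrow> int" where
  "odd_extension n f i = (if \<bar>i\<bar> \<in> {1..int n} then sgn i * f \<bar>i\<bar> else i)"

lemma unsigned_pos: "0 < i \<Longrightarrow> unsigned w i = \<bar>w i\<bar>"
  by (simp add: unsigned_def)

lemma eq_sgn_mult_unsigned: "0 < i \<Longrightarrow> w i = sgn (w i) * unsigned w i"
  by (simp add: unsigned_def sgn_mult_abs)

lemma unsigned_permutes:
  assumes "w \<in> signed_perms n" shows "unsigned w permutes {1..int n}"
proof (rule bij_imp_permutes)
  have inj: "inj_on (unsigned w) {1..int n}"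
    by (rule inj_onI) (simp add: unsigned_def signed_perms_abs_eq_iff[OF assms])
  have "unsigned w ` {1..int n} \<subseteq> {1..int n}"
    using signed_perms_abs_mem_iff[OF assms] by (auto simp: unsigned_def)
  then show "bij_betw (unsigned w) {1..int n} {1..int n}"
    using inj by (simp add: bij_betw_def endo_inj_surj)
  show "unsigned w i = i" if "i \<notin> {1..int n}" for i
    using that signed_perms_outside[OF assms, of i] by (auto simp: unsigned_def)
qed

lemma unsigned_mem: "w \<in> signed_perms n \<Longrightarrow> i \<in> {1..int n} \<Longrightarrow> unsigned w i \<in> {1..int n}"
  by (simp only: permutes_in_image[OF unsigned_permutes])

lemma unsigned_inj: "w \<in> signed_perms n \<Longrightarrow> inj (unsigned w)"
  by (rule permutes_inj[OF unsigned_permutes])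

lemma unsigned_permutation: "w \<in> signed_perms n \<Longrightarrow> permutation (unsigned w)"
  using unsigned_permutes permutation_permutes by blast

lemma unsigned_id: "unsigned id = id"
  by (auto simp: unsigned_def)

lemma unsigned_comp:
  assumes "u \<in> signed_perms n" "v \<in> signed_perms n"
  shows "unsigned (u \<circ> v) = unsigned u \<circ> unsigned v"
proof
  fix i show "unsigned (u \<circ> v) i = (unsigned u \<circ> unsigned v) i"
    using signed_perms_eq_0_iff[OF assms(2), of i] signed_perms_abs_eq_iff[OF assms(1), of "\<bar>v i\<bar>" "v i"]
    by (simp add: unsigned_def)
qed

lemma odd_extension_signed_perm:
  assumes "\<And>i. i \<in> {1..int n} \<Longrightarrow> \<bar>f i\<bar> \<in> {1..int n}" "inj_on (\<lambda>i. \<bar>f i\<bar>) {1..int n}"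
  shows "odd_extension n f \<in> signed_perms n"
proof -
  have abs: "\<bar>odd_extension n f i\<bar> = \<bar>f \<bar>i\<bar>\<bar>" if "\<bar>i\<bar> \<in> {1..int n}" for i
    using that by (auto simp: odd_extension_def abs_mult)
  have "odd_extension n f permutes signed_letters n"
  proof (rule bij_imp_permutes)
    have "odd_extension n f ` signed_letters n \<subseteq> signed_letters n"
    proof (rule image_subsetI, unfold signed_letters_iff)
      show "\<bar>odd_extension n f i\<bar> \<in> {1..int n}" if "\<bar>i\<bar> \<in> {1..int n}" for i
        unfolding abs[OF that] using that by (rule assms(1))
    qed
    moreover have "inj_on (odd_extension n f) (signed_letters n)"
    proof (rule inj_onI, unfold signed_letters_iff)
      fix i j assume mem: "\<bar>i\<bar> \<in> {1..int n}" "\<bar>j\<bar> \<in> {1..int n}"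
        and eq: "odd_extension n f i = odd_extension n f j"
      then have "\<bar>f \<bar>i\<bar>\<bar> = \<bar>f \<bar>j\<bar>\<bar>" using abs by metis
      then have "\<bar>i\<bar> = \<bar>j\<bar>" using inj_onD[OF assms(2) _ mem] by simp
      moreover have "f \<bar>i\<bar> \<noteq> 0" using assms(1)[OF mem(1)] by auto
      ultimately have "sgn i = sgn j" using eq mem by (simp add: odd_extension_def)
      then show "i = j" using \<open>\<bar>i\<bar> = \<bar>j\<bar>\<close> by (metis mult_sgn_abs)
    qed
    ultimately show "bij_betw (odd_extension n f) (signed_letters n) (signed_letters n)"
      by (simp add: bij_betw_def endo_inj_surj)
  qed (unfold signed_letters_iff odd_extension_def, simp only: if_False)
  then show ?thesis by (simp add: signed_perms_def odd_extension_def)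
qed

lemma odd_extension_apply: "i \<in> {1..int n} \<Longrightarrow> odd_extension n f i = f i"
  by (simp add: odd_extension_def)

lemma odd_extension_permutes:
  assumes "p permutes {1..int n}"
  shows "odd_extension n p \<in> signed_perms n" "unsigned (odd_extension n p) = p"
proof -
  have mem: "p i \<in> {1..int n}" if "i \<in> {1..int n}" for i using permutes_in_image[OF assms] that by blast
  show "odd_extension n p \<in> signed_perms n"
  proof (rule odd_extension_signed_perm)
    show "\<bar>p i\<bar> \<in> {1..int n}" if "i \<in> {1..int n}" for i using mem[OF that] by simp
    have "\<bar>p i\<bar> = p i" if "i \<in> {1..int n}" for i using mem[OF that] by simp
    then show "inj_on (\<lambda>i. \<bar>p i\<bar>) {1..int n}"
      using inj_on_cong[of "{1..int n}" "\<lambda>i. \<bar>p i\<bar>" p] permutes_inj_on[OF assms] by blast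
  qed
  show "unsigned (odd_extension n p) = p"
  proof
    fix i show "unsigned (odd_extension n p) i = p i"
      using mem[of i] permutes_not_in[OF assms, of i] by (auto simp: unsigned_def odd_extension_def)
  qed
qed

definition sign_flip :: "nat \<Rightarrow> int \<Rightarrow> int \<Rightarrow> int" where
  "sign_flip n k = odd_extension n (\<lambda>i. if i = k then - i else i)"

lemma sign_flip_apply: "i \<in> {1..int n} \<Longrightarrow> sign_flip n k i = (if i = k then - i else i)"
  by (simp add: sign_flip_def odd_extension_apply)

lemma sign_flip_mem: "sign_flip n k \<in> signed_perms n"
  unfolding sign_flip_def by (rule odd_extension_signed_perm) (auto simp: inj_on_def split: if_splits)

lemma unsigned_sign_flip: "unsigned (sign_flip n k) = id"
  by (auto simp: fun_eq_iff unsigned_def sign_flip_def odd_extension_def)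

lemma sign_flip_involution: "sign_flip n k \<circ> sign_flip n k = id"
proof (rule signed_perms_eqI[OF signed_perms.comp_mem[OF sign_flip_mem sign_flip_mem] signed_perms.id_mem])
  fix i assume "i \<in> {1..int n}"
  then show "(sign_flip n k \<circ> sign_flip n k) i = id i"
    by (simp add: sign_flip_apply signed_perms_uminus[OF sign_flip_mem])
qed

lemma signed_perms_transitive:
  assumes "i \<in> {1..int n}" "a \<in> signed_letters n"
  shows "\<exists>u\<in>signed_perms n. u i = a"
proof -
  have "transpose i \<bar>a\<bar> permutes {1..int n}"
    using assms unfolding signed_letters_iff by (rule permutes_swap_id)
  note swap = odd_extension_permutes(1)[OF this]
  show ?thesis
  proof (cases "0 < a")
    case True
    then show ?thesis using swap assms(1) by (intro bexI[OF _ swap]) (simp add: odd_extension_apply)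
  next
    case False
    let ?u = "odd_extension n (transpose i \<bar>a\<bar>) \<circ> sign_flip n i"
    have "?u i = - odd_extension n (transpose i \<bar>a\<bar>) i"
      using assms(1) signed_perms_uminus[OF swap] by (simp add: sign_flip_apply)
    then have "?u i = a" using False assms(1) by (simp add: odd_extension_apply)
    then show ?thesis using signed_perms.comp_mem[OF swap sign_flip_mem] by blast
  qed
qed

lemma signed_perms_point_stabilizer:
  assumes "n \<ge> 1" shows "signed_perms (n - 1) = {u \<in> signed_perms n. u (int n) = int n}"
proof -
  let ?T = "signed_letters (n - 1)"
  have "u permutes ?T \<longleftrightarrow> u permutes signed_letters n \<and> u (int n) = int n"
    if odd: "\<forall>i. u (- i) = - u i" for u
  proof
    assume u: "u permutes ?T"
    have "?T \<subseteq> signed_letters n" "int n \<notin> ?T" using assms by auto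
    then show "u permutes signed_letters n \<and> u (int n) = int n"
      by (intro conjI permutes_subset[OF u] permutes_not_in[OF u])
  next
    assume u: "u permutes signed_letters n \<and> u (int n) = int n"
    have "u i = i" if "i \<in> signed_letters n - ?T" for i
    proof -
      have "i = int n \<or> i = - int n" using that assms by auto
      then show ?thesis using u odd by auto
    qed
    then show "u permutes ?T" by (rule permutes_superset[OF conjunct1[OF u]])
  qed
  then show ?thesis by (auto simp: signed_perms_def)
qed

lemma signed_perms_point_orbit:
  "n \<ge> 1 \<Longrightarrow> u \<in> signed_perms n \<Longrightarrow> u (int n) \<in> signed_letters n"
  using permutes_in_image[OF signed_perms_permutes, of u n "int n"] by simp

lemma card_signed_perms: "card (signed_perms n) = 2 ^ n * fact n"
proof (induction n)
  case 0
  have "signed_perms 0 = {id}"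
    using signed_perms.id_mem signed_perms_eqI[OF _ signed_perms.id_mem, of _ 0] by auto
  then show ?case by simp
next
  case (Suc n)
  have "card (signed_perms (Suc n)) = card (signed_letters (Suc n))
      * card {u \<in> signed_perms (Suc n). u (int (Suc n)) = int (Suc n)}"
    using signed_perms_transitive[of "int (Suc n)" "Suc n"] signed_perms_point_orbit[of "Suc n"]
    by (intro signed_perms.card_eq_orbit_times_stabilizer) simp_all
  also have "{u \<in> signed_perms (Suc n). u (int (Suc n)) = int (Suc n)} = signed_perms n"
    using signed_perms_point_stabilizer[of "Suc n"] by simp
  also have "card (signed_letters (Suc n)) = 2 * Suc n" by (simp add: card_Diff_singleton)
  finally show ?case using Suc by (simp add: algebra_simps)
qed

section \<open>Signed cycle types\<close>

definition abs_cycles :: "nat \<Rightarrow> (int \<Rightarrow> int) \<Rightarrow> int set set" where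
  "abs_cycles n w = orbit (unsigned w) ` {1..int n}"

definition cycle_sign :: "(int \<Rightarrow> int) \<Rightarrow> int set \<Rightarrow> int" where
  "cycle_sign w b = (\<Prod>i\<in>b. sgn (w i))"

lemma finite_abs_cycles: "finite (abs_cycles n w)"
  by (simp add: abs_cycles_def)

lemma orbit_mem_abs_cycles: "i \<in> {1..int n} \<Longrightarrow> orbit (unsigned w) i \<in> abs_cycles n w"
  unfolding abs_cycles_def by (rule imageI)

lemma partition_on_abs_cycles: "w \<in> signed_perms n \<Longrightarrow> partition_on {1..int n} (abs_cycles n w)"
  unfolding abs_cycles_def by (simp add: partition_on_orbits unsigned_permutes)

lemma abs_cycle_subset:
  assumes "w \<in> signed_perms n" "b \<in> abs_cycles n w" shows "b \<subseteq> {1..int n}"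
  unfolding partition_onD1[OF partition_on_abs_cycles[OF assms(1)]] using assms(2) by (rule Union_upper)

lemma finite_abs_cycle: "w \<in> signed_perms n \<Longrightarrow> b \<in> abs_cycles n w \<Longrightarrow> finite b"
  by (rule finite_subset[OF abs_cycle_subset]) simp_all

lemma abs_cycle_nonempty: "b \<in> abs_cycles n w \<Longrightarrow> b \<noteq> {}"
  by (auto simp: abs_cycles_def orbit_nonempty)

lemma abs_cycles_disjoint:
  assumes "w \<in> signed_perms n" "b \<in> abs_cycles n w" "c \<in> abs_cycles n w" "b \<noteq> c"
  shows "b \<inter> c = {}"
  by (rule disjointD[OF partition_onD2[OF partition_on_abs_cycles[OF assms(1)]] assms(2-4)])

lemma self_mem_orbit: "w \<in> signed_perms n \<Longrightarrow> i \<in> orbit (unsigned w) i"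
  by (rule permutation_self_in_orbit[OF unsigned_permutation])

lemma abs_cycle_eq_orbit:
  assumes "w \<in> signed_perms n" "b \<in> abs_cycles n w" "i \<in> b" shows "orbit (unsigned w) i = b"
proof -
  obtain j where "b = orbit (unsigned w) j" using assms(2) by (auto simp: abs_cycles_def)
  then show ?thesis using orbit_eq_of_mem[OF unsigned_permutation[OF assms(1)]] assms(3) by blast
qed

lemma abs_cycle_sign:
  assumes "w \<in> signed_perms n" "b \<subseteq> {1..int n}" shows "\<bar>cycle_sign w b\<bar> = 1"
proof -
  have "\<bar>sgn (w i)\<bar> = 1" if "i \<in> b" for i
    using that assms(2) by (intro abs_sgn_signed_perms[OF assms(1)]) auto
  then show ?thesis by (simp add: cycle_sign_def abs_prod)
qed

lemma cycle_sign_cases: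
  assumes "w \<in> signed_perms n" "b \<in> abs_cycles n w"
  shows "cycle_sign w b = 1 \<or> cycle_sign w b = - 1"
  using abs_cycle_sign[OF assms(1) abs_cycle_subset[OF assms]] by linarith

subsection \<open>Powers of signed permutations\<close>

lemma signed_perms_funpow: "w \<in> signed_perms n \<Longrightarrow> w ^^ k \<in> signed_perms n"
  by (induction k) (auto intro: signed_perms.comp_mem signed_perms.id_mem)

lemma unsigned_funpow: "w \<in> signed_perms n \<Longrightarrow> unsigned (w ^^ k) = unsigned w ^^ k"
  by (induction k) (simp_all add: unsigned_id unsigned_comp signed_perms_funpow)

lemma abs_funpow: "w \<in> signed_perms n \<Longrightarrow> 0 < i \<Longrightarrow> \<bar>(w ^^ k) i\<bar> = (unsigned w ^^ k) i"
  by (simp add: unsigned_pos flip: unsigned_funpow)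

lemma funpow_eq_prod_sgn:
  assumes "w \<in> signed_perms n" "0 < i"
  shows "(w ^^ k) i = (\<Prod>t<k. sgn (w ((unsigned w ^^ t) i))) * (unsigned w ^^ k) i"
proof (induction k)
  case (Suc k)
  let ?s = "\<Prod>t<k. sgn (w ((unsigned w ^^ t) i))" and ?j = "(unsigned w ^^ k) i"
  have pos: "0 < (unsigned w ^^ t) i" for t
    using signed_perms_eq_0_iff[OF signed_perms_funpow[OF assms(1)], of t i] assms(2)
    by (simp add: flip: abs_funpow[OF assms])
  then have "\<bar>?s\<bar> = 1"
    using abs_sgn_signed_perms[OF assms(1)] by (simp add: abs_prod less_imp_neq[symmetric])
  then have "(w ^^ Suc k) i = ?s * w ?j" by (simp add: Suc signed_perms_sign_mult[OF assms(1)])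
  also have "w ?j = sgn (w ?j) * unsigned w ?j" using pos by (rule eq_sgn_mult_unsigned)
  finally show ?case by simp
qed simp

lemma funpow_card_orbit:
  assumes "w \<in> signed_perms n" "0 < i"
  shows "(w ^^ card (orbit (unsigned w) i)) i = cycle_sign w (orbit (unsigned w) i) * i"
proof -
  note p = unsigned_permutation[OF assms(1)]
  let ?b = "orbit (unsigned w) i"
  have "(\<Prod>t<card ?b. sgn (w ((unsigned w ^^ t) i))) = cycle_sign w ?b"
    unfolding cycle_sign_def by (rule prod.reindex_bij_betw[OF bij_betw_funpow_orbit[OF p]])
  moreover have "(unsigned w ^^ card ?b) i = i"
    unfolding least_power_eq_card_orbit[OF p, symmetric] by (rule least_power_of_permutation[OF p])
  ultimately show ?thesis using funpow_eq_prod_sgn[OF assms] by simp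
qed

lemma funpow_eq_sign_mult_iff:
  assumes "w \<in> signed_perms n" "i \<in> {1..int n}" "\<bar>s\<bar> = 1"
  defines "b \<equiv> orbit (unsigned w) i"
  shows "(w ^^ k) i = s * i \<longleftrightarrow> card b dvd k \<and> s = cycle_sign w b ^ (k div card b)"
proof -
  have pos: "0 < i" using assms(2) by simp
  note p = unsigned_permutation[OF assms(1)]
  have sign: "\<bar>cycle_sign w b ^ q\<bar> = 1" for q
    using abs_cycle_sign[OF assms(1) abs_cycle_subset[OF assms(1) orbit_mem_abs_cycles[OF assms(2)]]]
    by (simp add: b_def power_abs)
  have multiple: "(w ^^ (card b * q)) i = cycle_sign w b ^ q * i" for q
  proof (induction q)
    case (Suc q)
    have "(w ^^ (card b * Suc q)) i = (w ^^ card b) (cycle_sign w b ^ q * i)"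
      by (simp add: funpow_add Suc)
    then show ?case
      using signed_perms_sign_mult[OF signed_perms_funpow[OF assms(1)] sign] funpow_card_orbit[OF assms(1) pos]
      by (simp add: b_def)
  qed simp
  have "(unsigned w ^^ k) i = i \<longleftrightarrow> card b dvd k"
    unfolding b_def least_power_eq_card_orbit[OF p, symmetric]
    by (rule least_power_dvd[OF p, symmetric])
  then have "(w ^^ k) i = s * i \<Longrightarrow> card b dvd k"
    using abs_funpow[OF assms(1) pos, of k] assms(3) pos by (simp add: abs_mult)
  then show ?thesis using multiple[of "k div card b"] pos by auto
qed

subsection \<open>Cycles on signed letters\<close>

definition symmetrize :: "int set \<Rightarrow> int set" where
  "symmetrize b = b \<union> uminus ` b"

lemma mem_uminus_image: "i \<in> uminus ` A \<longleftrightarrow> - i \<in> A" for i :: int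
  by (simp add: image_iff equation_minus_iff[of i])

lemma mem_symmetrize_iff:
  assumes "b \<subseteq> {0<..}" shows "i \<in> symmetrize b \<longleftrightarrow> \<bar>i\<bar> \<in> b"
  unfolding symmetrize_def Un_iff mem_uminus_image
  using subsetD[OF assms, of i] subsetD[OF assms, of "- i"] by (cases "0 < i") auto

lemma symmetrize_Int_pos:
  assumes "b \<subseteq> {0<..}" shows "symmetrize b \<inter> {0<..} = b"
proof (rule Set.set_eqI)
  fix i show "i \<in> symmetrize b \<inter> {0<..} \<longleftrightarrow> i \<in> b"
    using mem_symmetrize_iff[OF assms, of i] subsetD[OF assms, of i] by auto
qed

lemma card_symmetrize:
  assumes "finite b" "b \<subseteq> {0<..}" shows "card (symmetrize b) = 2 * card b"
proof -
  have "- i \<notin> b" if "i \<in> b" for i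
    using that subsetD[OF assms(2), of i] subsetD[OF assms(2), of "- i"] by auto
  then have "b \<inter> uminus ` b = {}" unfolding disjoint_iff mem_uminus_image by blast
  then show ?thesis using assms(1) by (simp add: symmetrize_def card_Un_disjoint card_image)
qed

lemma abs_cycle_pos: "w \<in> signed_perms n \<Longrightarrow> b \<in> abs_cycles n w \<Longrightarrow> b \<subseteq> {0<..}"
  by (rule subset_trans[OF abs_cycle_subset]) auto

lemma signed_perms_orbit_eq_range: "w \<in> signed_perms n \<Longrightarrow> orbit w i = range (\<lambda>k. (w ^^ k) i)"
  by (intro orbit_eq_range permutes_imp_permutation[OF _ signed_perms_permutes]) simp

lemma orbit_uminus: "w \<in> signed_perms n \<Longrightarrow> orbit w (- i) = uminus ` orbit w i"
  by (simp add: signed_perms_orbit_eq_range image_image signed_perms_uminus[OF signed_perms_funpow])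

lemma symmetrize_orbit:
  assumes "w \<in> signed_perms n" "i \<in> signed_letters n"
  shows "symmetrize (orbit w i) = symmetrize (orbit (unsigned w) \<bar>i\<bar>)"
proof -
  have mem: "\<bar>i\<bar> \<in> {1..int n}" using assms(2) by (simp only: signed_letters_iff)
  have abs: "\<bar>(w ^^ k) i\<bar> = (unsigned w ^^ k) \<bar>i\<bar>" for k
    using signed_perms_abs_eq_iff[OF signed_perms_funpow[OF assms(1)], of k i "\<bar>i\<bar>"]
      abs_funpow[OF assms(1), of "\<bar>i\<bar>" k] assms(2) by simp
  have "j \<in> symmetrize (orbit w i) \<longleftrightarrow> \<bar>j\<bar> \<in> orbit (unsigned w) \<bar>i\<bar>" for j
    unfolding symmetrize_def Un_iff mem_uminus_image signed_perms_orbit_eq_range[OF assms(1)]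
      orbit_eq_range[OF unsigned_permutation[OF assms(1)]] abs[symmetric]
    by (auto simp: image_iff abs_eq_iff minus_equation_iff[of j])
  then show ?thesis
    using mem_symmetrize_iff[OF abs_cycle_pos[OF assms(1) orbit_mem_abs_cycles[OF mem]]] by blast
qed

lemma uminus_orbit_eq_iff:
  assumes "w \<in> signed_perms n" "i \<in> signed_letters n"
  shows "uminus ` orbit w i = orbit w i \<longleftrightarrow> cycle_sign w (orbit (unsigned w) \<bar>i\<bar>) = - 1"
proof -
  have mem: "\<bar>i\<bar> \<in> {1..int n}" using assms(2) by (simp only: signed_letters_iff)
  let ?b = "orbit (unsigned w) \<bar>i\<bar>"
  have p: "permutation w" using signed_perms_permutes[OF assms(1)] permutation_permutes by blast
  have "uminus ` orbit w i = orbit w i \<longleftrightarrow> - i \<in> orbit w i"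
    using orbit_uminus[OF assms(1), of i] orbit_eq_of_mem[OF p] permutation_self_in_orbit[OF p] by metis
  also have "\<dots> \<longleftrightarrow> (\<exists>k. (w ^^ k) i = - i)"
    unfolding signed_perms_orbit_eq_range[OF assms(1)] image_iff bex_UNIV by (intro ex_cong1 eq_commute)
  also have "\<dots> \<longleftrightarrow> (\<exists>k. (w ^^ k) \<bar>i\<bar> = - 1 * \<bar>i\<bar>)"
  proof (rule ex_cong1)
    fix k show "(w ^^ k) i = - i \<longleftrightarrow> (w ^^ k) \<bar>i\<bar> = - 1 * \<bar>i\<bar>"
      using signed_perms_uminus[OF signed_perms_funpow[OF assms(1)], of k i] by (auto simp: abs_if)
  qed
  also have "\<dots> \<longleftrightarrow> (\<exists>k. card ?b dvd k \<and> - 1 = cycle_sign w ?b ^ (k div card ?b))"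
    using funpow_eq_sign_mult_iff[OF assms(1) mem, of "- 1"] by simp
  also have "\<dots> \<longleftrightarrow> cycle_sign w ?b = - 1"
  proof
    assume "\<exists>k. card ?b dvd k \<and> - 1 = cycle_sign w ?b ^ (k div card ?b)"
    then show "cycle_sign w ?b = - 1"
      using cycle_sign_cases[OF assms(1) orbit_mem_abs_cycles[OF mem]] by auto
  next
    have "card ?b \<noteq> 0"
      using finite_abs_cycle[OF assms(1) orbit_mem_abs_cycles[OF mem]] orbit_nonempty by simp
    moreover assume "cycle_sign w ?b = - 1"
    ultimately show "\<exists>k. card ?b dvd k \<and> - 1 = cycle_sign w ?b ^ (k div card ?b)"
      by (intro exI[of _ "card ?b"]) simp
  qed
  finally show ?thesis .
qed

lemma abs_cycles_eq_image_signed_letters: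
  "abs_cycles n w = (\<lambda>i. orbit (unsigned w) \<bar>i\<bar>) ` signed_letters n"
proof -
  have "abs ` signed_letters n = {1..int n}"
  proof (intro equalityI subsetI)
    show "i \<in> abs ` signed_letters n" if "i \<in> {1..int n}" for i
      using that by (intro image_eqI[of _ _ i]) auto
  qed auto
  then show ?thesis unfolding abs_cycles_def by (metis image_image)
qed

lemma pos_cycles_eq:
  assumes "w \<in> signed_perms n"
  shows "pos_cycles n w = symmetrize ` {b \<in> abs_cycles n w. cycle_sign w b = 1}"
proof -
  have "pos_cycles n w = (\<lambda>i. symmetrize (orbit w i)) ` {i \<in> signed_letters n. uminus ` orbit w i \<noteq> orbit w i}"
    unfolding pos_cycles_def cycles_def symmetrize_def by blast
  also have "\<dots> = (\<lambda>i. symmetrize (orbit (unsigned w) \<bar>i\<bar>))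
      ` {i \<in> signed_letters n. cycle_sign w (orbit (unsigned w) \<bar>i\<bar>) \<noteq> - 1}"
    using symmetrize_orbit[OF assms] uminus_orbit_eq_iff[OF assms] by (intro image_cong) blast+
  also have "\<dots> = symmetrize ` {b \<in> abs_cycles n w. cycle_sign w b \<noteq> - 1}"
    unfolding abs_cycles_eq_image_signed_letters by blast
  also have "{b \<in> abs_cycles n w. cycle_sign w b \<noteq> - 1} = {b \<in> abs_cycles n w. cycle_sign w b = 1}"
    by (auto dest: cycle_sign_cases[OF assms])
  finally show ?thesis .
qed

lemma neg_cycles_eq:
  assumes "w \<in> signed_perms n"
  shows "neg_cycles n w = symmetrize ` {b \<in> abs_cycles n w. cycle_sign w b = - 1}"
proof -
  have "neg_cycles n w = symmetrize ` {c \<in> cycles n w. uminus ` c = c}"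
    unfolding neg_cycles_def symmetrize_def by force
  also have "\<dots> = (\<lambda>i. symmetrize (orbit w i)) ` {i \<in> signed_letters n. uminus ` orbit w i = orbit w i}"
    unfolding cycles_def by blast
  also have "\<dots> = (\<lambda>i. symmetrize (orbit (unsigned w) \<bar>i\<bar>))
      ` {i \<in> signed_letters n. cycle_sign w (orbit (unsigned w) \<bar>i\<bar>) = - 1}"
    using symmetrize_orbit[OF assms] uminus_orbit_eq_iff[OF assms] by (intro image_cong) blast+
  also have "\<dots> = symmetrize ` {b \<in> abs_cycles n w. cycle_sign w b = - 1}"
    unfolding abs_cycles_eq_image_signed_letters by blast
  finally show ?thesis .
qed

lemma signed_cycle_type_eq:
  assumes "w \<in> signed_perms n"
  shows "signed_cycle_type n w =
    (image_mset card (mset_set {b \<in> abs_cycles n w. cycle_sign w b = 1}),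
     image_mset card (mset_set {b \<in> abs_cycles n w. cycle_sign w b = - 1}))"
proof -
  have "image_mset (\<lambda>c. card c div 2) (mset_set (symmetrize ` B)) = image_mset card (mset_set B)"
    if "B \<subseteq> abs_cycles n w" for B
  proof -
    have "inj_on symmetrize B"
      using abs_cycle_pos[OF assms] that by (intro inj_onI) (metis subsetD symmetrize_Int_pos)
    then have "image_mset (\<lambda>c. card c div 2) (mset_set (symmetrize ` B))
        = image_mset (\<lambda>b. card (symmetrize b) div 2) (mset_set B)"
      by (simp add: image_mset_mset_set[symmetric] image_mset.compositionality comp_def)
    also have "\<dots> = image_mset card (mset_set B)"
      using that finite_subset[OF that finite_abs_cycles] finite_abs_cycle[OF assms] abs_cycle_pos[OF assms]
      by (intro image_mset_cong) (auto simp: card_symmetrize)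
    finally show ?thesis .
  qed
  then show ?thesis by (simp add: signed_cycle_type_def pos_cycles_eq[OF assms] neg_cycles_eq[OF assms])
qed

lemma prod_signed_cycle_type:
  fixes f g :: "nat \<Rightarrow> 'c :: comm_monoid_mult"
  assumes "w \<in> signed_perms n"
  shows "(\<Prod>a\<in>#fst (signed_cycle_type n w). f a) * (\<Prod>a\<in>#snd (signed_cycle_type n w). g a)
    = (\<Prod>b\<in>abs_cycles n w. if cycle_sign w b = 1 then f (card b) else g (card b))"
proof -
  have "abs_cycles n w \<inter> - {b. cycle_sign w b = 1} = {b \<in> abs_cycles n w. cycle_sign w b = - 1}"
    by (auto dest: cycle_sign_cases[OF assms])
  then show ?thesis
    unfolding signed_cycle_type_eq[OF assms] prod.If_cases[OF finite_abs_cycles]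
    by (simp add: prod_unfold_prod_mset image_mset.compositionality comp_def Collect_conj_eq)
qed

lemma cycles_conj:
  assumes "u \<in> signed_perms n" "h \<in> signed_perms n"
  shows "cycles n (u \<circ> h \<circ> inv u) = (`) u ` cycles n h"
proof -
  have funpow: "((u \<circ> h \<circ> inv u) ^^ k) (u i) = u ((h ^^ k) i)" for k i
    by (induction k) (simp_all add: signed_perms.inv_apply[OF assms(1)])
  have "orbit (u \<circ> h \<circ> inv u) (u i) = u ` orbit h i" for i
    unfolding signed_perms_orbit_eq_range[OF signed_perms.conj_mem[OF assms]]
      signed_perms_orbit_eq_range[OF assms(2)] image_image funpow ..
  then have "(`) u ` cycles n h = orbit (u \<circ> h \<circ> inv u) ` u ` signed_letters n"
    by (simp add: cycles_def image_image)
  then show ?thesis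
    using permutes_image[OF signed_perms_permutes[OF assms(1)]] by (simp only: cycles_def)
qed

lemma class_function_signed_cycle_type: "class_function (signed_perms n) (signed_cycle_type n)"
  unfolding class_function_def
proof (intro ballI)
  fix u h assume u: "u \<in> signed_perms n" and h: "h \<in> signed_perms n"
  define neg where "neg c = uminus ` c" for c :: "int set"
  have neg_image: "neg (u ` c) = u ` neg c" for c
    unfolding neg_def image_image signed_perms_uminus[OF u] ..
  have image_eq_iff: "u ` c = u ` d \<longleftrightarrow> c = d" for c d
    by (rule inj_image_eq_iff[OF signed_perms_inj[OF u]])
  have pos_eq: "pos_cycles n w = (\<lambda>c. c \<union> neg c) ` {c \<in> cycles n w. neg c \<noteq> c}"
    and neg_eq: "neg_cycles n w = {c \<in> cycles n w. neg c = c}" for w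
    unfolding pos_cycles_def neg_cycles_def neg_def by blast+
  have "{c \<in> (`) u ` C. neg c \<noteq> c} = (`) u ` {c \<in> C. neg c \<noteq> c}"
    and "{c \<in> (`) u ` C. neg c = c} = (`) u ` {c \<in> C. neg c = c}" for C
    using neg_image image_eq_iff by auto
  then have pos: "pos_cycles n (u \<circ> h \<circ> inv u) = (`) u ` pos_cycles n h"
    and neg: "neg_cycles n (u \<circ> h \<circ> inv u) = (`) u ` neg_cycles n h"
    unfolding pos_eq neg_eq cycles_conj[OF u h] by (simp_all only: image_image image_Un neg_image)
  have "image_mset (\<lambda>c. card c div 2) (mset_set ((`) u ` P)) = image_mset (\<lambda>c. card c div 2) (mset_set P)"
    for P
  proof -
    have "inj_on ((`) u) P" using image_eq_iff by (auto intro: inj_onI)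
    moreover have "card (u ` c) = card c" for c
      by (rule card_image[OF inj_on_subset[OF signed_perms_inj[OF u] subset_UNIV]])
    ultimately show ?thesis
      by (simp add: image_mset_mset_set[symmetric] image_mset.compositionality comp_def)
  qed
  then show "signed_cycle_type n (u \<circ> h \<circ> inv u) = signed_cycle_type n h"
    unfolding signed_cycle_type_def pos neg by simp
qed

lemma signed_cycle_type_point_stabilizer:
  assumes "n \<ge> 1" "h \<in> signed_perms (n - 1)"
  shows "signed_cycle_type n h = map_prod (add_mset 1) id (signed_cycle_type (n - 1) h)"
proof -
  have h: "h \<in> signed_perms n" "h (int n) = int n"
    using assms(2) unfolding signed_perms_point_stabilizer[OF assms(1)] by auto
  have "{1..int n} = insert (int n) {1..int (n - 1)}" using assms(1) by auto
  moreover have "orbit (unsigned h) (int n) = {int n}"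
    unfolding orbit_eq_singleton_iff using h(2) by (simp add: unsigned_def)
  ultimately have insert: "abs_cycles n h = insert {int n} (abs_cycles (n - 1) h)"
    by (simp add: abs_cycles_def)
  have sign: "cycle_sign h {int n} = 1" using h(2) assms(1) by (simp add: cycle_sign_def)
  have pos: "{b \<in> abs_cycles n h. cycle_sign h b = 1}
      = insert {int n} {b \<in> abs_cycles (n - 1) h. cycle_sign h b = 1}"
    and neg: "{b \<in> abs_cycles n h. cycle_sign h b = - 1} = {b \<in> abs_cycles (n - 1) h. cycle_sign h b = - 1}"
    unfolding insert using sign by auto
  have "{int n} \<notin> abs_cycles (n - 1) h"
    using abs_cycle_subset[OF assms(2), of "{int n}"] assms(1) by auto
  then show ?thesis
    unfolding signed_cycle_type_eq[OF h(1)] signed_cycle_type_eq[OF assms(2)] pos neg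
    using finite_abs_cycles[of "n - 1" h] by simp
qed

lemma bij_betw_positive_fixed_points:
  assumes "w \<in> signed_perms n"
  shows "bij_betw (\<lambda>a. {a}) {a \<in> {1..int n}. w a = a} {b \<in> abs_cycles n w. cycle_sign w b = 1 \<and> card b = 1}"
proof (rule bij_betw_imageI)
  show "(\<lambda>a. {a}) ` {a \<in> {1..int n}. w a = a} = {b \<in> abs_cycles n w. cycle_sign w b = 1 \<and> card b = 1}"
  proof (intro equalityI subsetI)
    fix b assume "b \<in> (\<lambda>a. {a}) ` {a \<in> {1..int n}. w a = a}"
    then obtain a where a: "a \<in> {1..int n}" "w a = a" "b = {a}" by blast
    then have "orbit (unsigned w) a = b" by (simp add: orbit_eq_singleton_iff unsigned_def)
    then show "b \<in> {b \<in> abs_cycles n w. cycle_sign w b = 1 \<and> card b = 1}"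
      using a orbit_mem_abs_cycles[OF a(1), of w] by (simp add: cycle_sign_def)
  next
    fix b assume b: "b \<in> {b \<in> abs_cycles n w. cycle_sign w b = 1 \<and> card b = 1}"
    then obtain a where a: "b = {a}" by (auto simp: card_1_singleton_iff)
    then have mem: "a \<in> {1..int n}" and "orbit (unsigned w) a = {a}"
      using b abs_cycle_subset[OF assms, of b] abs_cycle_eq_orbit[OF assms, of b a] by blast+
    then have "unsigned w a = a" by (simp only: orbit_eq_singleton_iff)
    moreover have "sgn (w a) = 1" using b a by (simp add: cycle_sign_def)
    ultimately have "w a = a" using eq_sgn_mult_unsigned[of a w] mem by simp
    then show "b \<in> (\<lambda>a. {a}) ` {a \<in> {1..int n}. w a = a}" using a mem by blast
  qed
qed (simp add: inj_on_def)

lemma card_fixed_points: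
  assumes "w \<in> signed_perms n"
  shows "card {a \<in> signed_letters n. w a = a} = 2 * count (fst (signed_cycle_type n w)) 1"
proof -
  let ?F = "{a \<in> {1..int n}. w a = a}"
  have "{a \<in> signed_letters n. w a = a} = symmetrize ?F"
  proof (intro equalityI subsetI)
    fix a assume "a \<in> {a \<in> signed_letters n. w a = a}"
    then show "a \<in> symmetrize ?F"
      using signed_perms_uminus[OF assms, of a] by (subst mem_symmetrize_iff) (auto simp: abs_if)
  next
    fix a assume "a \<in> symmetrize ?F"
    then have "\<bar>a\<bar> \<in> ?F" by (subst (asm) mem_symmetrize_iff) auto
    then show "a \<in> {a \<in> signed_letters n. w a = a}"
      using signed_perms_uminus[OF assms, of a] by (auto simp: abs_if split: if_splits)
  qed
  moreover have "card (symmetrize ?F) = 2 * card ?F"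
    by (rule card_symmetrize) (auto intro: finite_subset[of _ "{1..int n}"])
  moreover have "card ?F = count (fst (signed_cycle_type n w)) 1"
    unfolding signed_cycle_type_eq[OF assms] bij_betw_same_card[OF bij_betw_positive_fixed_points[OF assms]]
    using finite_abs_cycles[of n w] by (simp add: count_image_mset_eq_card_vimage)
  ultimately show ?thesis by simp
qed

section \<open>The character of the exterior algebra\<close>

text \<open>The signed permutation \<open>w\<close> maps the basis vector \<open>e I\<close> to \<open>ext_sign w I\<close> times \<open>e (unsigned w ` I)\<close>.\<close>

definition ext_sign :: "(int \<Rightarrow> int) \<Rightarrow> int set \<Rightarrow> int" where
  "ext_sign w I = (\<Prod>i\<in>I. sgn (w i)) * inv_sign (unsigned w) I"

lemma ext_sign_comp:
  assumes "u \<in> signed_perms n" "v \<in> signed_perms n" "I \<subseteq> {1..int n}"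
  shows "ext_sign (u \<circ> v) I = ext_sign u (unsigned v ` I) * ext_sign v I"
proof -
  have inj: "inj_on (unsigned v) I" "inj_on (unsigned u) (unsigned v ` I)"
    using assms(1,2) inj_on_subset[OF unsigned_inj subset_UNIV] by blast+
  have "sgn ((u \<circ> v) i) = sgn (u (unsigned v i)) * sgn (v i)" if "i \<in> I" for i
  proof -
    have pos: "0 < i" using that assms(3) by auto
    have "u (v i) = u (sgn (v i) * unsigned v i)" using eq_sgn_mult_unsigned[OF pos, of v] by simp
    also have "\<dots> = sgn (v i) * u (unsigned v i)"
      using pos by (intro signed_perms_sign_mult[OF assms(1)] abs_sgn_signed_perms[OF assms(2)]) simp
    finally show ?thesis by (simp add: sgn_mult mult.commute)
  qed
  then have "(\<Prod>i\<in>I. sgn ((u \<circ> v) i)) = (\<Prod>i\<in>unsigned v ` I. sgn (u i)) * (\<Prod>i\<in>I. sgn (v i))"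
    by (simp add: prod.distrib prod.reindex[OF inj(1)])
  moreover have "finite I" using assms(3) finite_subset by blast
  ultimately show ?thesis
    using inv_sign_comp[OF _ inj] by (simp add: ext_sign_def unsigned_comp[OF assms(1,2)] mult_ac)
qed

lemma ext_sign_id: "I \<subseteq> {1..int n} \<Longrightarrow> ext_sign id I = 1"
  by (auto simp: ext_sign_def unsigned_id inv_sign_id intro!: prod.neutral)

lemma ext_sign_sign_flip:
  assumes "I \<subseteq> {1..int n}" shows "ext_sign (sign_flip n k) I = (if k \<in> I then - 1 else 1)"
proof -
  have "finite I" using assms finite_subset by blast
  have "sgn (sign_flip n k i) = (if i = k then - 1 else 1)" if "i \<in> I" for i
    using that assms by (auto simp: sign_flip_apply subset_iff)
  then have "(\<Prod>i\<in>I. sgn (sign_flip n k i)) = (if k \<in> I then - 1 else 1)"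
    using \<open>finite I\<close> by (simp add: prod.delta)
  then show ?thesis by (simp add: ext_sign_def unsigned_sign_flip inv_sign_id)
qed

lemma ext_sign_abs_cycle:
  assumes "w \<in> signed_perms n" "b \<in> abs_cycles n w"
  shows "ext_sign w b = (- 1) ^ (card b - 1) * cycle_sign w b"
proof -
  obtain i where "b = orbit (unsigned w) i" using assms(2) by (auto simp: abs_cycles_def)
  then show ?thesis
    using inv_sign_orbit[OF unsigned_permutation[OF assms(1)], of i]
    by (simp add: ext_sign_def cycle_sign_def)
qed

lemma ext_sign_Union_abs_cycles:
  assumes "w \<in> signed_perms n" "Q \<subseteq> abs_cycles n w"
  shows "ext_sign w (\<Union>Q) = (\<Prod>b\<in>Q. ext_sign w b)"
proof -
  have "finite Q" using assms(2) finite_abs_cycles finite_subset by blast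
  then show ?thesis using assms(2)
  proof (induction Q rule: finite_induct)
    case (insert b Q)
    then have b: "b \<in> abs_cycles n w" and Q: "Q \<subseteq> abs_cycles n w" by auto
    have disjoint: "b \<inter> \<Union>Q = {}"
      using abs_cycles_disjoint[OF assms(1) b] Q insert.hyps(2) by blast
    have fin: "finite b" "finite (\<Union>Q)"
      using finite_abs_cycle[OF assms(1)] insert.hyps(1) b Q by auto
    have invariant: "unsigned w ` c = c" if "c \<in> abs_cycles n w" for c
      using that orbit_image[OF unsigned_permutation[OF assms(1)]] by (auto simp: abs_cycles_def)
    then have "unsigned w ` \<Union>Q = \<Union>Q" unfolding image_Union using Q by (simp add: subset_iff)
    then have "ext_sign w (b \<union> \<Union>Q) = ext_sign w b * ext_sign w (\<Union>Q)"
      unfolding ext_sign_def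
      using inv_sign_Un_invariant[OF unsigned_inj[OF assms(1)] invariant[OF b] _ fin disjoint]
        prod.union_disjoint[OF fin disjoint, of "\<lambda>i. sgn (w i)"] by simp
    then show ?case using insert Q by simp
  qed (simp add: ext_sign_def)
qed

lemma sum_ext_sign_invariant:
  assumes "w \<in> signed_perms n"
  shows "(\<Sum>I | I \<subseteq> {1..int n} \<and> unsigned w ` I = I. ext_sign w I)
    = (\<Prod>b\<in>abs_cycles n w. 1 + (- 1) ^ (card b - 1) * cycle_sign w b)"
proof -
  have "(\<Sum>I | I \<subseteq> {1..int n} \<and> unsigned w ` I = I. ext_sign w I)
      = (\<Prod>b\<in>orbit (unsigned w) ` {1..int n}. 1 + ext_sign w b)"
    using ext_sign_Union_abs_cycles[OF assms] unfolding abs_cycles_def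
    by (intro sum_invariant_eq_prod_orbits unsigned_permutes[OF assms]) simp_all
  also have "\<dots> = (\<Prod>b\<in>abs_cycles n w. 1 + (- 1) ^ (card b - 1) * cycle_sign w b)"
    unfolding abs_cycles_def[symmetric] by (simp add: ext_sign_abs_cycle[OF assms])
  finally show ?thesis .
qed

lemma wedge_basis:
  assumes "finite A" "finite B" "A \<inter> B = {}"
  shows "wedge (\<lambda>J. a * ext_basis A J) (\<lambda>J. b * ext_basis B J)
    = (\<lambda>J. a * b * (- 1) ^ card {(i, j). i \<in> A \<and> j \<in> B \<and> j < i} * ext_basis (A \<union> B) J)"
proof
  fix J
  let ?term = "\<lambda>I. (- 1) ^ card {(i, j). i \<in> I \<and> j \<in> J - I \<and> j < i}
    * (a * ext_basis A I) * (b * ext_basis B (J - I))"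
  show "wedge (\<lambda>J. a * ext_basis A J) (\<lambda>J. b * ext_basis B J) J
    = a * b * (- 1) ^ card {(i, j). i \<in> A \<and> j \<in> B \<and> j < i} * ext_basis (A \<union> B) J"
  proof (cases "J = A \<union> B")
    case True
    then have "J - A = B" using assms(3) by blast
    have "wedge (\<lambda>J. a * ext_basis A J) (\<lambda>J. b * ext_basis B J) J = (\<Sum>I\<in>{A}. ?term I)"
      unfolding wedge_def
      by (rule sum.mono_neutral_right) (use True assms in \<open>auto simp: ext_basis_def\<close>)
    then show ?thesis unfolding True[symmetric] using \<open>J - A = B\<close> by (simp add: ext_basis_def)
  next
    case False
    then have "?term I = 0" if "I \<in> Pow J" for I using that by (auto simp: ext_basis_def)
    then have "wedge (\<lambda>J. a * ext_basis A J) (\<lambda>J. b * ext_basis B J) J = 0"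
      unfolding wedge_def by (intro sum.neutral) blast
    then show ?thesis using False by (simp add: ext_basis_def)
  qed
qed

lemma ext_sign_insert_less:
  assumes "w \<in> signed_perms n" "finite I" "\<And>i. i \<in> I \<Longrightarrow> x < i"
  shows "ext_sign w (insert x I)
    = sgn (w x) * (- 1) ^ card {k \<in> unsigned w ` I. k < unsigned w x} * ext_sign w I"
proof -
  have inj: "inj_on (unsigned w) K" for K
    by (rule inj_on_subset[OF unsigned_inj[OF assms(1)] subset_UNIV])
  have "x \<notin> I" using assms(3) by blast
  have "(\<Prod>i\<in>I. order_sign (unsigned w) i x) = (\<Prod>i\<in>I. if unsigned w i < unsigned w x then - 1 else 1)"
    using assms(3) by (intro prod.cong refl) (auto simp: order_sign_def dest: less_asym)
  also have "\<dots> = (\<Prod>k\<in>unsigned w ` I. if k < unsigned w x then - 1 else 1)"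
    by (simp add: prod.reindex[OF inj])
  also have "\<dots> = (- 1) ^ card {k \<in> unsigned w ` I. k < unsigned w x}"
    using assms(2) by (simp add: prod.If_cases Collect_conj_eq)
  finally show ?thesis
    using assms(2) \<open>x \<notin> I\<close> by (simp add: ext_sign_def inv_sign_insert[OF _ _ inj])
qed

lemma foldr_wedge_vec_act:
  assumes "w \<in> signed_perms n" "sorted_wrt (<) xs" "set xs \<subseteq> {1..int n}"
  shows "foldr wedge (map (vec_act w) xs) (ext_basis {})
    = (\<lambda>J. of_int (ext_sign w (set xs)) * ext_basis (unsigned w ` set xs) J)"
  using assms(2,3)
proof (induction xs)
  case Nil
  then show ?case by (simp add: ext_sign_def)
next
  case (Cons x xs)
  let ?y = "unsigned w x" and ?K = "unsigned w ` set xs"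
  have x: "0 < x" "\<And>i. i \<in> set xs \<Longrightarrow> x < i" using Cons.prems by auto
  have "?y \<notin> ?K" using x(2)[of x] by (auto simp: inj_eq[OF unsigned_inj[OF assms(1)]])
  have "{(i, j). i \<in> {?y} \<and> j \<in> ?K \<and> j < i} = Pair ?y ` {k \<in> ?K. k < ?y}" by auto
  then have "card {(i, j). i \<in> {?y} \<and> j \<in> ?K \<and> j < i} = card {k \<in> ?K. k < ?y}"
    by (simp add: card_image inj_on_def)
  then have "wedge (\<lambda>J. of_int (sgn (w x)) * ext_basis {?y} J)
        (\<lambda>J. of_int (ext_sign w (set xs)) * ext_basis ?K J)
      = (\<lambda>J. of_int (ext_sign w (set (x # xs))) * ext_basis (unsigned w ` set (x # xs)) J)"
    using \<open>?y \<notin> ?K\<close> ext_sign_insert_less[OF assms(1) finite_set x(2)] by (simp add: wedge_basis mult_ac)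
  moreover have "vec_act w x = (\<lambda>J. of_int (sgn (w x)) * ext_basis {?y} J)"
    using x(1) by (simp add: vec_act_def[abs_def] unsigned_pos)
  ultimately show ?case using Cons by simp
qed

lemma ext_char_eq_sum_ext_sign:
  assumes "w \<in> signed_perms n"
  shows "ext_char n w = of_int (\<Sum>I | I \<subseteq> {1..int n} \<and> unsigned w ` I = I. ext_sign w I)"
proof -
  have diagonal: "ext_act n w (ext_basis I) I = (if unsigned w ` I = I then of_int (ext_sign w I) else 0)"
    if I: "I \<in> Pow {1..int n}" for I
  proof -
    have "finite I" using I finite_subset by blast
    have "ext_act n w (ext_basis I) I
        = (\<Sum>I'\<in>{I}. ext_basis I I' * foldr wedge (map (vec_act w) (sorted_list_of_set I')) (ext_basis {}) I)"
      unfolding ext_act_def by (rule sum.mono_neutral_right) (use I in \<open>auto simp: ext_basis_def\<close>)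
    also have "\<dots> = of_int (ext_sign w I) * ext_basis (unsigned w ` I) I"
      using foldr_wedge_vec_act[OF assms, of "sorted_list_of_set I"] I \<open>finite I\<close>
      by (simp add: ext_basis_def)
    finally show ?thesis by (auto simp: ext_basis_def)
  qed
  have "ext_char n w = (\<Sum>I\<in>Pow {1..int n}. if unsigned w ` I = I then of_int (ext_sign w I) else 0)"
    using assms diagonal by (simp add: ext_char_def)
  also have "\<dots> = (\<Sum>I\<in>{I \<in> Pow {1..int n}. unsigned w ` I = I}. of_int (ext_sign w I))"
    by (rule sum.inter_filter[symmetric]) simp
  finally show ?thesis by (simp add: Pow_def Collect_conj_eq)
qed

text \<open>This is the character \<open>w \<mapsto> det (1 + w)\<close> as a function of the signed cycle type of \<open>w\<close>.\<close>

definition type_product :: "nat multiset \<times> nat multiset \<Rightarrow> int" where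
  "type_product t = (\<Prod>a\<in>#fst t. 1 + (- 1) ^ (a - 1)) * (\<Prod>a\<in>#snd t. 1 - (- 1) ^ (a - 1))"

lemma ext_char_eq_type_product:
  assumes "w \<in> signed_perms n"
  shows "ext_char n w = of_int (type_product (signed_cycle_type n w))"
proof -
  have "type_product (signed_cycle_type n w)
      = (\<Prod>b\<in>abs_cycles n w. 1 + (- 1) ^ (card b - 1) * cycle_sign w b)"
    unfolding type_product_def prod_signed_cycle_type[OF assms]
    using cycle_sign_cases[OF assms] by (intro prod.cong refl) fastforce
  then show ?thesis by (simp add: ext_char_eq_sum_ext_sign[OF assms] sum_ext_sign_invariant[OF assms])
qed

lemma induced_ext_char:
  assumes "n \<ge> 1" "g \<in> signed_perms n"
  shows "induced (signed_perms (n - 1)) (signed_perms n) (ext_char (n - 1)) g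
    = of_nat (count (fst (signed_cycle_type n g)) 1) * of_int (type_product (signed_cycle_type n g))"
proof -
  let ?\<phi> = "\<lambda>w. of_int (type_product (signed_cycle_type n w)) / (2 :: complex)"
  have "class_function (signed_perms n) ?\<phi>"
    unfolding class_function_def by (simp add: class_functionD[OF class_function_signed_cycle_type])
  moreover have "ext_char (n - 1) h = ?\<phi> h" if "h \<in> signed_perms n" "h (int n) = int n" for h
  proof -
    have h: "h \<in> signed_perms (n - 1)" using that signed_perms_point_stabilizer[OF assms(1)] by blast
    have "type_product (signed_cycle_type n h) = 2 * type_product (signed_cycle_type (n - 1) h)"
      by (simp add: signed_cycle_type_point_stabilizer[OF assms(1) h] type_product_def)
    then show ?thesis unfolding ext_char_eq_type_product[OF h] by simp
  qed
  moreover note assms signed_perms_transitive[of "int n" n] signed_perms_point_orbit[OF assms(1)]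
  ultimately have "induced (signed_perms (n - 1)) (signed_perms n) (ext_char (n - 1)) g
      = of_nat (card {a \<in> signed_letters n. g a = a}) * ?\<phi> g"
    unfolding signed_perms_point_stabilizer[OF assms(1)]
    by (intro signed_perms.induced_from_point_stabilizer) simp_all
  also have "\<dots> = of_nat (2 * count (fst (signed_cycle_type n g)) 1) * ?\<phi> g"
    unfolding card_fixed_points[OF assms(2)] ..
  finally show ?thesis by simp
qed

section \<open>Irreducibility of the exterior powers\<close>

text \<open>The permutation action on \<open>J\<close>, twisted by the cocycle \<open>\<epsilon>\<close>: the group element \<open>u\<close> maps the basis
  vector of \<open>I\<close> to \<open>\<epsilon> u I\<close> times the basis vector of \<open>act u I\<close>.\<close>

locale monomial_action = finite_permutation_group G for G :: "('a \<Rightarrow> 'a) set" +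
  fixes J :: "'j set" and act :: "('a \<Rightarrow> 'a) \<Rightarrow> 'j \<Rightarrow> 'j" and \<epsilon> :: "('a \<Rightarrow> 'a) \<Rightarrow> 'j \<Rightarrow> complex"
  assumes finite_basis: "finite J"
    and act_mem: "u \<in> G \<Longrightarrow> I \<in> J \<Longrightarrow> act u I \<in> J"
    and act_id: "I \<in> J \<Longrightarrow> act id I = I"
    and act_comp: "u \<in> G \<Longrightarrow> v \<in> G \<Longrightarrow> I \<in> J \<Longrightarrow> act (u \<circ> v) I = act u (act v I)"
    and cocycle_id: "I \<in> J \<Longrightarrow> \<epsilon> id I = 1"
    and cocycle_comp: "u \<in> G \<Longrightarrow> v \<in> G \<Longrightarrow> I \<in> J \<Longrightarrow> \<epsilon> (u \<circ> v) I = \<epsilon> u (act v I) * \<epsilon> v I"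
begin

definition enum :: "nat \<Rightarrow> 'j" where
  "enum = (SOME e. bij_betw e {..<card J} J)"

definition monomial_rep :: "('a \<Rightarrow> 'a) \<Rightarrow> complex mat" where
  "monomial_rep u = mat (card J) (card J) (\<lambda>(p, q). if act u (enum q) = enum p then \<epsilon> u (enum q) else 0)"

lemma bij_betw_enum: "bij_betw enum {..<card J} J"
  unfolding enum_def lessThan_atLeast0 by (rule someI_ex[OF ex_bij_betw_nat_finite[OF finite_basis]])

lemma enum_mem: "p < card J \<Longrightarrow> enum p \<in> J"
  using bij_betw_enum by (auto simp: bij_betw_def)

lemma enum_eq_iff: "p < card J \<Longrightarrow> q < card J \<Longrightarrow> enum p = enum q \<longleftrightarrow> p = q"
  using bij_betw_enum by (auto simp: bij_betw_def inj_on_def)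

lemma enum_cases:
  assumes "I \<in> J" obtains p where "p < card J" "enum p = I"
proof -
  have "I \<in> enum ` {..<card J}" using assms by (simp only: bij_betw_imp_surj_on[OF bij_betw_enum])
  then show ?thesis using that by blast
qed

lemma cocycle_nonzero:
  assumes "u \<in> G" "I \<in> J" shows "\<epsilon> u I \<noteq> 0"
  using cocycle_comp[OF inv_mem[OF assms(1)] assms] cocycle_id[OF assms(2)] inv_comp[OF assms(1)]
  by (metis mult_zero_right zero_neq_one)

lemma monomial_rep_carrier: "monomial_rep u \<in> carrier_mat (card J) (card J)"
  by (simp add: monomial_rep_def)

lemma monomial_rep_index:
  "p < card J \<Longrightarrow> q < card J \<Longrightarrow>
    monomial_rep u $$ (p, q) = (if act u (enum q) = enum p then \<epsilon> u (enum q) else 0)"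
  by (simp add: monomial_rep_def)

lemma monomial_rep_comp:
  assumes "u \<in> G" "v \<in> G" shows "monomial_rep (u \<circ> v) = monomial_rep u * monomial_rep v"
proof (rule eq_matI)
  fix p q assume "p < dim_row (monomial_rep u * monomial_rep v)" "q < dim_col (monomial_rep u * monomial_rep v)"
  then have p: "p < card J" and q: "q < card J" by (simp_all add: monomial_rep_def)
  obtain r where r: "r < card J" "enum r = act v (enum q)"
    using act_mem[OF assms(2) enum_mem[OF q]] by (rule enum_cases)
  have "(monomial_rep u * monomial_rep v) $$ (p, q)
      = (\<Sum>s\<in>{0..<card J}. monomial_rep u $$ (p, s) * monomial_rep v $$ (s, q))"
    using p q monomial_rep_carrier[of u] monomial_rep_carrier[of v] by (simp add: scalar_prod_def)
  also have "\<dots> = (\<Sum>s\<in>{r}. monomial_rep u $$ (p, s) * monomial_rep v $$ (s, q))"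
  proof (rule sum.mono_neutral_right)
    show "\<forall>s\<in>{0..<card J} - {r}. monomial_rep u $$ (p, s) * monomial_rep v $$ (s, q) = 0"
    proof
      fix s assume "s \<in> {0..<card J} - {r}"
      then have "s < card J" "enum s \<noteq> act v (enum q)" using r enum_eq_iff[of s r] by auto
      then show "monomial_rep u $$ (p, s) * monomial_rep v $$ (s, q) = 0"
        using q by (simp add: monomial_rep_index)
    qed
  qed (use r in auto)
  also have "\<dots> = monomial_rep (u \<circ> v) $$ (p, q)"
    using p q r assms enum_mem[OF q] by (simp add: monomial_rep_index act_comp cocycle_comp)
  finally show "monomial_rep (u \<circ> v) $$ (p, q) = (monomial_rep u * monomial_rep v) $$ (p, q)" by simp
qed (simp_all add: monomial_rep_def)

lemma representation_monomial_rep: "representation G (card J) monomial_rep"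
proof -
  have "monomial_rep id = 1\<^sub>m (card J)"
    by (rule eq_matI)
      (simp_all add: monomial_rep_def act_id cocycle_id enum_mem enum_eq_iff eq_commute)
  then show ?thesis
    by (simp add: representation_def monomial_rep_carrier monomial_rep_comp)
qed

lemma monomial_rep_mult_unit_vec:
  assumes "p < card J" "q < card J" "act u (enum p) = enum q"
  shows "monomial_rep u *\<^sub>v unit_vec (card J) p = \<epsilon> u (enum p) \<cdot>\<^sub>v unit_vec (card J) q"
proof (rule eq_vecI)
  fix r assume "r < dim_vec (\<epsilon> u (enum p) \<cdot>\<^sub>v unit_vec (card J) q)"
  then have r: "r < card J" by simp
  have "(monomial_rep u *\<^sub>v unit_vec (card J) p) $ r = monomial_rep u $$ (r, p)"
    using r assms(1) monomial_rep_carrier[of u] by (simp add: scalar_prod_right_unit[of _ "card J"])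
  then show "(monomial_rep u *\<^sub>v unit_vec (card J) p) $ r = (\<epsilon> u (enum p) \<cdot>\<^sub>v unit_vec (card J) q) $ r"
    using r assms by (simp add: monomial_rep_index enum_eq_iff)
qed (simp add: monomial_rep_def)

lemma trace_monomial_rep:
  "(\<Sum>p<card J. monomial_rep u $$ (p, p)) = (\<Sum>I | I \<in> J \<and> act u I = I. \<epsilon> u I)"
proof -
  have "(\<Sum>p<card J. monomial_rep u $$ (p, p))
      = (\<Sum>p<card J. if act u (enum p) = enum p then \<epsilon> u (enum p) else 0)"
    by (simp add: monomial_rep_index)
  also have "\<dots> = (\<Sum>I\<in>J. if act u I = I then \<epsilon> u I else 0)"
    by (rule sum.reindex_bij_betw[OF bij_betw_enum])
  finally show ?thesis by (simp add: sum.inter_filter[OF finite_basis])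
qed

lemma irreducible_character_monomial:
  assumes "J \<noteq> {}"
    and separated: "\<And>I K. I \<in> J \<Longrightarrow> K \<in> J \<Longrightarrow> I \<noteq> K \<Longrightarrow> \<exists>t\<in>G. (\<forall>L\<in>J. act t L = L) \<and> \<epsilon> t I \<noteq> \<epsilon> t K"
    and transitive: "\<And>I K. I \<in> J \<Longrightarrow> K \<in> J \<Longrightarrow> \<exists>u\<in>G. act u I = K"
  shows "irreducible_character G (\<lambda>u. if u \<in> G then \<Sum>I | I \<in> J \<and> act u I = I. \<epsilon> u I else 0)"
proof -
  have "irreducible_representation G (card J) monomial_rep"
  proof (rule irreducible_representationI[OF representation_monomial_rep])
    show "card J > 0" using assms(1) finite_basis by (simp add: card_gt_0_iff)
  next
    fix p q assume p: "p < card J" and q: "q < card J" and "p \<noteq> q"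
    then have "enum p \<noteq> enum q" using enum_eq_iff by blast
    then obtain t where t: "t \<in> G" "\<And>L. L \<in> J \<Longrightarrow> act t L = L" "\<epsilon> t (enum p) \<noteq> \<epsilon> t (enum q)"
      using separated[OF enum_mem[OF p] enum_mem[OF q]] by blast
    have "diagonal_mat (monomial_rep t)"
      unfolding diagonal_mat_def by (auto simp: monomial_rep_def t(2) enum_mem enum_eq_iff)
    moreover have "monomial_rep t $$ (p, p) \<noteq> monomial_rep t $$ (q, q)"
      using p q t by (simp add: monomial_rep_index enum_mem)
    ultimately show "\<exists>t\<in>G. diagonal_mat (monomial_rep t) \<and> monomial_rep t $$ (p, p) \<noteq> monomial_rep t $$ (q, q)"
      using t(1) by blast
  next
    fix p q assume p: "p < card J" and q: "q < card J"
    obtain u where u: "u \<in> G" "act u (enum p) = enum q"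
      using transitive[OF enum_mem[OF p] enum_mem[OF q]] by blast
    then show "\<exists>u\<in>G. \<exists>a. a \<noteq> 0 \<and> monomial_rep u *\<^sub>v unit_vec (card J) p = a \<cdot>\<^sub>v unit_vec (card J) q"
      using monomial_rep_mult_unit_vec[OF p q u(2)] cocycle_nonzero[OF u(1) enum_mem[OF p]] by blast
  qed
  then show ?thesis
    unfolding irreducible_character_def trace_monomial_rep[symmetric] by blast
qed

end

definition subsets_of_card :: "nat \<Rightarrow> nat \<Rightarrow> int set set" where
  "subsets_of_card n j = {I. I \<subseteq> {1..int n} \<and> card I = j}"

lemma finite_subsets_of_card: "finite (subsets_of_card n j)"
  unfolding subsets_of_card_def by (rule finite_subset[of _ "Pow {1..int n}"]) auto

definition ext_power_char :: "nat \<Rightarrow> nat \<Rightarrow> (int \<Rightarrow> int) \<Rightarrow> complex" where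
  "ext_power_char n j w = (if w \<in> signed_perms n
     then \<Sum>I | I \<in> subsets_of_card n j \<and> unsigned w ` I = I. of_int (ext_sign w I) else 0)"

interpretation ext_power: monomial_action "signed_perms n" "subsets_of_card n j"
  "\<lambda>w. (`) (unsigned w)" "\<lambda>w I. of_int (ext_sign w I)" for n j
proof
  show "finite (subsets_of_card n j)" by (rule finite_subsets_of_card)
  show "complex_of_int (ext_sign id I) = 1" if "I \<in> subsets_of_card n j" for I
    using that ext_sign_id[of I n] by (simp add: subsets_of_card_def)
  fix u I assume u: "u \<in> signed_perms n" and I: "I \<in> subsets_of_card n j"
  have "unsigned u ` I \<subseteq> unsigned u ` {1..int n}"
    using I by (intro image_mono) (simp add: subsets_of_card_def)
  also have "\<dots> = {1..int n}" by (rule permutes_image[OF unsigned_permutes[OF u]])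
  finally have "unsigned u ` I \<subseteq> {1..int n}" .
  moreover have "card (unsigned u ` I) = card I"
    by (rule card_image[OF inj_on_subset[OF unsigned_inj[OF u] subset_UNIV]])
  ultimately show "unsigned u ` I \<in> subsets_of_card n j" using I by (simp add: subsets_of_card_def)
  fix v assume v: "v \<in> signed_perms n"
  show "unsigned (u \<circ> v) ` I = unsigned u ` unsigned v ` I"
    by (simp add: unsigned_comp[OF u v] image_comp)
  show "complex_of_int (ext_sign (u \<circ> v) I) = of_int (ext_sign u (unsigned v ` I)) * of_int (ext_sign v I)"
    using I ext_sign_comp[OF u v] by (simp add: subsets_of_card_def)
qed (simp add: unsigned_id)

lemma ex_permutes_image_eq:
  assumes "finite D" "A \<subseteq> D" "B \<subseteq> D" "card A = card B"
  obtains p where "p permutes D" "p ` A = B"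
proof -
  have "image_mset (\<lambda>i. i \<in> A) (mset_set D) = image_mset (\<lambda>i. i \<in> B) (mset_set D)"
  proof (rule multiset_eqI)
    have "card {i \<in> D. i \<in> A \<longleftrightarrow> x} = card {i \<in> D. i \<in> B \<longleftrightarrow> x}" for x
      using assms
      by (cases x) (simp_all add: Int_absorb1 set_diff_eq[symmetric] card_Diff_subset finite_subset
        flip: Collect_conj_eq Int_def)
    then show "count (image_mset (\<lambda>i. i \<in> A) (mset_set D)) x
        = count (image_mset (\<lambda>i. i \<in> B) (mset_set D)) x" for x
      using assms(1) by (simp add: count_image_mset_eq_card_vimage)
  qed
  then obtain p where p: "p permutes D" "\<forall>i\<in>D. i \<in> A \<longleftrightarrow> p i \<in> B"
    using image_mset_eq_implies_permutes[OF assms(1)] by blast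
  have "p ` A = B"
  proof (intro equalityI subsetI)
    fix y assume "y \<in> B"
    then have "y \<in> p ` D" using assms(3) permutes_image[OF p(1)] by blast
    then show "y \<in> p ` A" using p(2) \<open>y \<in> B\<close> by blast
  qed (use p(2) assms(2) in blast)
  then show ?thesis using that p(1) by blast
qed

lemma irreducible_character_ext_power:
  assumes "j \<le> n" shows "irreducible_character (signed_perms n) (ext_power_char n j)"
  unfolding ext_power_char_def[abs_def]
proof (rule ext_power.irreducible_character_monomial)
  obtain E where "E \<subseteq> {1..int n}" "card E = j"
    using obtain_subset_with_card_n[of j "{1..int n}"] assms by auto
  then show "subsets_of_card n j \<noteq> {}" by (auto simp: subsets_of_card_def)
next
  fix I K assume I: "I \<in> subsets_of_card n j" and K: "K \<in> subsets_of_card n j" and "I \<noteq> K"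
  then obtain k where "k \<in> I \<longleftrightarrow> k \<notin> K" by blast
  then have "ext_sign (sign_flip n k) I \<noteq> ext_sign (sign_flip n k) K"
    using I K by (auto simp: subsets_of_card_def ext_sign_sign_flip)
  then show "\<exists>t\<in>signed_perms n. (\<forall>L\<in>subsets_of_card n j. unsigned t ` L = L)
      \<and> complex_of_int (ext_sign t I) \<noteq> of_int (ext_sign t K)"
    by (intro bexI[OF _ sign_flip_mem[of n k]]) (simp add: unsigned_sign_flip)
next
  fix I K assume "I \<in> subsets_of_card n j" "K \<in> subsets_of_card n j"
  then obtain p where "p permutes {1..int n}" "p ` I = K"
    using ex_permutes_image_eq[of "{1..int n}" I K] by (auto simp: subsets_of_card_def)
  then show "\<exists>u\<in>signed_perms n. unsigned u ` I = K"
    using odd_extension_permutes by (intro bexI[of _ "odd_extension n p"]) simp_all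
qed

lemma class_function_ext_power_char: "j \<le> n \<Longrightarrow> class_function (signed_perms n) (ext_power_char n j)"
  by (intro signed_perms.irreducible_character_class_function irreducible_character_ext_power)

section \<open>The Frobenius characteristic\<close>

lemma mcoeff_0: "mcoeff 0 M = 0"
  by (simp add: zero_mseries.rep_eq)

lemma mcoeff_add: "mcoeff (f + g) M = mcoeff f M + mcoeff g M"
  by (simp add: plus_mseries.rep_eq)

lemma mcoeff_diff: "mcoeff (f - g) M = mcoeff f M - mcoeff g M"
  by (simp add: minus_mseries.rep_eq)

lemma mcoeff_sum: "mcoeff (sum f A) M = (\<Sum>x\<in>A. mcoeff (f x) M)"
  by (induction A rule: infinite_finite_induct) (simp_all add: mcoeff_0 mcoeff_add)

lemma mcoeff_mult: "mcoeff (f * g) M = (\<Sum>A | A \<subseteq># M. mcoeff f A * mcoeff g (M - A))"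
  by (simp add: times_mseries.rep_eq)

lemma mcoeff_mult_eq_sum:
  assumes "finite V" "inj_on m V" "\<And>v. v \<in> V \<Longrightarrow> m v \<subseteq># M"
    and "\<And>A. A \<subseteq># M \<Longrightarrow> A \<notin> m ` V \<Longrightarrow> mcoeff f A * mcoeff g (M - A) = 0"
  shows "mcoeff (f * g) M = (\<Sum>v\<in>V. mcoeff f (m v) * mcoeff g (M - m v))"
proof -
  have "mcoeff (f * g) M = (\<Sum>A\<in>m ` V. mcoeff f A * mcoeff g (M - A))"
    unfolding mcoeff_mult using assms by (intro sum.mono_neutral_right finite_submultisets) auto
  then show ?thesis by (simp add: sum.reindex[OF assms(2)])
qed

lemma mcoeff_mconst_mult: "mcoeff (mconst a * f) M = a * mcoeff f M"
  using mcoeff_mult_eq_sum[of "{{#}}" "\<lambda>A. A" M "mconst a" f] by (simp add: mconst.rep_eq)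

definition type_series :: "nat multiset \<times> nat multiset \<Rightarrow> var mseries" where
  "type_series t = prod_mset (image_mset p_plus (fst t)) * prod_mset (image_mset p_minus (snd t))"

lemma ch_eq: "ch n f = mconst (1 / of_nat (card (signed_perms n)))
    * (\<Sum>w\<in>signed_perms n. mconst (f w) * type_series (signed_cycle_type n w))"
  by (simp add: ch_def type_series_def card_signed_perms case_prod_unfold mult.assoc)

lemma mcoeff_ch:
  "mcoeff (ch n f) M = (\<Sum>w\<in>signed_perms n. f w * mcoeff (type_series (signed_cycle_type n w)) M)
    / of_nat (card (signed_perms n))"
  by (simp add: ch_eq mcoeff_mconst_mult mcoeff_sum)

lemma ch_diff: "ch n (\<lambda>w. f w - g w) = ch n f - ch n g"
  by (rule mseries_eqI)
    (simp add: mcoeff_ch mcoeff_diff left_diff_distrib sum_subtractf diff_divide_distrib)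

lemma ch_sum: "ch n (\<lambda>w. \<Sum>k\<in>K. f k w) = (\<Sum>k\<in>K. ch n (f k))"
proof (rule mseries_eqI)
  fix M
  have "(\<Sum>w\<in>signed_perms n. (\<Sum>k\<in>K. f k w) * mcoeff (type_series (signed_cycle_type n w)) M)
      = (\<Sum>k\<in>K. \<Sum>w\<in>signed_perms n. f k w * mcoeff (type_series (signed_cycle_type n w)) M)"
    unfolding sum_distrib_right by (rule sum.swap)
  then show "mcoeff (ch n (\<lambda>w. \<Sum>k\<in>K. f k w)) M = mcoeff (\<Sum>k\<in>K. ch n (f k)) M"
    by (simp add: mcoeff_ch mcoeff_sum sum_divide_distrib)
qed

lemma ch_induced:
  assumes "n \<ge> 1"
  shows "ch n (induced (signed_perms (n - 1)) (signed_perms n) f) = p_plus 1 * ch (n - 1) f"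
proof -
  let ?G = "signed_perms n" and ?H = "signed_perms (n - 1)"
  have "ch n (induced ?H ?G f)
      = mconst (1 / of_nat (card ?H)) * (\<Sum>h\<in>?H. mconst (f h) * type_series (signed_cycle_type n h))"
  proof (rule mseries_eqI)
    fix M
    let ?q = "\<lambda>w. mcoeff (type_series (signed_cycle_type n w)) M"
    have "?H \<subseteq> ?G" unfolding signed_perms_point_stabilizer[OF assms] by blast
    moreover have "class_function ?G ?q"
      unfolding class_function_def by (simp add: class_functionD[OF class_function_signed_cycle_type])
    ultimately have "(\<Sum>w\<in>?G. induced ?H ?G f w * ?q w)
        = of_nat (card ?G) / of_nat (card ?H) * (\<Sum>h\<in>?H. f h * ?q h)"
      by (rule signed_perms.sum_induced_mult_class_function)
    then show "mcoeff (ch n (induced ?H ?G f)) M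
      = mcoeff (mconst (1 / of_nat (card ?H)) * (\<Sum>h\<in>?H. mconst (f h) * type_series (signed_cycle_type n h))) M"
      using signed_perms.card_pos[of n] by (simp add: mcoeff_ch mcoeff_mconst_mult mcoeff_sum)
  qed
  also have "(\<Sum>h\<in>?H. mconst (f h) * type_series (signed_cycle_type n h))
      = p_plus 1 * (\<Sum>h\<in>?H. mconst (f h) * type_series (signed_cycle_type (n - 1) h))"
    unfolding sum_distrib_left
    by (intro sum.cong refl)
      (simp add: signed_cycle_type_point_stabilizer[OF assms] type_series_def mult_ac)
  finally show ?thesis by (simp only: ch_eq[of "n - 1"] mult_ac)
qed

section \<open>The characteristic as a signed count of colourings\<close>

fun is_X :: "var \<Rightarrow> bool" where
  "is_X (X i) = True" | "is_X (Y i) = False"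

definition weighted_fillings :: "'b set \<Rightarrow> ('b \<Rightarrow> nat) \<Rightarrow> 'v multiset \<Rightarrow> ('b \<Rightarrow> 'v) set" where
  "weighted_fillings Q r M = {h \<in> Q \<rightarrow>\<^sub>E UNIV. (\<Sum>b\<in>Q. replicate_mset (r b) (h b)) = M}"

lemma finite_weighted_fillings:
  assumes "finite Q" "\<And>b. b \<in> Q \<Longrightarrow> r b \<noteq> 0"
  shows "finite (weighted_fillings Q r M)"
proof (rule finite_subset)
  show "weighted_fillings Q r M \<subseteq> Q \<rightarrow>\<^sub>E set_mset M"
  proof
    fix h assume h: "h \<in> weighted_fillings Q r M"
    then have "h b \<in># M" if "b \<in> Q" for b
      using that assms
      by (auto simp: weighted_fillings_def set_mset_sum in_replicate_mset intro!: bexI[of _ b])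
    then show "h \<in> Q \<rightarrow>\<^sub>E set_mset M" using h by (auto simp: weighted_fillings_def PiE_iff)
  qed
qed (simp add: finite_PiE assms(1))

lemma sum_weighted_fillings_insert:
  assumes "finite Q" "b \<notin> Q" "\<And>c. c \<in> insert b Q \<Longrightarrow> r c \<noteq> 0"
  shows "(\<Sum>h\<in>weighted_fillings (insert b Q) r M. \<phi> h)
    = (\<Sum>v | replicate_mset (r b) v \<subseteq># M. \<Sum>h\<in>weighted_fillings Q r (M - replicate_mset (r b) v). \<phi> (h(b := v)))"
proof -
  let ?r = "replicate_mset (r b)" and ?content = "\<lambda>h. \<Sum>c\<in>Q. replicate_mset (r c) (h c)"
  define V where "V = {v. ?r v \<subseteq># M}"
  define H where "H v = weighted_fillings Q r (M - ?r v)" for v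
  have "V \<subseteq> set_mset M"
    using assms(3)[of b] unfolding V_def by (auto dest: mset_subset_eqD simp: in_replicate_mset)
  then have "finite V" by (rule finite_subset) simp
  have "(\<Sum>v\<in>V. \<Sum>h\<in>H v. \<phi> (h(b := v))) = (\<Sum>(v, h)\<in>Sigma V H. \<phi> (h(b := v)))"
    using assms by (intro sum.Sigma \<open>finite V\<close>) (simp add: H_def finite_weighted_fillings)
  also have "\<dots> = (\<Sum>h\<in>weighted_fillings (insert b Q) r M. \<phi> h)"
  proof (rule sum.reindex_bij_witness[of _ "\<lambda>h. (h b, restrict h Q)" "\<lambda>(v, h). h(b := v)"], goal_cases)
    case (1 p)
    then show ?case using assms(2) by (auto simp: H_def weighted_fillings_def PiE_def extensional_def)
  next
    case (2 p)
    then obtain v h where p: "p = (v, h)" "v \<in> V" "h \<in> H v" by blast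
    have "?content (h(b := v)) = ?content h" using assms(2) by (intro sum.cong) auto
    then show ?case
      using p assms(1,2) by (auto simp: V_def H_def weighted_fillings_def PiE_def extensional_def)
  next
    case (3 h)
    then show ?case by (auto simp: weighted_fillings_def PiE_def extensional_def)
  next
    case (4 h)
    moreover have "?content (restrict h Q) = ?content h" by (intro sum.cong) auto
    ultimately show ?case using assms(1,2) by (auto simp: V_def H_def weighted_fillings_def)
  next
    case (5 p)
    then show ?case by auto
  qed
  finally show ?thesis unfolding V_def H_def by simp
qed

lemma mcoeff_prod_power_series:
  assumes "finite Q" "\<And>b. b \<in> Q \<Longrightarrow> r b \<noteq> 0"
    and "\<And>b A. b \<in> Q \<Longrightarrow> mcoeff (g b) A = (\<Sum>v | replicate_mset (r b) v = A. \<epsilon> b v)"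
  shows "mcoeff (\<Prod>b\<in>Q. g b) M = (\<Sum>h\<in>weighted_fillings Q r M. \<Prod>b\<in>Q. \<epsilon> b (h b))"
  using assms
proof (induction Q arbitrary: M rule: finite_induct)
  case empty
  have "weighted_fillings {} r M = (if M = {#} then {\<lambda>_. undefined} else {})"
    by (auto simp: weighted_fillings_def)
  then show ?case by (simp add: one_mseries.rep_eq)
next
  case (insert b Q)
  let ?r = "replicate_mset (r b)" and ?V = "{v. replicate_mset (r b) v \<subseteq># M}"
  have r_eq_iff: "?r v = ?r v' \<longleftrightarrow> v = v'" for v v'
    using insert.prems(1)[of b] by (simp add: replicate_mset_eq_iff)
  have coeff: "mcoeff (g b) (?r v) = \<epsilon> b v" for v
    by (simp add: insert.prems(2) r_eq_iff)
  have "?V \<subseteq> set_mset M"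
    using insert.prems(1)[of b] by (auto dest: mset_subset_eqD simp: in_replicate_mset)
  then have "finite ?V" by (rule finite_subset) simp
  then have "mcoeff (g b * (\<Prod>c\<in>Q. g c)) M = (\<Sum>v\<in>?V. mcoeff (g b) (?r v) * mcoeff (\<Prod>c\<in>Q. g c) (M - ?r v))"
    by (intro mcoeff_mult_eq_sum) (auto simp: inj_on_def r_eq_iff insert.prems(2) intro!: sum.neutral)
  also have "\<dots> = (\<Sum>v\<in>?V. \<Sum>h\<in>weighted_fillings Q r (M - ?r v). \<epsilon> b v * (\<Prod>c\<in>Q. \<epsilon> c (h c)))"
    using insert by (simp add: coeff sum_distrib_left)
  also have "\<dots> = (\<Sum>v\<in>?V. \<Sum>h\<in>weighted_fillings Q r (M - ?r v). \<Prod>c\<in>insert b Q. \<epsilon> c ((h(b := v)) c))"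
    using insert.hyps by (auto intro!: sum.cong prod.cong arg_cong2[of _ _ _ _ "(*)"])
  also have "\<dots> = (\<Sum>h\<in>weighted_fillings (insert b Q) r M. \<Prod>c\<in>insert b Q. \<epsilon> c (h c))"
    using insert by (intro sum_weighted_fillings_insert[symmetric]) auto
  finally show ?case using insert.hyps by simp
qed

lemma mcoeff_cycle_series:
  assumes "r \<noteq> 0" "s = 1 \<or> s = - 1"
  shows "mcoeff (if s = 1 then p_plus r else p_minus r) A
    = (\<Sum>v | replicate_mset r v = A. of_int (if is_X v then 1 else s))"
proof -
  have eq_iff: "replicate_mset r u = replicate_mset r v \<longleftrightarrow> u = v" for u v :: var
    using assms(1) by (simp add: replicate_mset_eq_iff)
  show ?thesis
  proof (cases "\<exists>v. replicate_mset r v = A")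
    case True
    then obtain v where v: "A = replicate_mset r v" by blast
    have "{u. replicate_mset r u = A} = {v}" unfolding v eq_iff by simp
    moreover have "mcoeff (power_sum z r) A = (if v \<in> range z then 1 else 0)" for z
      unfolding v power_sum.rep_eq eq_iff by (simp add: image_iff)
    moreover have "v \<in> range X \<longleftrightarrow> is_X v" "v \<in> range Y \<longleftrightarrow> \<not> is_X v" by (cases v; auto)+
    ultimately show ?thesis using assms(2) by (auto simp: p_plus_def p_minus_def mcoeff_add mcoeff_diff)
  next
    case False
    then have "{u. replicate_mset r u = A} = {}" "mcoeff (power_sum z r) A = 0" for z
      by (auto simp: power_sum.rep_eq)
    then show ?thesis by (simp add: p_plus_def p_minus_def mcoeff_add mcoeff_diff)
  qed
qed

lemma type_series_eq_prod:
  assumes "w \<in> signed_perms n"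
  shows "type_series (signed_cycle_type n w)
    = (\<Prod>b\<in>abs_cycles n w. if cycle_sign w b = 1 then p_plus (card b) else p_minus (card b))"
  unfolding type_series_def by (rule prod_signed_cycle_type[OF assms])

lemma image_mset_partition:
  assumes "finite D" "partition_on D Q"
  shows "image_mset c (mset_set D) = (\<Sum>b\<in>Q. image_mset c (mset_set b))"
proof -
  have "image_mset c (mset_set B) = (\<Sum>i\<in>B. {#c i#})" for B
    by (simp add: sum_unfold_sum_mset)
  then show ?thesis using sum.partition[OF assms, of "\<lambda>i. {#c i#}"] by simp
qed

definition colour_sign :: "nat \<Rightarrow> (int \<Rightarrow> var) \<Rightarrow> (int \<Rightarrow> int) \<Rightarrow> int" where
  "colour_sign n c w = (\<Prod>i\<in>{1..int n}. if is_X (c i) then 1 else sgn (w i))"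

definition colour_stabilizer :: "nat \<Rightarrow> (int \<Rightarrow> var) \<Rightarrow> (int \<Rightarrow> int) set" where
  "colour_stabilizer n c = {w \<in> signed_perms n. \<forall>i\<in>{1..int n}. c (unsigned w i) = c i}"

lemma finite_colour_stabilizer: "finite (colour_stabilizer n c)"
  by (simp add: colour_stabilizer_def signed_perms.finite_group)

lemma colour_stabilizer_iff_constant:
  assumes w: "w \<in> signed_perms n"
  shows "w \<in> colour_stabilizer n c
    \<longleftrightarrow> (\<forall>i\<in>{1..int n}. \<forall>j\<in>{1..int n}. orbit (unsigned w) i = orbit (unsigned w) j \<longrightarrow> c i = c j)"
proof (intro iffI ballI impI)
  fix i j assume stab: "w \<in> colour_stabilizer n c" and "i \<in> {1..int n}"
    and "orbit (unsigned w) i = orbit (unsigned w) j"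
  then have "j \<in> orbit (unsigned w) i" using self_mem_orbit[OF w] by blast
  then have "c j = c i \<and> j \<in> {1..int n}"
  proof (induction rule: orbit.induct)
    case base
    then show ?case
      using stab \<open>i \<in> {1..int n}\<close> unsigned_mem[OF w] unfolding colour_stabilizer_def by blast
  next
    case (step j)
    then show ?case using stab unsigned_mem[OF w, of j] unfolding colour_stabilizer_def by auto
  qed
  then show "c i = c j" by simp
next
  assume const: "\<forall>i\<in>{1..int n}. \<forall>j\<in>{1..int n}. orbit (unsigned w) i = orbit (unsigned w) j \<longrightarrow> c i = c j"
  have "c (unsigned w i) = c i" if "i \<in> {1..int n}" for i
    using const unsigned_mem[OF w that] that permutation_orbit_step[OF unsigned_permutation[OF w]]
    by blast
  then show "w \<in> colour_stabilizer n c" using w by (simp add: colour_stabilizer_def)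
qed

definition colouring_of_cycles :: "nat \<Rightarrow> (int \<Rightarrow> int) \<Rightarrow> (int set \<Rightarrow> var) \<Rightarrow> int \<Rightarrow> var" where
  "colouring_of_cycles n w E = (\<lambda>i\<in>{1..int n}. E (orbit (unsigned w) i))"

lemma colouring_of_cycles_apply:
  assumes "w \<in> signed_perms n" "b \<in> abs_cycles n w" "i \<in> b"
  shows "colouring_of_cycles n w E i = E b"
  using abs_cycle_subset[OF assms(1,2)] abs_cycle_eq_orbit[OF assms] assms(3)
  by (auto simp: colouring_of_cycles_def)

lemma colour_sign_colouring_of_cycles:
  assumes v: "v \<in> signed_perms n"
  shows "colour_sign n (colouring_of_cycles n v E) w
    = (\<Prod>b\<in>abs_cycles n v. if is_X (E b) then 1 else cycle_sign w b)"
  unfolding colour_sign_def prod.partition[OF finite_atLeastAtMost_int partition_on_abs_cycles[OF v]]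
  by (intro prod.cong refl) (simp add: colouring_of_cycles_apply[OF v] cycle_sign_def)

lemma content_colouring_of_cycles:
  assumes w: "w \<in> signed_perms n"
  shows "image_mset (colouring_of_cycles n w E) (mset_set {1..int n})
    = (\<Sum>b\<in>abs_cycles n w. replicate_mset (card b) (E b))"
proof -
  have "image_mset (colouring_of_cycles n w E) (mset_set b) = replicate_mset (card b) (E b)"
    if "b \<in> abs_cycles n w" for b
  proof -
    have "image_mset (colouring_of_cycles n w E) (mset_set b) = image_mset (\<lambda>_. E b) (mset_set b)"
      using finite_abs_cycle[OF w that]
      by (intro image_mset_cong) (simp add: colouring_of_cycles_apply[OF w that])
    then show ?thesis by (simp add: image_mset_const_eq)
  qed
  then show ?thesis by (simp add: image_mset_partition[OF _ partition_on_abs_cycles[OF w]])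
qed

lemma bij_betw_colouring_of_cycles:
  assumes w: "w \<in> signed_perms n"
  shows "bij_betw (colouring_of_cycles n w) (weighted_fillings (abs_cycles n w) card M)
    {c \<in> fillings {1..int n} M. w \<in> colour_stabilizer n c}"
proof -
  let ?D = "{1..int n}" and ?orbit = "orbit (unsigned w)"
  have "bij_betw (colouring_of_cycles n w) (abs_cycles n w \<rightarrow>\<^sub>E UNIV)
      {c \<in> ?D \<rightarrow>\<^sub>E UNIV. \<forall>i\<in>?D. \<forall>j\<in>?D. ?orbit i = ?orbit j \<longrightarrow> c i = c j}"
    unfolding colouring_of_cycles_def[abs_def]
    by (rule bij_betw_PiE_comp_surj) (simp add: abs_cycles_def)
  also have "{c \<in> ?D \<rightarrow>\<^sub>E UNIV. \<forall>i\<in>?D. \<forall>j\<in>?D. ?orbit i = ?orbit j \<longrightarrow> c i = c j}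
      = {c \<in> ?D \<rightarrow>\<^sub>E UNIV. w \<in> colour_stabilizer n c}"
    by (simp only: colour_stabilizer_iff_constant[OF w])
  finally have "bij_betw (colouring_of_cycles n w)
      {E \<in> abs_cycles n w \<rightarrow>\<^sub>E UNIV. image_mset (colouring_of_cycles n w E) (mset_set ?D) = M}
      {c \<in> {c \<in> ?D \<rightarrow>\<^sub>E UNIV. w \<in> colour_stabilizer n c}. image_mset c (mset_set ?D) = M}"
    by (rule bij_betw_Collect) (rule refl)
  also have "{E \<in> abs_cycles n w \<rightarrow>\<^sub>E UNIV. image_mset (colouring_of_cycles n w E) (mset_set ?D) = M}
      = weighted_fillings (abs_cycles n w) card M"
    by (simp only: content_colouring_of_cycles[OF w] weighted_fillings_def)
  also have "{c \<in> {c \<in> ?D \<rightarrow>\<^sub>E UNIV. w \<in> colour_stabilizer n c}. image_mset c (mset_set ?D) = M}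
      = {c \<in> fillings ?D M. w \<in> colour_stabilizer n c}"
    by (simp add: fillings_def conj_ac)
  finally show ?thesis .
qed

lemma mcoeff_type_series:
  assumes w: "w \<in> signed_perms n"
  shows "mcoeff (type_series (signed_cycle_type n w)) M
    = (\<Sum>c | c \<in> fillings {1..int n} M \<and> w \<in> colour_stabilizer n c. of_int (colour_sign n c w))"
proof -
  let ?Q = "abs_cycles n w"
  let ?weight = "\<lambda>b v. of_int (if is_X v then 1 else cycle_sign w b) :: complex"
  have "mcoeff (type_series (signed_cycle_type n w)) M
      = (\<Sum>E\<in>weighted_fillings ?Q card M. \<Prod>b\<in>?Q. ?weight b (E b))"
    unfolding type_series_eq_prod[OF w]
  proof (rule mcoeff_prod_power_series[OF finite_abs_cycles])
    fix b assume b: "b \<in> ?Q"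
    show nonempty: "card b \<noteq> 0" using finite_abs_cycle[OF w b] abs_cycle_nonempty[OF b] by simp
    show "mcoeff (if cycle_sign w b = 1 then p_plus (card b) else p_minus (card b)) A
        = (\<Sum>v | replicate_mset (card b) v = A. ?weight b v)" for A
      using nonempty cycle_sign_cases[OF w b] by (rule mcoeff_cycle_series)
  qed
  also have "\<dots> = (\<Sum>c | c \<in> fillings {1..int n} M \<and> w \<in> colour_stabilizer n c. of_int (colour_sign n c w))"
    unfolding sum.reindex_bij_betw[OF bij_betw_colouring_of_cycles[OF w], symmetric]
    by (simp only: colour_sign_colouring_of_cycles[OF w] of_int_prod)
  finally show ?thesis .
qed

lemma mcoeff_ch_eq_sum_colourings:
  "mcoeff (ch n f) M = (\<Sum>c\<in>fillings {1..int n} M. \<Sum>w\<in>colour_stabilizer n c.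
      f w * of_int (colour_sign n c w)) / of_nat (card (signed_perms n))"
proof -
  let ?C = "fillings {1..int n} M" and ?t = "\<lambda>c w. f w * of_int (colour_sign n c w)"
  have "(\<Sum>w\<in>signed_perms n. f w * mcoeff (type_series (signed_cycle_type n w)) M)
      = (\<Sum>w\<in>signed_perms n. \<Sum>c\<in>{c \<in> ?C. w \<in> colour_stabilizer n c}. ?t c w)"
    by (simp add: mcoeff_type_series sum_distrib_left)
  also have "\<dots> = (\<Sum>c\<in>?C. \<Sum>w\<in>{w \<in> signed_perms n. w \<in> colour_stabilizer n c}. ?t c w)"
    by (intro sum.swap_restrict signed_perms.finite_group finite_fillings) simp
  finally show ?thesis by (simp add: mcoeff_ch colour_stabilizer_def)
qed

lemma mcoeff_ch_eq_0_of_size: "size M \<noteq> n \<Longrightarrow> mcoeff (ch n f) M = 0"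
  using fillings_eq_empty_iff[of "{1..int n}" M] by (simp add: mcoeff_ch_eq_sum_colourings)

lemma colour_transport:
  assumes "c \<in> fillings {1..int n} M" "c' \<in> fillings {1..int n} M"
  obtains u where "u \<in> signed_perms n" "\<And>i. i \<in> {1..int n} \<Longrightarrow> u i \<in> {1..int n}"
    and "\<And>i. i \<in> {1..int n} \<Longrightarrow> c (u i) = c' i"
proof -
  obtain p where p: "p permutes {1..int n}" "\<And>i. i \<in> {1..int n} \<Longrightarrow> c' i = c (p i)"
    using fillings_eq_permuted[OF _ assms] by blast
  show ?thesis
  proof
    show "odd_extension n p \<in> signed_perms n" by (rule odd_extension_permutes(1)[OF p(1)])
    fix i assume "i \<in> {1..int n}"
    then show "odd_extension n p i \<in> {1..int n}" "c (odd_extension n p i) = c' i"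
      using permutes_in_image[OF p(1)] p(2) by (simp_all add: odd_extension_apply)
  qed
qed

context
  fixes n u and c c' :: "int \<Rightarrow> var"
  assumes u: "u \<in> signed_perms n"
    and positive: "\<And>i. i \<in> {1..int n} \<Longrightarrow> u i \<in> {1..int n}"
    and transport: "\<And>i. i \<in> {1..int n} \<Longrightarrow> c (u i) = c' i"
begin

lemma positive_signed_perm_image: "u ` {1..int n} = {1..int n}"
proof -
  have "unsigned u i = u i" if "i \<in> {1..int n}" for i
    using positive[OF that] that by (simp add: unsigned_def)
  then have "unsigned u ` {1..int n} = u ` {1..int n}" by (rule image_cong[OF refl])
  then show ?thesis using permutes_image[OF unsigned_permutes[OF u]] by simp
qed

lemma positive_signed_perm_apply:
  assumes "w \<in> signed_perms n" "i \<in> {1..int n}"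
  shows "unsigned (u \<circ> w) i = u (unsigned w i)" "sgn ((u \<circ> w) i) = sgn (w i)"
proof -
  have abs: "\<bar>w i\<bar> \<in> {1..int n}" using signed_perms_abs_mem_iff[OF assms(1), of i] assms(2) by simp
  have "u (w i) = sgn (w i) * u \<bar>w i\<bar>"
    using signed_perms_sign_mult[OF u abs_sgn_signed_perms[OF assms(1)], of i "\<bar>w i\<bar>"] assms(2)
    by (simp add: sgn_mult_abs)
  moreover have "w i \<noteq> 0" using abs by auto
  ultimately show "unsigned (u \<circ> w) i = u (unsigned w i)" "sgn ((u \<circ> w) i) = sgn (w i)"
    using positive[OF abs] abs assms(2) by (simp_all add: unsigned_def abs_mult sgn_mult abs_sgn_eq)
qed

lemma transported_stabilizer_iff:
  assumes "w \<in> signed_perms n"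
  shows "u \<circ> w \<circ> inv u \<in> colour_stabilizer n c \<longleftrightarrow> w \<in> colour_stabilizer n c'"
proof -
  have "(\<forall>k\<in>{1..int n}. c (unsigned (u \<circ> w \<circ> inv u) k) = c k)
      \<longleftrightarrow> (\<forall>k\<in>u ` {1..int n}. c (unsigned (u \<circ> w \<circ> inv u) k) = c k)"
    by (simp only: positive_signed_perm_image)
  also have "\<dots> \<longleftrightarrow> (\<forall>i\<in>{1..int n}. c (unsigned (u \<circ> w \<circ> inv u) (u i)) = c (u i))"
    by (simp only: ball_simps)
  also have "\<dots> \<longleftrightarrow> (\<forall>i\<in>{1..int n}. c (u (unsigned w i)) = c (u i))"
  proof (rule ball_cong[OF refl])
    fix i assume i: "i \<in> {1..int n}"
    then have "unsigned (u \<circ> w \<circ> inv u) (u i) = unsigned (u \<circ> w) i"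
      using positive[OF i] by (simp add: unsigned_def signed_perms.inv_apply[OF u])
    then show "c (unsigned (u \<circ> w \<circ> inv u) (u i)) = c (u i) \<longleftrightarrow> c (u (unsigned w i)) = c (u i)"
      using positive_signed_perm_apply(1)[OF assms i] by simp
  qed
  also have "\<dots> \<longleftrightarrow> (\<forall>i\<in>{1..int n}. c' (unsigned w i) = c' i)"
    using transport unsigned_mem[OF assms] by simp
  finally show ?thesis
    using assms signed_perms.conj_mem[OF u assms] by (simp add: colour_stabilizer_def)
qed

lemma bij_betw_transported_stabilizer:
  "bij_betw (\<lambda>w. u \<circ> w \<circ> inv u) (colour_stabilizer n c') (colour_stabilizer n c)"
proof (rule bij_betw_byWitness[where f' = "\<lambda>w. inv u \<circ> w \<circ> u"])
  show "\<forall>w\<in>colour_stabilizer n c'. inv u \<circ> (u \<circ> w \<circ> inv u) \<circ> u = w"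
    "\<forall>w\<in>colour_stabilizer n c. u \<circ> (inv u \<circ> w \<circ> u) \<circ> inv u = w"
    by (intro ballI signed_perms.inv_conj_conj[OF u])+
  show "(\<lambda>w. u \<circ> w \<circ> inv u) ` colour_stabilizer n c' \<subseteq> colour_stabilizer n c"
    using transported_stabilizer_iff by (auto simp: colour_stabilizer_def)
  show "(\<lambda>w. inv u \<circ> w \<circ> u) ` colour_stabilizer n c \<subseteq> colour_stabilizer n c'"
  proof (rule image_subsetI)
    fix w assume w: "w \<in> colour_stabilizer n c"
    then have "w \<in> signed_perms n" by (simp add: colour_stabilizer_def)
    then have "inv u \<circ> w \<circ> u \<in> signed_perms n" by (rule signed_perms.inv_conj_mem[OF u])
    from transported_stabilizer_iff[OF this] show "inv u \<circ> w \<circ> u \<in> colour_stabilizer n c'"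
      using w by (simp only: signed_perms.inv_conj_conj[OF u])
  qed
qed

lemma colour_sign_transported:
  assumes "w \<in> signed_perms n"
  shows "colour_sign n c (u \<circ> w \<circ> inv u) = colour_sign n c' w"
proof -
  have inj: "inj_on u {1..int n}" using signed_perms_inj[OF u] by (rule inj_on_subset) simp
  have "colour_sign n c (u \<circ> w \<circ> inv u)
      = (\<Prod>k\<in>u ` {1..int n}. if is_X (c k) then 1 else sgn ((u \<circ> w \<circ> inv u) k))"
    by (simp only: colour_sign_def positive_signed_perm_image)
  also have "\<dots> = (\<Prod>i\<in>{1..int n}. if is_X (c (u i)) then 1 else sgn ((u \<circ> w) i))"
    by (simp add: prod.reindex[OF inj] signed_perms.inv_apply[OF u] cong: if_cong)
  also have "\<dots> = colour_sign n c' w"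
    unfolding colour_sign_def
    using transport positive_signed_perm_apply(2)[OF assms] by (intro prod.cong refl) simp
  finally show ?thesis .
qed

lemma card_colour_transporters:
  "card {w \<in> signed_perms n. \<forall>i\<in>{1..int n}. c (unsigned w i) = c' i} = card (colour_stabilizer n c)"
proof -
  have "{w \<in> signed_perms n. \<forall>i\<in>{1..int n}. c (unsigned w i) = c' i}
      = {w \<in> signed_perms n. inv u \<circ> w \<in> colour_stabilizer n c'}"
  proof (intro Collect_cong conj_cong refl)
    fix w assume "w \<in> signed_perms n"
    then have mem: "inv u \<circ> w \<in> signed_perms n" by (intro signed_perms.comp_mem signed_perms.inv_mem u)
    have w: "u \<circ> (inv u \<circ> w) = w" by (simp add: fun_eq_iff signed_perms.apply_inv[OF u])
    have "c (unsigned w i) = c' (unsigned (inv u \<circ> w) i)" if "i \<in> {1..int n}" for i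
      using positive_signed_perm_apply(1)[OF mem that] transport[OF unsigned_mem[OF mem that]]
      by (simp only: w)
    then show "(\<forall>i\<in>{1..int n}. c (unsigned w i) = c' i) \<longleftrightarrow> inv u \<circ> w \<in> colour_stabilizer n c'"
      using mem by (simp add: colour_stabilizer_def)
  qed
  then have "card {w \<in> signed_perms n. \<forall>i\<in>{1..int n}. c (unsigned w i) = c' i}
      = card {w \<in> signed_perms n. w \<in> colour_stabilizer n c'}"
    using signed_perms.card_left_translate[OF u, of "\<lambda>w. w \<in> colour_stabilizer n c'"] by (simp only:)
  also have "{w \<in> signed_perms n. w \<in> colour_stabilizer n c'} = colour_stabilizer n c'"
    by (auto simp: colour_stabilizer_def)
  finally show ?thesis using bij_betw_same_card[OF bij_betw_transported_stabilizer] by simp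
qed

end

lemma sum_colour_stabilizer_eq:
  assumes f: "class_function (signed_perms n) f"
    and "c \<in> fillings {1..int n} M" "c' \<in> fillings {1..int n} M"
  shows "(\<Sum>w\<in>colour_stabilizer n c'. f w * of_int (colour_sign n c' w))
    = (\<Sum>w\<in>colour_stabilizer n c. f w * of_int (colour_sign n c w))"
proof -
  obtain u where u: "u \<in> signed_perms n" "\<And>i. i \<in> {1..int n} \<Longrightarrow> u i \<in> {1..int n}"
    "\<And>i. i \<in> {1..int n} \<Longrightarrow> c (u i) = c' i"
    using colour_transport[OF assms(2,3)] by blast
  have "(\<Sum>w\<in>colour_stabilizer n c. f w * of_int (colour_sign n c w))
      = (\<Sum>w\<in>colour_stabilizer n c'. f (u \<circ> w \<circ> inv u) * of_int (colour_sign n c (u \<circ> w \<circ> inv u)))"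
    by (rule sum.reindex_bij_betw[OF bij_betw_transported_stabilizer[where c = c and c' = c', OF u], symmetric])
  also have "\<dots> = (\<Sum>w\<in>colour_stabilizer n c'. f w * of_int (colour_sign n c' w))"
    using class_functionD[OF f u(1)] colour_sign_transported[where c = c and c' = c', OF u]
    by (intro sum.cong refl) (simp add: colour_stabilizer_def)
  finally show ?thesis ..
qed

lemma card_fillings_mult_stabilizer:
  assumes "c \<in> fillings {1..int n} M"
  shows "card (fillings {1..int n} M) * card (colour_stabilizer n c) = card (signed_perms n)"
proof -
  let ?C = "fillings {1..int n} M"
  let ?T = "\<lambda>c'. {w \<in> signed_perms n. \<forall>i\<in>{1..int n}. c (unsigned w i) = c' i}"
  have "signed_perms n = (\<Union>c'\<in>?C. ?T c')"
  proof (intro equalityI subsetI)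
    fix w assume w: "w \<in> signed_perms n"
    have "image_mset (c \<circ> unsigned w) (mset_set {1..int n}) = image_mset c (mset_set {1..int n})"
      unfolding multiset.map_comp[symmetric] permutes_image_mset[OF unsigned_permutes[OF w]] ..
    also have "\<dots> = M" using assms by (simp add: fillings_def)
    finally have "restrict (c \<circ> unsigned w) {1..int n} \<in> ?C" by (simp add: restrict_mem_fillings_iff)
    moreover have "w \<in> ?T (restrict (c \<circ> unsigned w) {1..int n})" using w by simp
    ultimately show "w \<in> (\<Union>c'\<in>?C. ?T c')" by blast
  qed blast
  also have "card \<dots> = (\<Sum>c'\<in>?C. card (?T c'))"
  proof (rule card_UN_disjoint)
    have "c' = c''" if "c' \<in> ?C" "c'' \<in> ?C" "w \<in> ?T c'" "w \<in> ?T c''" for c' c'' w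
    proof (rule PiE_ext)
      show "c' \<in> {1..int n} \<rightarrow>\<^sub>E UNIV" "c'' \<in> {1..int n} \<rightarrow>\<^sub>E UNIV"
        using that(1,2) by (simp_all add: fillings_def)
      show "c' i = c'' i" if "i \<in> {1..int n}" for i using that \<open>w \<in> ?T c'\<close> \<open>w \<in> ?T c''\<close> by auto
    qed
    then show "\<forall>c'\<in>?C. \<forall>c''\<in>?C. c' \<noteq> c'' \<longrightarrow> ?T c' \<inter> ?T c'' = {}" by blast
  qed (simp_all add: finite_fillings signed_perms.finite_group)
  also have "\<dots> = (\<Sum>c'\<in>?C. card (colour_stabilizer n c))"
  proof (rule sum.cong[OF refl])
    fix c' assume "c' \<in> ?C"
    then obtain u where u: "u \<in> signed_perms n" "\<And>i. i \<in> {1..int n} \<Longrightarrow> u i \<in> {1..int n}"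
      "\<And>i. i \<in> {1..int n} \<Longrightarrow> c (u i) = c' i"
      using colour_transport[OF assms] by blast
    show "card (?T c') = card (colour_stabilizer n c)"
      by (rule card_colour_transporters[where c = c and c' = c', OF u])
  qed
  finally show ?thesis by simp
qed

theorem mcoeff_ch_class_function:
  assumes "class_function (signed_perms n) f" "c \<in> fillings {1..int n} M"
  shows "mcoeff (ch n f) M = (\<Sum>w\<in>colour_stabilizer n c. f w * of_int (colour_sign n c w))
    / of_nat (card (colour_stabilizer n c))"
proof -
  let ?S = "\<Sum>w\<in>colour_stabilizer n c. f w * of_int (colour_sign n c w)"
  let ?C = "fillings {1..int n} M"
  have "mcoeff (ch n f) M = of_nat (card ?C) * ?S / of_nat (card (signed_perms n))"
    unfolding mcoeff_ch_eq_sum_colourings by (simp add: sum_colour_stabilizer_eq[OF assms])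
  moreover have "card ?C \<noteq> 0" using assms(2) finite_fillings[of "{1..int n}" M] by auto
  ultimately show ?thesis by (simp add: flip: card_fillings_mult_stabilizer[OF assms(2)])
qed

section \<open>Conjugacy of signed permutations with equal cycles\<close>

lemma funpow_sign_mult_eq_iff:
  assumes w: "w \<in> signed_perms n" and i: "i \<in> {1..int n}" and signs: "\<bar>s\<bar> = 1" "\<bar>t\<bar> = 1"
  defines "b \<equiv> orbit (unsigned w) i"
  shows "s * (w ^^ k) i = t * (w ^^ (k + d)) i \<longleftrightarrow> card b dvd d \<and> s * t = cycle_sign w b ^ (d div card b)"
proof -
  note mult = signed_perms_sign_mult[OF signed_perms_funpow[OF w]]
  have "s * (w ^^ k) i = t * (w ^^ (k + d)) i \<longleftrightarrow> (w ^^ k) (s * i) = (w ^^ k) (t * (w ^^ d) i)"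
    by (simp add: funpow_add mult[OF signs(1)] mult[OF signs(2)])
  also have "\<dots> \<longleftrightarrow> s * i = t * (w ^^ d) i"
    using inj_eq[OF signed_perms_inj[OF signed_perms_funpow[OF w]]] .
  also have "\<dots> \<longleftrightarrow> (w ^^ d) i = (s * t) * i" using signs by (auto simp: abs_if split: if_splits)
  also have "\<dots> \<longleftrightarrow> card b dvd d \<and> s * t = cycle_sign w b ^ (d div card b)"
    unfolding b_def using signs by (intro funpow_eq_sign_mult_iff[OF w i]) (simp add: abs_mult)
  finally show ?thesis .
qed

lemma Min_abs_cycle_mem:
  assumes "w \<in> signed_perms n" "b \<in> abs_cycles n w" shows "Min b \<in> b"
  by (intro Min_in finite_abs_cycle[OF assms] abs_cycle_nonempty[OF assms(2)])

text \<open>The cycles of \<open>w\<close> and of \<open>v\<close> are traversed simultaneously, starting from the least element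
  of each cycle.\<close>

definition cycle_aligned :: "nat \<Rightarrow> (int \<Rightarrow> int) \<Rightarrow> (int \<Rightarrow> int) \<Rightarrow> int \<Rightarrow> int \<Rightarrow> bool" where
  "cycle_aligned n w v x y \<longleftrightarrow> (\<exists>b\<in>abs_cycles n w. \<exists>s k. \<bar>s\<bar> = 1 \<and>
    x = s * (w ^^ k) (Min b) \<and> y = s * (v ^^ k) (Min b))"

lemma abs_funpow_Min_mem:
  assumes "w \<in> signed_perms n" "b \<in> abs_cycles n w" "\<bar>s\<bar> = 1"
  shows "\<bar>s * (w ^^ k) (Min b)\<bar> \<in> b"
proof -
  note Min = Min_abs_cycle_mem[OF assms(1,2)]
  have "0 < Min b" using abs_cycle_pos[OF assms(1,2)] Min by auto
  then have "\<bar>s * (w ^^ k) (Min b)\<bar> = (unsigned w ^^ k) (Min b)"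
    using abs_funpow[OF assms(1)] assms(3) by (simp add: abs_mult)
  also have "\<dots> \<in> orbit (unsigned w) (Min b)"
    unfolding orbit_eq_range[OF unsigned_permutation[OF assms(1)]] by blast
  finally show ?thesis using abs_cycle_eq_orbit[OF assms(1,2) Min] by simp
qed

lemma ex_cycle_aligned:
  assumes "w \<in> signed_perms n" "\<bar>x\<bar> \<in> {1..int n}" shows "\<exists>y. cycle_aligned n w v x y"
proof -
  define b where "b = orbit (unsigned w) \<bar>x\<bar>"
  have b: "b \<in> abs_cycles n w" unfolding b_def by (rule orbit_mem_abs_cycles[OF assms(2)])
  note Min = Min_abs_cycle_mem[OF assms(1) b]
  have "\<bar>x\<bar> \<in> orbit (unsigned w) (Min b)"
    using self_mem_orbit[OF assms(1)] abs_cycle_eq_orbit[OF assms(1) b Min] by (simp add: b_def)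
  then obtain k where "\<bar>x\<bar> = (unsigned w ^^ k) (Min b)"
    unfolding orbit_eq_range[OF unsigned_permutation[OF assms(1)]] by blast
  moreover have "0 < Min b" using abs_cycle_pos[OF assms(1) b] Min by auto
  ultimately have "\<bar>x\<bar> = \<bar>(w ^^ k) (Min b)\<bar>" using abs_funpow[OF assms(1)] by simp
  then have "\<exists>s. \<bar>s\<bar> = 1 \<and> x = s * (w ^^ k) (Min b)"
    by (intro exI[of _ "if x = (w ^^ k) (Min b) then 1 else - 1"]) (auto simp: abs_eq_iff)
  then show ?thesis using b unfolding cycle_aligned_def by blast
qed

lemma cycle_aligned_sign_mult:
  assumes "cycle_aligned n w v x y" "\<bar>s\<bar> = 1" shows "cycle_aligned n w v (s * x) (s * y)"
proof -
  obtain b t k where "b \<in> abs_cycles n w" "\<bar>t\<bar> = 1" "x = t * (w ^^ k) (Min b)" "y = t * (v ^^ k) (Min b)"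
    using assms(1) unfolding cycle_aligned_def by blast
  then show ?thesis
    using assms(2) unfolding cycle_aligned_def
    by (intro bexI[of _ b] exI[of _ "s * t"] exI[of _ k]) (simp_all add: abs_mult)
qed

lemma cycle_aligned_step:
  assumes "w \<in> signed_perms n" "v \<in> signed_perms n" "cycle_aligned n w v x y"
  shows "cycle_aligned n w v (w x) (v y)"
proof -
  obtain b s k where b: "b \<in> abs_cycles n w" "\<bar>s\<bar> = 1" "x = s * (w ^^ k) (Min b)" "y = s * (v ^^ k) (Min b)"
    using assms(3) unfolding cycle_aligned_def by blast
  then have "w x = s * (w ^^ Suc k) (Min b)" "v y = s * (v ^^ Suc k) (Min b)"
    using signed_perms_sign_mult[OF assms(1) b(2)] signed_perms_sign_mult[OF assms(2) b(2)] by simp_all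
  then show ?thesis using b(1,2) unfolding cycle_aligned_def by blast
qed

context
  fixes n w v
  assumes w: "w \<in> signed_perms n" and v: "v \<in> signed_perms n"
    and cycles: "abs_cycles n w = abs_cycles n v"
    and signs: "\<And>b. b \<in> abs_cycles n v \<Longrightarrow> cycle_sign w b = cycle_sign v b"
begin

lemma funpow_sign_mult_eq_iff_same_cycles:
  assumes b: "b \<in> abs_cycles n v" and st: "\<bar>s\<bar> = 1" "\<bar>t\<bar> = 1"
  shows "s * (w ^^ k) (Min b) = t * (w ^^ l) (Min b) \<longleftrightarrow> s * (v ^^ k) (Min b) = t * (v ^^ l) (Min b)"
proof -
  note Min = Min_abs_cycle_mem[OF v b]
  have i: "Min b \<in> {1..int n}" using abs_cycle_subset[OF v b] Min by blast
  have "orbit (unsigned w) (Min b) = b" "orbit (unsigned v) (Min b) = b"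
    using abs_cycle_eq_orbit[OF w _ Min] abs_cycle_eq_orbit[OF v b Min] b cycles by simp_all
  then have shift: "s * (w ^^ k) (Min b) = t * (w ^^ (k + d)) (Min b)
      \<longleftrightarrow> s * (v ^^ k) (Min b) = t * (v ^^ (k + d)) (Min b)"
    if "\<bar>s\<bar> = 1" "\<bar>t\<bar> = 1" for s t k d
    unfolding funpow_sign_mult_eq_iff[OF w i that] funpow_sign_mult_eq_iff[OF v i that]
    by (simp add: signs[OF b])
  show ?thesis
  proof (cases "k \<le> l")
    case True
    then show ?thesis using shift[OF st, of k "l - k"] by simp
  next
    case False
    then show ?thesis using shift[OF st(2,1), of l "k - l"] by (simp add: eq_commute)
  qed
qed

lemma cycle_aligned_eq_iff:
  assumes "cycle_aligned n w v x y" "cycle_aligned n w v x' y'" shows "x = x' \<longleftrightarrow> y = y'"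
proof -
  obtain b s k where b: "b \<in> abs_cycles n w" "\<bar>s\<bar> = 1" "x = s * (w ^^ k) (Min b)" "y = s * (v ^^ k) (Min b)"
    using assms(1) unfolding cycle_aligned_def by blast
  obtain b' s' k' where b': "b' \<in> abs_cycles n w" "\<bar>s'\<bar> = 1" "x' = s' * (w ^^ k') (Min b')"
    "y' = s' * (v ^^ k') (Min b')"
    using assms(2) unfolding cycle_aligned_def by blast
  show ?thesis
  proof (cases "b = b'")
    case True
    then show ?thesis using funpow_sign_mult_eq_iff_same_cycles[of b s s' k k'] b b' cycles by simp
  next
    case False
    then have "b \<inter> b' = {}" using abs_cycles_disjoint[OF w b(1) b'(1)] by simp
    moreover have "\<bar>x\<bar> \<in> b" "\<bar>x'\<bar> \<in> b'" "\<bar>y\<bar> \<in> b" "\<bar>y'\<bar> \<in> b'"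
      using abs_funpow_Min_mem[OF w] abs_funpow_Min_mem[OF v] b b' cycles by simp_all
    ultimately show ?thesis by auto
  qed
qed

lemma inj_on_abs_aligned:
  assumes g: "\<And>i. i \<in> {1..int n} \<Longrightarrow> cycle_aligned n w v i (g i)"
  shows "inj_on (\<lambda>i. \<bar>g i\<bar>) {1..int n}"
proof (rule inj_onI)
  fix i j assume i: "i \<in> {1..int n}" and j: "j \<in> {1..int n}" and "\<bar>g i\<bar> = \<bar>g j\<bar>"
  then have "g i = (if g i = g j then 1 else - 1) * g j" by (auto simp: abs_eq_iff)
  then obtain s where s: "\<bar>s\<bar> = 1" "g i = s * g j" by (rule that[rotated]) simp
  have "cycle_aligned n w v i (s * g j)" using g[OF i] s(2) by simp
  moreover have "cycle_aligned n w v (s * j) (s * g j)"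
    using g[OF j] s(1) by (rule cycle_aligned_sign_mult)
  ultimately have "i = s * j" by (simp only: cycle_aligned_eq_iff)
  then have "\<bar>i\<bar> = \<bar>j\<bar>" using s(1) by (simp add: abs_mult)
  then show "i = j" using i j by simp
qed

lemma ex_aligning_signed_perm:
  obtains u where "u \<in> signed_perms n" "\<And>x. \<bar>x\<bar> \<in> {1..int n} \<Longrightarrow> cycle_aligned n w v x (u x)"
proof
  define g where "g i = (SOME y. cycle_aligned n w v i y)" for i
  have g: "cycle_aligned n w v i (g i)" if "i \<in> {1..int n}" for i
    unfolding g_def by (rule someI_ex[OF ex_cycle_aligned[OF w]]) (use that in simp)
  show "odd_extension n g \<in> signed_perms n"
  proof (rule odd_extension_signed_perm[OF _ inj_on_abs_aligned[OF g]])
    fix i assume "i \<in> {1..int n}"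
    then obtain b s k where "b \<in> abs_cycles n w" "\<bar>s\<bar> = 1" "g i = s * (v ^^ k) (Min b)"
      using g unfolding cycle_aligned_def by blast
    then have "\<bar>g i\<bar> \<in> b" "b \<subseteq> {1..int n}"
      using abs_funpow_Min_mem[OF v] abs_cycle_subset[OF w] cycles by simp_all
    then show "\<bar>g i\<bar> \<in> {1..int n}" by blast
  qed
  fix x assume x: "\<bar>x\<bar> \<in> {1..int n}"
  then have "\<bar>sgn x\<bar> = 1" by (auto simp: sgn_if)
  then have "cycle_aligned n w v (sgn x * \<bar>x\<bar>) (sgn x * g \<bar>x\<bar>)"
    by (rule cycle_aligned_sign_mult[OF g[OF x]])
  then show "cycle_aligned n w v x (odd_extension n g x)"
    using x by (simp add: odd_extension_def sgn_mult_abs)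
qed

lemma ex_conjugator:
  obtains u where "u \<in> signed_perms n" "u \<circ> w \<circ> inv u = v"
proof -
  obtain u where u: "u \<in> signed_perms n"
    and aligned: "\<And>x. \<bar>x\<bar> \<in> {1..int n} \<Longrightarrow> cycle_aligned n w v x (u x)"
    using ex_aligning_signed_perm by blast
  have "u \<circ> w = v \<circ> u"
  proof (rule signed_perms_eqI)
    fix i assume "i \<in> {1..int n}"
    then have i: "\<bar>i\<bar> \<in> {1..int n}" by simp
    then have "cycle_aligned n w v (w i) (u (w i))"
      using signed_perms_abs_mem_iff[OF w] by (intro aligned) simp
    from cycle_aligned_eq_iff[OF this cycle_aligned_step[OF w v aligned[OF i]]]
    show "(u \<circ> w) i = (v \<circ> u) i" by simp
  qed (simp_all add: signed_perms.comp_mem w v u)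
  then have "u \<circ> w \<circ> inv u = v" by (simp add: comp_assoc signed_perms.comp_inv[OF u])
  then show ?thesis using that u by blast
qed

end

section \<open>The characteristic determines a class function\<close>

definition cycle_colouring :: "nat \<Rightarrow> (int \<Rightarrow> int) \<Rightarrow> int set set \<Rightarrow> int \<Rightarrow> var" where
  "cycle_colouring n v T = colouring_of_cycles n v (\<lambda>b. (if b \<in> T then Y else X) (nat (Min b)))"

definition cycle_preservers :: "nat \<Rightarrow> (int \<Rightarrow> int) \<Rightarrow> (int \<Rightarrow> int) set" where
  "cycle_preservers n v =
     {w \<in> signed_perms n. \<forall>i\<in>{1..int n}. orbit (unsigned v) (unsigned w i) = orbit (unsigned v) i}"

lemma cycle_colouring_eq_iff:
  assumes v: "v \<in> signed_perms n" and ij: "i \<in> {1..int n}" "j \<in> {1..int n}"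
  shows "cycle_colouring n v T i = cycle_colouring n v T j \<longleftrightarrow> orbit (unsigned v) i = orbit (unsigned v) j"
proof
  let ?orbit = "orbit (unsigned v)"
  have Min: "Min (?orbit k) \<in> ?orbit k" "0 < Min (?orbit k)" if "k \<in> {1..int n}" for k
    using Min_abs_cycle_mem[OF v orbit_mem_abs_cycles[OF that]] abs_cycle_pos[OF v orbit_mem_abs_cycles[OF that]]
    by auto
  assume "cycle_colouring n v T i = cycle_colouring n v T j"
  then have "nat (Min (?orbit i)) = nat (Min (?orbit j))"
    using ij by (simp add: cycle_colouring_def colouring_of_cycles_def split: if_splits)
  then have "Min (?orbit i) = Min (?orbit j)" using Min(2)[OF ij(1)] Min(2)[OF ij(2)] by simp
  then have "Min (?orbit i) \<in> ?orbit i" "Min (?orbit i) \<in> ?orbit j"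
    using Min(1)[OF ij(1)] Min(1)[OF ij(2)] by simp_all
  then show "?orbit i = ?orbit j" using orbit_eq_of_mem[OF unsigned_permutation[OF v]] by metis
qed (use ij in \<open>simp add: cycle_colouring_def colouring_of_cycles_def\<close>)

lemma colour_stabilizer_cycle_colouring:
  assumes v: "v \<in> signed_perms n"
  shows "colour_stabilizer n (cycle_colouring n v T) = cycle_preservers n v"
  unfolding colour_stabilizer_def cycle_preservers_def
  by (intro Collect_cong conj_cong ball_cong refl cycle_colouring_eq_iff[OF v] unsigned_mem)

lemma colour_sign_cycle_colouring:
  assumes v: "v \<in> signed_perms n" and T: "T \<subseteq> abs_cycles n v"
  shows "colour_sign n (cycle_colouring n v T) w = (\<Prod>b\<in>T. cycle_sign w b)"
proof -
  have "colour_sign n (cycle_colouring n v T) w = (\<Prod>b\<in>abs_cycles n v. if b \<in> T then cycle_sign w b else 1)"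
    unfolding cycle_colouring_def colour_sign_colouring_of_cycles[OF v] by (intro prod.cong) auto
  also have "\<dots> = (\<Prod>b\<in>T. cycle_sign w b)"
    using prod.inter_restrict[OF finite_abs_cycles, of "cycle_sign w" n v T] T
    by (simp add: Int_absorb1)
  finally show ?thesis .
qed

lemma self_mem_cycle_preservers: "v \<in> signed_perms n \<Longrightarrow> v \<in> cycle_preservers n v"
  by (simp add: cycle_preservers_def orbit_eq_of_mem[OF unsigned_permutation] orbit.base)

lemma finite_cycle_preservers: "finite (cycle_preservers n v)"
  by (simp add: cycle_preservers_def signed_perms.finite_group)

lemma cycle_preserver_refines:
  assumes v: "v \<in> signed_perms n" and "w \<in> cycle_preservers n v"
  shows "refines {1..int n} (abs_cycles n w) (abs_cycles n v)"
proof -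
  have w: "w \<in> signed_perms n"
    and preserve: "\<And>i. i \<in> {1..int n} \<Longrightarrow> orbit (unsigned v) (unsigned w i) = orbit (unsigned v) i"
    using assms(2) by (simp_all add: cycle_preservers_def)
  have "\<exists>b\<in>abs_cycles n v. a \<subseteq> b" if a: "a \<in> abs_cycles n w" for a
  proof -
    obtain i where i: "i \<in> {1..int n}" "a = orbit (unsigned w) i"
      using a unfolding abs_cycles_def by blast
    have "j \<in> orbit (unsigned v) i" if "j \<in> a" for j
    proof -
      have "orbit (unsigned v) j = orbit (unsigned v) i \<and> j \<in> {1..int n}"
        using that unfolding i(2)
      proof (induction rule: orbit.induct)
        case base
        then show ?case using preserve[OF i(1)] unsigned_mem[OF w i(1)] by blast
      next
        case (step j)
        then show ?case using preserve[of j] unsigned_mem[OF w, of j] by simp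
      qed
      then show ?thesis using self_mem_orbit[OF v, of j] by simp
    qed
    then show ?thesis using orbit_mem_abs_cycles[OF i(1), of v] by blast
  qed
  then show ?thesis
    using partition_on_abs_cycles[OF w] partition_on_abs_cycles[OF v] by (simp add: refines_def)
qed

text \<open>Colour the cycles of \<open>v\<close> by different variables, each cycle by an \<open>x\<close> or a \<open>y\<close>. Summing the
  resulting equations over the \<open>x\<close>-\<open>y\<close>-choices with suitable signs isolates those \<open>w\<close> whose cycles
  refine the cycles of \<open>v\<close> and have the same signs on them.\<close>

lemma sum_cycle_preservers_eq_0:
  assumes f: "class_function (signed_perms n) f" "ch n f = 0" and v: "v \<in> signed_perms n"
  shows "(\<Sum>w | w \<in> cycle_preservers n v \<and> (\<forall>b\<in>abs_cycles n v. cycle_sign w b = cycle_sign v b). f w) = 0"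
proof -
  let ?S = "cycle_preservers n v" and ?d = "\<lambda>w b. complex_of_int (cycle_sign w b)"
  have "(\<Sum>w | w \<in> ?S \<and> (\<forall>b\<in>abs_cycles n v. ?d w b = ?d v b). f w) = 0"
  proof (rule sum_sign_pattern_eq_0[OF finite_abs_cycles finite_cycle_preservers])
    fix T assume T: "T \<subseteq> abs_cycles n v"
    let ?c = "cycle_colouring n v T"
    have "?c \<in> fillings {1..int n} (image_mset ?c (mset_set {1..int n}))"
      by (simp add: fillings_def cycle_colouring_def colouring_of_cycles_def)
    from mcoeff_ch_class_function[OF f(1) this]
    have "(\<Sum>w\<in>?S. f w * of_int (colour_sign n ?c w)) / of_nat (card ?S) = 0"
      by (simp add: f(2) mcoeff_0 colour_stabilizer_cycle_colouring[OF v])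
    moreover have "card ?S \<noteq> 0" using self_mem_cycle_preservers[OF v] finite_cycle_preservers by auto
    ultimately show "(\<Sum>w\<in>?S. f w * (\<Prod>b\<in>T. ?d w b)) = 0"
      by (simp add: colour_sign_cycle_colouring[OF v T])
  next
    have signs: "?d w b = 1 \<or> ?d w b = - 1" if "w \<in> signed_perms n" "b \<in> abs_cycles n v" for w b
      using abs_cycle_sign[OF that(1) abs_cycle_subset[OF v that(2)]]
      by (auto simp: abs_if split: if_splits)
    show "?d v b = 1 \<or> ?d v b = - 1" if "b \<in> abs_cycles n v" for b using signs[OF v that] .
    show "?d w b = 1 \<or> ?d w b = - 1" if "w \<in> ?S" "b \<in> abs_cycles n v" for w b
      using that by (intro signs) (simp_all add: cycle_preservers_def)
  qed
  then show ?thesis by simp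
qed

theorem class_function_eq_0_if_ch_eq_0:
  assumes f: "class_function (signed_perms n) f" "ch n f = 0" and "v \<in> signed_perms n"
  shows "f v = 0"
  using assms(3)
proof (induction "n - card (abs_cycles n v)" arbitrary: v rule: less_induct)
  case less
  note v = less.prems
  let ?S = "{w \<in> cycle_preservers n v. \<forall>b\<in>abs_cycles n v. cycle_sign w b = cycle_sign v b}"
  let ?R = "{w \<in> ?S. abs_cycles n w = abs_cycles n v}"
  have mem: "w \<in> signed_perms n" if "w \<in> ?S" for w using that by (simp add: cycle_preservers_def)
  have card_le: "card (abs_cycles n w) \<le> n" for w
    using card_image_le[of "{1..int n}" "orbit (unsigned w)"] by (simp add: abs_cycles_def)
  have "f w = 0" if w: "w \<in> ?S" "abs_cycles n w \<noteq> abs_cycles n v" for w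
  proof -
    have "refines {1..int n} (abs_cycles n w) (abs_cycles n v)"
      using w(1) by (intro cycle_preserver_refines[OF v]) simp
    then have "card (abs_cycles n v) < card (abs_cycles n w)"
      using card_le_refines_imp_eq[OF finite_atLeastAtMost_int] w(2) by fastforce
    then have "n - card (abs_cycles n w) < n - card (abs_cycles n v)" using card_le[of w] by simp
    then show "f w = 0" using less.hyps mem[OF w(1)] by blast
  qed
  then have "(\<Sum>w\<in>?R. f w) = (\<Sum>w\<in>?S. f w)"
    using finite_cycle_preservers by (intro sum.mono_neutral_left) auto
  also have "\<dots> = 0" by (rule sum_cycle_preservers_eq_0[OF f v])
  also have "(\<Sum>w\<in>?R. f w) = (\<Sum>w\<in>?R. f v)"
  proof (intro sum.cong refl)
    fix w assume w: "w \<in> ?R"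
    then obtain u where u: "u \<in> signed_perms n" "u \<circ> w \<circ> inv u = v"
      using ex_conjugator[OF mem v] by blast
    then show "f w = f v" using class_functionD[OF f(1) u(1) mem] w by auto
  qed
  finally have "card ?R = 0 \<or> f v = 0" by simp
  moreover have "card ?R \<noteq> 0"
    using self_mem_cycle_preservers[OF v] finite_cycle_preservers[of n v] by auto
  ultimately show ?case by simp
qed

section \<open>Schur functions of rows and columns\<close>

definition y_squarefree :: "var multiset \<Rightarrow> bool" where
  "y_squarefree M \<longleftrightarrow> (\<forall>x. \<not> is_X x \<longrightarrow> count M x \<le> 1)"

lemma range_X: "x \<in> range X \<longleftrightarrow> is_X x" and range_Y: "x \<in> range Y \<longleftrightarrow> \<not> is_X x"
  by (cases x; auto)+

lemma mcoeff_schur_image: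
  assumes "inj z"
  shows "mcoeff (schur z lam) (image_mset z N)
    = of_nat (card {T \<in> ssyt lam. image_mset T (mset_set (young_diagram lam)) = N})"
proof -
  have "image_mset (\<lambda>b. z (T b)) (mset_set (young_diagram lam))
      = image_mset z (image_mset T (mset_set (young_diagram lam)))" for T
    by (simp add: image_mset.compositionality comp_def)
  then show ?thesis by (simp only: schur.rep_eq inj_eq[OF multiset.inj_map[OF assms]])
qed

lemma mcoeff_schur_eq_0:
  assumes "\<not> set_mset M \<subseteq> range z" shows "mcoeff (schur z lam) M = 0"
proof -
  have "{T \<in> ssyt lam. image_mset (\<lambda>b. z (T b)) (mset_set (young_diagram lam)) = M} = {}"
    using assms by auto
  then show ?thesis unfolding schur.rep_eq by (simp only: card.empty of_nat_0)
qed

lemma image_mset_if_subset_range: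
  assumes "set_mset M \<subseteq> range z" obtains N where "M = image_mset z N"
proof
  have "image_mset (\<lambda>x. z (inv z x)) M = image_mset (\<lambda>x. x) M"
    using assms by (intro image_mset_cong) (auto simp: f_inv_into_f)
  then show "M = image_mset z (image_mset (inv z) M)"
    by (simp add: image_mset.compositionality comp_def)
qed

lemma card_chain_tableaux:
  assumes "bij_betw g {..<k} D" "transp r"
  shows "card {T \<in> {T \<in> D \<rightarrow>\<^sub>E UNIV. \<forall>j. Suc j < k \<longrightarrow> r (T (g j)) (T (g (Suc j)))}. image_mset T (mset_set D) = N}
    = (if size N = k then card {xs. mset xs = N \<and> sorted_wrt r xs} else 0)"
proof -
  have "{T \<in> {T \<in> D \<rightarrow>\<^sub>E UNIV. \<forall>j. Suc j < k \<longrightarrow> r (T (g j)) (T (g (Suc j)))}. image_mset T (mset_set D) = N}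
      = {T \<in> fillings D N. \<forall>j. Suc j < k \<longrightarrow> r (T (g j)) (T (g (Suc j)))}"
    by (auto simp: fillings_def)
  moreover have "size N = k" if "fillings D N \<noteq> {}"
    using that size_filling[of _ D N] bij_betw_same_card[OF assms(1)] by auto
  ultimately show ?thesis
    using card_chain_fillings[OF assms(1) _ assms(2), of N] by (auto simp: card_eq_0_iff)
qed

lemma mcoeff_schur_row:
  assumes "inj z"
  shows "mcoeff (schur z [k]) M = (if size M = k \<and> set_mset M \<subseteq> range z then 1 else 0)"
proof (cases "set_mset M \<subseteq> range z")
  case True
  then obtain N where M: "M = image_mset z N" by (rule image_mset_if_subset_range)
  let ?g = "\<lambda>j. (0 :: nat, j)"
  have "young_diagram [k] = ?g ` {..<k}" by (auto simp: young_diagram_def)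
  then have "bij_betw ?g {..<k} (young_diagram [k])" by (simp add: bij_betw_def inj_on_def)
  moreover have "ssyt [k] = {T \<in> young_diagram [k] \<rightarrow>\<^sub>E UNIV. \<forall>j. Suc j < k \<longrightarrow> T (?g j) \<le> T (?g (Suc j))}"
    by (auto simp: ssyt_def young_diagram_def)
  ultimately have "card {T \<in> ssyt [k]. image_mset T (mset_set (young_diagram [k])) = N}
      = (if size N = k then card {xs. mset xs = N \<and> sorted xs} else 0)"
    using card_chain_tableaux[of ?g k "young_diagram [k]" "(\<le>)" N] by (simp add: transp_on_le)
  then show ?thesis using True by (simp add: M mcoeff_schur_image[OF assms] sorted_arrangements)
qed (simp add: mcoeff_schur_eq_0)

lemma mcoeff_schur_column:
  assumes "inj z"
  shows "mcoeff (schur z (replicate k 1)) M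
    = (if size M = k \<and> set_mset M \<subseteq> range z \<and> (\<forall>x. count M x \<le> 1) then 1 else 0)"
proof (cases "set_mset M \<subseteq> range z")
  case True
  then obtain N where M: "M = image_mset z N" by (rule image_mset_if_subset_range)
  let ?g = "\<lambda>j. (j, 0 :: nat)" and ?lam = "replicate k (1 :: nat)"
  have "young_diagram ?lam = ?g ` {..<k}" by (auto simp: young_diagram_def)
  then have "bij_betw ?g {..<k} (young_diagram ?lam)" by (simp add: bij_betw_def inj_on_def)
  moreover have "ssyt ?lam = {T \<in> young_diagram ?lam \<rightarrow>\<^sub>E UNIV. \<forall>j. Suc j < k \<longrightarrow> T (?g j) < T (?g (Suc j))}"
    by (auto simp: ssyt_def young_diagram_def)
  ultimately have "card {T \<in> ssyt ?lam. image_mset T (mset_set (young_diagram ?lam)) = N}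
      = (if size N = k then card {xs. mset xs = N \<and> sorted_wrt (<) xs} else 0)"
    using card_chain_tableaux[of ?g k "young_diagram ?lam" "(<)" N] by simp
  moreover have "(\<forall>x. count M x \<le> 1) \<longleftrightarrow> (\<forall>a. count N a \<le> 1)"
  proof -
    have "z -` {z a} = {a}" for a using assms by (auto simp: inj_eq)
    then have "count M (z a) = count N a" for a
      by (auto simp: M count_image_mset Int_insert_left count_eq_zero_iff)
    moreover have "count M x = 0" if "x \<notin> range z" for x
      using True that by (auto simp: count_eq_zero_iff)
    ultimately show ?thesis by (metis rangeE zero_le_one)
  qed
  ultimately show ?thesis
    using True by (simp add: M mcoeff_schur_image[OF assms] card_strict_sorted_arrangements)
qed (simp add: mcoeff_schur_eq_0)

lemma size_eq_size_X_plus_size_Y: "size M = size (filter_mset is_X M) + size (filter_mset (\<lambda>x. \<not> is_X x) M)"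
  by (metis multiset_partition size_union)

lemma mcoeff_schur_row_column:
  "mcoeff (schur X [k] * schur Y (replicate j 1)) M
    = (if size (filter_mset is_X M) = k \<and> size (filter_mset (\<lambda>x. \<not> is_X x) M) = j \<and> y_squarefree M
       then 1 else 0)"
proof -
  let ?A = "filter_mset is_X M" and ?B = "filter_mset (\<lambda>x. \<not> is_X x) M"
  have "inj X" "inj Y" by (simp_all add: inj_def)
  note schur = mcoeff_schur_row[OF this(1)] mcoeff_schur_column[OF this(2)]
  have "mcoeff (schur X [k] * schur Y (replicate j 1)) M
      = (\<Sum>A\<in>{?A}. mcoeff (schur X [k]) A * mcoeff (schur Y (replicate j 1)) (M - A))"
  proof (rule mcoeff_mult_eq_sum)
    fix A assume A: "A \<subseteq># M" "A \<notin> (\<lambda>A. A) ` {?A}"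
    have "\<not> (set_mset A \<subseteq> range X \<and> set_mset (M - A) \<subseteq> range Y)"
    proof
      assume split: "set_mset A \<subseteq> range X \<and> set_mset (M - A) \<subseteq> range Y"
      have "?A = filter_mset is_X (A + (M - A))" by (simp only: subset_mset.add_diff_inverse[OF A(1)])
      also have "\<dots> = filter_mset is_X A + filter_mset is_X (M - A)" by (rule filter_union_mset)
      also have "filter_mset is_X A = A"
        using split by (auto simp: subset_iff range_X filter_mset_eq_conv)
      also have "filter_mset is_X (M - A) = {#}"
        using split unfolding filter_mset_eq_mempty_iff by (auto simp: subset_iff range_Y)
      finally show False using A(2) by simp
    qed
    then show "mcoeff (schur X [k]) A * mcoeff (schur Y (replicate j 1)) (M - A) = 0"
      unfolding schur by auto
  qed auto
  moreover have "M - ?A = ?B" by (metis add_diff_cancel_left' multiset_partition)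
  moreover have "(\<forall>x. count ?B x \<le> 1) \<longleftrightarrow> y_squarefree M" by (simp add: y_squarefree_def)
  moreover have "set_mset ?A \<subseteq> range X" "set_mset ?B \<subseteq> range Y" by (auto simp: range_X range_Y)
  ultimately show ?thesis by (simp add: schur[unfolded One_nat_def])
qed

lemma mcoeff_sum_schur:
  "mcoeff (\<Sum>k = 0..m. schur X [k] * schur Y (replicate (m - k) 1)) M
    = (if size M = m \<and> y_squarefree M then 1 else 0)"
proof -
  let ?a = "size (filter_mset is_X M)" and ?b = "size (filter_mset (\<lambda>x. \<not> is_X x) M)"
  have "mcoeff (\<Sum>k = 0..m. schur X [k] * schur Y (replicate (m - k) 1)) M
      = (\<Sum>k = 0..m. if ?a = k then (if ?b = m - k \<and> y_squarefree M then 1 else 0) else 0)"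
    unfolding mcoeff_sum mcoeff_schur_row_column by (intro sum.cong refl) auto
  also have "\<dots> = (if (?a \<le> m \<and> ?b = m - ?a) \<and> y_squarefree M then 1 else 0)" by simp
  also have "(?a \<le> m \<and> ?b = m - ?a) \<longleftrightarrow> size M = m"
    by (auto simp: size_eq_size_X_plus_size_Y[of M])
  finally show ?thesis .
qed

lemma mcoeff_p_plus_1: "mcoeff (p_plus 1) A = (if size A = 1 then 1 else 0)"
proof (cases "size A = 1")
  case True
  then obtain x where "A = {#x#}" by (metis One_nat_def size_1_singleton_mset)
  then show ?thesis by (cases x) (auto simp: p_plus_def mcoeff_add power_sum.rep_eq)
next
  case False
  then show ?thesis by (auto simp: p_plus_def mcoeff_add power_sum.rep_eq)
qed

lemma mcoeff_p_plus_1_mult_sum_schur: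
  assumes "n \<ge> 1"
  shows "mcoeff (p_plus 1 * (\<Sum>k = 0..n - 1. schur X [k] * schur Y (replicate (n - 1 - k) 1))) M
    = (if size M = n then of_nat (card {x \<in> set_mset M. y_squarefree (M - {#x#})}) else 0)"
proof -
  let ?H = "\<Sum>k = 0..n - 1. schur X [k] * schur Y (replicate (n - 1 - k) 1)"
  have "mcoeff (p_plus 1 * ?H) M = (\<Sum>x\<in>set_mset M. mcoeff (p_plus 1) {#x#} * mcoeff ?H (M - {#x#}))"
  proof (rule mcoeff_mult_eq_sum)
    fix A assume A: "A \<subseteq># M" "A \<notin> (\<lambda>x. {#x#}) ` set_mset M"
    have "size A \<noteq> 1"
    proof
      assume "size A = 1"
      then obtain x where "A = {#x#}" by (metis One_nat_def size_1_singleton_mset)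
      then show False using A by auto
    qed
    then show "mcoeff (p_plus 1) A * mcoeff ?H (M - A) = 0"
      by (simp only: mcoeff_p_plus_1 if_False mult_zero_left)
  qed (auto simp: inj_on_def)
  also have "\<dots> = (\<Sum>x\<in>set_mset M. if size M = n \<and> y_squarefree (M - {#x#}) then 1 else 0)"
  proof (intro sum.cong refl)
    fix x assume "x \<in># M"
    then obtain N where "M = add_mset x N" by (blast dest: multi_member_split)
    then have "size (M - {#x#}) = n - 1 \<longleftrightarrow> size M = n" using assms by auto
    then show "mcoeff (p_plus 1) {#x#} * mcoeff ?H (M - {#x#})
        = (if size M = n \<and> y_squarefree (M - {#x#}) then 1 else 0)"
      by (simp only: mcoeff_sum_schur mcoeff_p_plus_1) simp
  qed
  finally show ?thesis by (simp add: sum.If_cases Int_def)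
qed

section \<open>The characteristic of the exterior powers\<close>

definition y_positions :: "nat \<Rightarrow> (int \<Rightarrow> var) \<Rightarrow> int set" where
  "y_positions n c = {i \<in> {1..int n}. \<not> is_X (c i)}"

lemma y_positions_subset: "y_positions n c \<subseteq> {1..int n}"
  by (auto simp: y_positions_def)

lemma finite_y_positions: "finite (y_positions n c)"
  by (rule finite_subset[OF y_positions_subset]) simp

lemma colour_sign_eq_prod: "colour_sign n c w = (\<Prod>i\<in>y_positions n c. sgn (w i))"
  unfolding colour_sign_def y_positions_def by (subst prod.inter_filter) (auto intro: prod.cong)

lemma colour_stabilizer_mem: "w \<in> colour_stabilizer n c \<Longrightarrow> w \<in> signed_perms n"
  and colour_stabilizer_apply: "w \<in> colour_stabilizer n c \<Longrightarrow> i \<in> {1..int n} \<Longrightarrow> c (unsigned w i) = c i"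
  by (simp_all add: colour_stabilizer_def)

lemma colour_stabilizer_comp_mem:
  assumes "u \<in> colour_stabilizer n c" "v \<in> colour_stabilizer n c" shows "u \<circ> v \<in> colour_stabilizer n c"
  using assms unsigned_mem[of v n] unsigned_comp[of u n v]
  by (auto simp: colour_stabilizer_def signed_perms.comp_mem simp del: atLeastAtMost_iff)

lemma colour_stabilizer_image_y_positions:
  assumes "w \<in> colour_stabilizer n c" shows "unsigned w ` y_positions n c = y_positions n c"
proof (rule card_subset_eq)
  note w = colour_stabilizer_mem[OF assms]
  show "unsigned w ` y_positions n c \<subseteq> y_positions n c"
    using colour_stabilizer_apply[OF assms] unsigned_mem[OF w] by (auto simp: y_positions_def)
  show "card (unsigned w ` y_positions n c) = card (y_positions n c)"
    using inj_on_subset[OF unsigned_inj[OF w] subset_UNIV] by (rule card_image)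
qed (rule finite_y_positions)

lemma colour_sign_comp:
  assumes "w \<in> signed_perms n" "u \<in> colour_stabilizer n c"
  shows "colour_sign n c (w \<circ> u) = colour_sign n c w * colour_sign n c u"
proof -
  let ?Y = "y_positions n c"
  note u = colour_stabilizer_mem[OF assms(2)]
  have "sgn ((w \<circ> u) i) = sgn (w (unsigned u i)) * sgn (u i)" if "i \<in> ?Y" for i
  proof -
    have "0 < i" using y_positions_subset that by fastforce
    then show ?thesis
      using signed_perms_sign_mult[OF assms(1) abs_sgn_signed_perms[OF u], of i "unsigned u i"]
        eq_sgn_mult_unsigned[of i u] by (simp add: sgn_mult mult.commute)
  qed
  then have "colour_sign n c (w \<circ> u) = (\<Prod>i\<in>?Y. sgn (w (unsigned u i))) * colour_sign n c u"
    by (simp add: colour_sign_eq_prod prod.distrib)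
  also have "(\<Prod>i\<in>?Y. sgn (w (unsigned u i))) = (\<Prod>i\<in>unsigned u ` ?Y. sgn (w i))"
    using inj_on_subset[OF unsigned_inj[OF u] subset_UNIV] by (simp add: prod.reindex)
  finally show ?thesis
    by (simp add: colour_stabilizer_image_y_positions[OF assms(2)] colour_sign_eq_prod)
qed

lemma sum_ext_sign_colour_sign_eq_0:
  assumes I: "I \<subseteq> {1..int n}" and t: "t \<in> colour_stabilizer n c" "unsigned t ` I = I" "t \<circ> t = id"
    and sign: "ext_sign t I * colour_sign n c t = - 1"
  shows "(\<Sum>w | w \<in> colour_stabilizer n c \<and> unsigned w ` I = I. ext_sign w I * colour_sign n c w) = 0"
proof (rule sum_involution_eq_0[where h = "\<lambda>w. w \<circ> t"])
  fix w assume w: "w \<in> {w. w \<in> colour_stabilizer n c \<and> unsigned w ` I = I}"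
  note mem = colour_stabilizer_mem[of w n c] colour_stabilizer_mem[OF t(1)]
  have "ext_sign (w \<circ> t) I * colour_sign n c (w \<circ> t)
      = (ext_sign w I * colour_sign n c w) * (ext_sign t I * colour_sign n c t)"
    using w mem I t by (simp add: ext_sign_comp colour_sign_comp mult_ac)
  then show "ext_sign (w \<circ> t) I * colour_sign n c (w \<circ> t) + ext_sign w I * colour_sign n c w = 0"
    by (simp add: sign)
  have "unsigned (w \<circ> t) ` I = unsigned w ` (unsigned t ` I)"
    using w mem by (simp add: unsigned_comp image_comp)
  then show "w \<circ> t \<in> {w. w \<in> colour_stabilizer n c \<and> unsigned w ` I = I}"
    using w t by (simp add: colour_stabilizer_comp_mem)
  show "w \<circ> t \<circ> t = w" by (simp add: comp_assoc t(3))
  show "w \<circ> t \<noteq> w"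
  proof
    assume "w \<circ> t = w"
    then have "t = id" using signed_perms_inj[of w n] w mem by (simp add: fun_eq_iff inj_eq)
    moreover have "colour_sign n c id = 1"
      by (simp add: colour_sign_eq_prod y_positions_def)
    ultimately show False using sign ext_sign_id[OF I] by simp
  qed
qed

lemma sum_ext_sign_colour_sign_ne_y_positions:
  assumes I: "I \<subseteq> {1..int n}" and "I \<noteq> y_positions n c"
  shows "(\<Sum>w | w \<in> colour_stabilizer n c \<and> unsigned w ` I = I. ext_sign w I * colour_sign n c w) = 0"
proof -
  obtain k where k: "k \<in> {1..int n}" "k \<in> I \<longleftrightarrow> k \<notin> y_positions n c"
    using assms y_positions_subset[of n c] by blast
  have "colour_sign n c (sign_flip n k) = (\<Prod>i\<in>y_positions n c. if i = k then - 1 else 1)"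
    unfolding colour_sign_eq_prod y_positions_def by (intro prod.cong refl) (simp add: sign_flip_apply)
  also have "\<dots> = (if k \<in> y_positions n c then - 1 else 1)"
    by (simp add: prod.delta finite_y_positions)
  finally have "ext_sign (sign_flip n k) I * colour_sign n c (sign_flip n k) = - 1"
    using k(2) ext_sign_sign_flip[OF I, of k] by simp
  then show ?thesis
    by (intro sum_ext_sign_colour_sign_eq_0[OF I _ _ sign_flip_involution])
      (simp_all add: colour_stabilizer_def sign_flip_mem unsigned_sign_flip)
qed

lemma sum_ext_sign_colour_sign_not_inj:
  assumes I: "I = y_positions n c" and "\<not> inj_on c I"
  shows "(\<Sum>w | w \<in> colour_stabilizer n c \<and> unsigned w ` I = I. ext_sign w I * colour_sign n c w) = 0"
proof -
  obtain p q where pq: "p \<in> I" "q \<in> I" "p \<noteq> q" "c p = c q" using assms(2) unfolding inj_on_def by blast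
  have subset: "I \<subseteq> {1..int n}" using y_positions_subset I by simp
  define t where "t = odd_extension n (transpose p q)"
  have swap: "transpose p q permutes {1..int n}" using pq subset by (intro permutes_swap_id) auto
  note t = odd_extension_permutes[OF swap, folded t_def]
  have t_apply: "t i = transpose p q i" "transpose p q i \<in> {1..int n}" if "i \<in> {1..int n}" for i
    using that permutes_in_image[OF swap] by (simp_all add: t_def odd_extension_apply)
  then have pos: "sgn (t i) = 1" if "i \<in> {1..int n}" for i using that by fastforce
  have stab: "t \<in> colour_stabilizer n c"
    using t pq(4) by (simp add: colour_stabilizer_def transpose_def)
  have image: "unsigned t ` I = I" using pq(1,2) by (simp add: t(2) transpose_image_eq)
  have involution: "t \<circ> t = id"
    by (rule signed_perms_eqI[of _ n])
      (simp_all add: signed_perms.comp_mem signed_perms.id_mem t(1) t_apply del: atLeastAtMost_iff)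
  have "colour_sign n c t = 1"
    unfolding colour_sign_eq_prod using pos y_positions_subset by (intro prod.neutral) blast
  moreover have "(\<Prod>i\<in>I. sgn (t i)) = 1" using pos subset by (intro prod.neutral) blast
  then have "ext_sign t I = - 1"
    using inv_sign_transpose[OF finite_subset[OF subset] pq(1-3)] by (simp add: ext_sign_def t(2))
  ultimately show ?thesis by (intro sum_ext_sign_colour_sign_eq_0[OF subset stab image involution]) simp
qed

lemma sum_ext_sign_colour_sign_inj:
  assumes I: "I = y_positions n c" and inj: "inj_on c I"
  shows "(\<Sum>w | w \<in> colour_stabilizer n c \<and> unsigned w ` I = I. ext_sign w I * colour_sign n c w)
    = int (card (colour_stabilizer n c))"
proof -
  have subset: "I \<subseteq> {1..int n}" using y_positions_subset I by simp
  have "ext_sign w I * colour_sign n c w = 1" if w: "w \<in> colour_stabilizer n c" for w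
  proof -
    note mem = colour_stabilizer_mem[OF w]
    have "unsigned w i = i" if "i \<in> I" for i
    proof (rule inj_onD[OF inj _ _ that])
      show "c (unsigned w i) = c i" using colour_stabilizer_apply[OF w] that subset by blast
      show "unsigned w i \<in> I" using colour_stabilizer_image_y_positions[OF w] that by (auto simp: I)
    qed
    then have "inv_sign (unsigned w) I = 1" by (rule inv_sign_id)
    then have "ext_sign w I * colour_sign n c w = (\<Prod>i\<in>I. sgn (w i) * sgn (w i))"
      by (simp only: ext_sign_def colour_sign_eq_prod prod.distrib mult_1_right flip: I)
    also have "\<dots> = 1"
    proof (intro prod.neutral ballI)
      fix i assume "i \<in> I"
      then have "w i \<noteq> 0" using subset signed_perms_eq_0_iff[OF mem, of i] by auto
      then show "sgn (w i) * sgn (w i) = 1" by (simp add: sgn_if)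
    qed
    finally show ?thesis .
  qed
  moreover have "{w. w \<in> colour_stabilizer n c \<and> unsigned w ` I = I} = colour_stabilizer n c"
    unfolding I using colour_stabilizer_image_y_positions[of _ n c] by blast
  ultimately show ?thesis by simp
qed

lemma sum_ext_power_char_colour_sign:
  "(\<Sum>w\<in>colour_stabilizer n c. ext_power_char n j w * of_int (colour_sign n c w))
    = (if card (y_positions n c) = j \<and> inj_on c (y_positions n c)
       then of_nat (card (colour_stabilizer n c)) else 0)"
proof -
  let ?S = "colour_stabilizer n c" and ?J = "subsets_of_card n j" and ?Y = "y_positions n c"
  let ?t = "\<lambda>w I. ext_sign w I * colour_sign n c w"
  have "(\<Sum>w\<in>?S. ext_power_char n j w * of_int (colour_sign n c w))
      = (\<Sum>w\<in>?S. \<Sum>I\<in>{I \<in> ?J. unsigned w ` I = I}. of_int (?t w I))"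
    by (intro sum.cong refl) (simp add: ext_power_char_def colour_stabilizer_mem sum_distrib_right)
  also have "\<dots> = (\<Sum>I\<in>?J. \<Sum>w\<in>{w \<in> ?S. unsigned w ` I = I}. of_int (?t w I))"
    by (intro sum.swap_restrict finite_colour_stabilizer finite_subsets_of_card)
  also have "\<dots> = (\<Sum>I\<in>?J. if I = ?Y then (if inj_on c ?Y then of_nat (card ?S) else 0) else 0)"
  proof (rule sum.cong[OF refl])
    fix I assume "I \<in> ?J"
    then have "I \<subseteq> {1..int n}" by (simp add: subsets_of_card_def)
    then have total: "(\<Sum>w | w \<in> ?S \<and> unsigned w ` I = I. ?t w I)
        = (if I = ?Y \<and> inj_on c ?Y then int (card ?S) else 0)"
      using sum_ext_sign_colour_sign_ne_y_positions sum_ext_sign_colour_sign_not_inj sum_ext_sign_colour_sign_inj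
      by (cases "I = ?Y"; cases "inj_on c ?Y") auto
    show "(\<Sum>w | w \<in> ?S \<and> unsigned w ` I = I. of_int (?t w I))
        = (if I = ?Y then (if inj_on c ?Y then of_nat (card ?S) else 0) else (0 :: complex))"
      unfolding of_int_sum[symmetric] total by simp
  qed
  also have "\<dots> = (if ?Y \<in> ?J then (if inj_on c ?Y then of_nat (card ?S) else 0) else 0)"
    by (rule sum.delta[OF finite_subsets_of_card])
  also have "?Y \<in> ?J \<longleftrightarrow> card ?Y = j" by (simp add: subsets_of_card_def y_positions_subset)
  finally show ?thesis by simp
qed

lemma filling_y_positions:
  assumes c: "c \<in> fillings {1..int n} M"
  shows "card (y_positions n c) = size (filter_mset (\<lambda>x. \<not> is_X x) M)"
    and "inj_on c (y_positions n c) \<longleftrightarrow> y_squarefree M"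
proof -
  have M: "M = image_mset c (mset_set {1..int n})" using c by (simp add: fillings_def)
  show "card (y_positions n c) = size (filter_mset (\<lambda>x. \<not> is_X x) M)"
    by (simp add: M filter_mset_image_mset y_positions_def)
  have "count M x \<le> 1 \<longleftrightarrow> (\<forall>i\<in>{i \<in> {1..int n}. c i = x}. \<forall>j\<in>{j \<in> {1..int n}. c j = x}. i = j)" for x
    unfolding count_filling[OF finite_atLeastAtMost_int c] One_nat_def
    by (rule card_le_Suc0_iff_eq, rule finite_Collect_conjI) simp
  then show "inj_on c (y_positions n c) \<longleftrightarrow> y_squarefree M"
    by (auto simp: y_squarefree_def inj_on_def y_positions_def)
qed

theorem ch_ext_power_char:
  assumes "k + j = n"
  shows "ch n (ext_power_char n j) = schur X [k] * schur Y (replicate j 1)"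
proof (rule mseries_eqI)
  fix M
  have size: "size M = size (filter_mset is_X M) + size (filter_mset (\<lambda>x. \<not> is_X x) M)"
    by (rule size_eq_size_X_plus_size_Y)
  show "mcoeff (ch n (ext_power_char n j)) M = mcoeff (schur X [k] * schur Y (replicate j 1)) M"
  proof (cases "size M = n")
    case True
    then obtain c where c: "c \<in> fillings {1..int n} M"
      using fillings_eq_empty_iff[of "{1..int n}" M] by auto
    have "id \<in> colour_stabilizer n c"
      by (simp add: colour_stabilizer_def signed_perms.id_mem unsigned_id)
    then have "card (colour_stabilizer n c) \<noteq> 0" using finite_colour_stabilizer by auto
    then have "mcoeff (ch n (ext_power_char n j)) M
        = (if size (filter_mset (\<lambda>x. \<not> is_X x) M) = j \<and> y_squarefree M then 1 else 0)"
      using class_function_ext_power_char[of j n] assms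
      by (simp add: mcoeff_ch_class_function[OF _ c] sum_ext_power_char_colour_sign filling_y_positions[OF c])
    then show ?thesis unfolding mcoeff_schur_row_column using size assms True by auto
  next
    case False
    then show ?thesis
      unfolding mcoeff_schur_row_column mcoeff_ch_eq_0_of_size[OF False] using size assms by auto
  qed
qed

theorem irr_char_row_column:
  assumes "k + j = n"
  shows "irr_char n [k] (replicate j 1) = ext_power_char n j"
  unfolding irr_char_def
proof (rule the_equality)
  let ?s = "schur X [k] * schur Y (replicate j 1)"
  have "j \<le> n" using assms by simp
  note irr = irreducible_character_ext_power[OF this] and cls = class_function_ext_power_char[OF this]
  show "irreducible_character (signed_perms n) (ext_power_char n j) \<and> ch n (ext_power_char n j) = ?s"
    using irr ch_ext_power_char[OF assms] by blast
  fix \<chi> assume \<chi>: "irreducible_character (signed_perms n) \<chi> \<and> ch n \<chi> = ?s"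
  let ?f = "\<lambda>w. \<chi> w - ext_power_char n j w"
  have "class_function (signed_perms n) \<chi>"
    using \<chi> by (intro signed_perms.irreducible_character_class_function) simp
  then have "class_function (signed_perms n) ?f" using cls by (simp add: class_function_def)
  moreover have "ch n ?f = 0" using \<chi> by (simp add: ch_diff ch_ext_power_char[OF assms])
  ultimately have "?f w = 0" if "w \<in> signed_perms n" for w
    using that by (rule class_function_eq_0_if_ch_eq_0)
  moreover have "\<chi> w = 0" "ext_power_char n j w = 0" if "w \<notin> signed_perms n" for w
    using that \<chi> by (auto simp: irreducible_character_def ext_power_char_def)
  ultimately show "\<chi> = ext_power_char n j" by (metis eq_iff_diff_eq_0 ext)
qed

section \<open>Residues and cyclic intervals\<close>

definition residue_rep :: "nat \<Rightarrow> int \<Rightarrow> int" where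
  "residue_rep n x = (x - 1) mod int n + 1"

lemma residue_rep_mem: "n \<ge> 1 \<Longrightarrow> residue_rep n x \<in> {1..int n}"
  by (simp add: residue_rep_def add1_zle_eq)

lemma residue_rep_eq_iff: "residue_rep n x = residue_rep n y \<longleftrightarrow> [x = y] (mod int n)"
  by (simp add: residue_rep_def mod_eq_dvd_iff cong_iff_dvd_diff)

lemma residue_rep_id: "x \<in> {1..int n} \<Longrightarrow> residue_rep n x = x"
  by (simp add: residue_rep_def)

lemma residue_rep_cong: "[residue_rep n x = x] (mod int n)"
  by (simp add: residue_rep_def cong_def mod_add_left_eq)

lemma cong_close_imp_eq:
  assumes "[x = y] (mod int n)" "\<bar>x - y\<bar> < int n" shows "x = y"
proof (rule ccontr)
  assume "x \<noteq> y"
  then have "\<not> int n dvd \<bar>x - y\<bar>" using assms(2) by (intro zdvd_not_zless) auto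
  then show False using assms(1) by (simp add: cong_iff_dvd_diff)
qed

lemma residue_rep_Suc_neq: "n \<ge> 2 \<Longrightarrow> residue_rep n (x + 1) \<noteq> residue_rep n x"
  by (simp add: residue_rep_eq_iff cong_iff_dvd_diff)

lemma residue_rep_less_Suc:
  assumes "n \<ge> 2" shows "residue_rep n (x + 1) < residue_rep n x \<longleftrightarrow> int n dvd x"
proof -
  let ?r = "residue_rep n x"
  have r: "?r \<in> {1..int n}" using residue_rep_mem assms by simp
  have "[x + 1 = ?r + 1] (mod int n)" using residue_rep_cong[of n x] by (simp add: cong_sym cong_add)
  then have Suc: "residue_rep n (x + 1) = residue_rep n (?r + 1)" by (simp only: residue_rep_eq_iff)
  have dvd: "int n dvd x \<longleftrightarrow> int n dvd ?r" using cong_dvd_iff[OF residue_rep_cong[of n x]] by simp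
  show ?thesis
  proof (cases "?r = int n")
    case True
    then have "residue_rep n (?r + 1) = 1" using assms by (simp add: residue_rep_def)
    then show ?thesis using Suc dvd True assms by simp
  next
    case False
    then have "residue_rep n (?r + 1) = ?r + 1" using r by (intro residue_rep_id) simp
    moreover have "\<not> int n dvd ?r" using False r by (intro zdvd_not_zless) auto
    ultimately show ?thesis using Suc dvd by simp
  qed
qed

lemma cyclic_interval_cong:
  assumes "\<And>x. x \<in> A \<Longrightarrow> \<exists>y\<in>{l<..<u}. [x = y] (mod int n)"
    and "\<And>y. y \<in> {l<..<u} \<Longrightarrow> \<exists>x\<in>A. [y = x] (mod int n)"
  shows "cyclic_interval n A"
proof -
  have "(\<lambda>x. x mod int n) ` A = (\<lambda>x. x mod int n) ` {l<..<u}"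
  proof (intro equalityI image_subsetI)
    show "x mod int n \<in> (\<lambda>x. x mod int n) ` {l<..<u}" if "x \<in> A" for x
      using assms(1)[OF that] by (auto simp: cong_def)
    show "y mod int n \<in> (\<lambda>x. x mod int n) ` A" if "y \<in> {l<..<u}" for y
      using assms(2)[OF that] by (auto simp: cong_def)
  qed
  also have "{l<..<u} = (\<lambda>j. (l + 1) + int j) ` {..<nat (u - l - 1)}"
  proof (intro equalityI subsetI)
    fix x assume "x \<in> {l<..<u}"
    then have "x = (l + 1) + int (nat (x - l - 1))" "nat (x - l - 1) \<in> {..<nat (u - l - 1)}" by auto
    then show "x \<in> (\<lambda>j. (l + 1) + int j) ` {..<nat (u - l - 1)}" by (rule image_eqI)
  qed auto
  finally show ?thesis unfolding cyclic_interval_def image_image by blast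
qed

lemma cyclic_interval_remove_one: "cyclic_interval n ({1..int n} - {a})" if "a \<in> {1..int n}"
proof (rule cyclic_interval_cong[where l = a and u = "a + int n"])
  fix x assume "x \<in> {1..int n} - {a}"
  then show "\<exists>y\<in>{a<..<a + int n}. [x = y] (mod int n)"
    using that by (intro bexI[of _ "if a < x then x else x + int n"]) (auto simp: cong_def)
next
  fix y assume "y \<in> {a<..<a + int n}"
  then show "\<exists>x\<in>{1..int n} - {a}. [y = x] (mod int n)"
    using that by (intro bexI[of _ "if y \<le> int n then y else y - int n"]) (auto simp: cong_iff_dvd_diff)
qed

lemma cyclic_interval_neighbour:
  assumes "cyclic_interval n A" "x \<in> A" "y \<in> A" "\<not> [x = y] (mod int n)"
  obtains z s where "z \<in> A" "s = 1 \<or> s = - 1" "[x + s = z] (mod int n)"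
proof -
  obtain a k where A: "(\<lambda>x. x mod int n) ` A = (\<lambda>j. (a + int j) mod int n) ` {..<k}"
    using assms(1) unfolding cyclic_interval_def by blast
  have mem: "\<exists>z\<in>A. [z = a + int j] (mod int n)" if "j < k" for j
  proof -
    have "(a + int j) mod int n \<in> (\<lambda>x. x mod int n) ` A" unfolding A using that by blast
    then show ?thesis by (auto simp: cong_def)
  qed
  have index: "\<exists>j<k. [z = a + int j] (mod int n)" if "z \<in> A" for z
  proof -
    have "z mod int n \<in> (\<lambda>j. (a + int j) mod int n) ` {..<k}" unfolding A[symmetric] using that by blast
    then show ?thesis by (auto simp: cong_def)
  qed
  obtain i where i: "i < k" "[x = a + int i] (mod int n)" using index[OF assms(2)] by blast
  obtain j where j: "j < k" "[y = a + int j] (mod int n)" using index[OF assms(3)] by blast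
  have "i \<noteq> j" using assms(4) i(2) j(2) by (auto simp: cong_def)
  then consider "i > 0" | "i = 0" "1 < k" using i(1) j(1) by linarith
  then show ?thesis
  proof cases
    case 1
    then obtain z where "z \<in> A" "[z = a + int i - 1] (mod int n)"
      using mem[OF less_imp_diff_less[OF i(1)], of 1] by (auto simp: of_nat_diff algebra_simps)
    moreover have "[x + - 1 = a + int i - 1] (mod int n)"
      using cong_diff[OF i(2) cong_refl[of 1]] by simp
    ultimately show ?thesis using that[of z "- 1"] cong_trans cong_sym by blast
  next
    case 2
    then obtain z where "z \<in> A" "[z = a + int i + 1] (mod int n)" using mem[of 1] by auto
    moreover have "[x + 1 = a + int i + 1] (mod int n)" using i(2) by (simp add: cong_add)
    ultimately show ?thesis using that[of z 1] cong_trans cong_sym by blast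
  qed
qed

section \<open>Signed arc permutations\<close>

definition prefix_letters :: "(int \<Rightarrow> int) \<Rightarrow> nat \<Rightarrow> int set" where
  "prefix_letters w i = (\<lambda>j. \<bar>w (int j)\<bar>) ` {1..<i}"

lemma signed_arc_perms_iff:
  "w \<in> signed_arc_perms n \<longleftrightarrow> w \<in> signed_perms n \<and> (\<forall>i\<in>{2..<n}. cyclic_interval n (prefix_letters w i) \<and>
    ((\<exists>a\<in>prefix_letters w i. [\<bar>w (int i)\<bar> - 1 = a] (mod int n)) \<longrightarrow> 0 < w (int i)) \<and>
    ((\<exists>a\<in>prefix_letters w i. [\<bar>w (int i)\<bar> + 1 = a] (mod int n)) \<longrightarrow> w (int i) < 0))"
proof -
  have interval: "{int a..int b - 1} = int ` {a..<b}" for a b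
    unfolding image_int_atLeastLessThan by auto
  have positions: "{2..int n - 1} = int ` {2..<n}" using interval[of 2 n] by simp
  have prefix: "(\<lambda>j. \<bar>w j\<bar>) ` {1..int i - 1} = prefix_letters w i" for i
    using interval[of 1 i] by (simp add: prefix_letters_def image_image)
  show ?thesis
    unfolding signed_arc_perms_def positions Let_def by (simp only: mem_Collect_eq ball_simps prefix)
qed

lemma bij_betw_abs_letters:
  assumes "w \<in> signed_perms n" shows "bij_betw (\<lambda>j. \<bar>w (int j)\<bar>) {1..n} {1..int n}"
proof -
  have "bij_betw int {1..n} {1..int n}" by (simp add: bij_betw_def image_int_atLeastAtMost)
  from bij_betw_trans[OF this permutes_imp_bij[OF unsigned_permutes[OF assms]]] show ?thesis
    by (rule bij_betw_cong[THEN iffD1, rotated]) (simp add: unsigned_def)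
qed

lemma abs_letters_cong_iff:
  assumes w: "w \<in> signed_perms n" and ij: "i \<in> {1..n}" "j \<in> {1..n}"
  shows "[\<bar>w (int i)\<bar> = \<bar>w (int j)\<bar>] (mod int n) \<longleftrightarrow> i = j"
proof
  assume "[\<bar>w (int i)\<bar> = \<bar>w (int j)\<bar>] (mod int n)"
  moreover have "\<bar>w (int i)\<bar> \<in> {1..int n}" "\<bar>w (int j)\<bar> \<in> {1..int n}"
    using bij_betwE[OF bij_betw_abs_letters[OF w]] ij by blast+
  ultimately have "\<bar>w (int i)\<bar> = \<bar>w (int j)\<bar>" by (intro cong_close_imp_eq) auto
  then show "i = j" using inj_onD[OF bij_betw_imp_inj_on[OF bij_betw_abs_letters[OF w]]] ij by blast
qed simp

lemma cyclic_interval_prefix_letters: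
  assumes "w \<in> signed_arc_perms n" "i \<in> {2..n}" shows "cyclic_interval n (prefix_letters w i)"
proof (cases "i = n")
  case True
  have w: "w \<in> signed_perms n" using assms(1) by (simp add: signed_arc_perms_iff)
  have n: "n \<in> {1..n}" using assms(2) by simp
  have "prefix_letters w n = (\<lambda>j. \<bar>w (int j)\<bar>) ` ({1..n} - {n})"
    unfolding prefix_letters_def by (intro arg_cong2[of _ _ _ _ image]) auto
  also have "\<dots> = {1..int n} - {\<bar>w (int n)\<bar>}"
    using inj_on_image_set_diff[OF bij_betw_imp_inj_on[OF bij_betw_abs_letters[OF w]], of "{1..n}" "{n}"] n
      bij_betw_imp_surj_on[OF bij_betw_abs_letters[OF w]] by simp
  finally have "prefix_letters w n = {1..int n} - {\<bar>w (int n)\<bar>}" .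
  then show ?thesis
    using cyclic_interval_remove_one bij_betwE[OF bij_betw_abs_letters[OF w]] n True by auto
next
  case False
  then show ?thesis using assms by (auto simp: signed_arc_perms_iff)
qed

lemma signed_arc_perm_sign:
  assumes "w \<in> signed_arc_perms n" "i \<in> {2..<n}" "a \<in> prefix_letters w i"
    and "[\<bar>w (int i)\<bar> + s = a] (mod int n)" "s = 1 \<or> s = - 1"
  shows "s = - sgn (w (int i))"
proof -
  have "\<exists>a\<in>prefix_letters w i. [\<bar>w (int i)\<bar> + s = a] (mod int n)" using assms(3,4) by blast
  moreover have "(\<exists>a\<in>prefix_letters w i. [\<bar>w (int i)\<bar> - 1 = a] (mod int n)) \<longrightarrow> 0 < w (int i)"
    "(\<exists>a\<in>prefix_letters w i. [\<bar>w (int i)\<bar> + 1 = a] (mod int n)) \<longrightarrow> w (int i) < 0"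
    using assms(1,2) by (simp_all add: signed_arc_perms_iff)
  ultimately show ?thesis using assms(5) by (elim disjE) simp_all
qed

lemma unit_step_not_cong:
  assumes "n \<ge> 2" "s = 1 \<or> s = - 1" shows "\<not> [x + s = x] (mod int n)"
  using assms by (auto simp: cong_iff_dvd_diff)

lemma sgn_signed_letter: "w \<in> signed_perms n \<Longrightarrow> i \<noteq> 0 \<Longrightarrow> sgn (w i) = 1 \<or> sgn (w i) = - 1"
  by (auto simp: sgn_if signed_perms_eq_0_iff)

lemma last_letter_predecessor:
  assumes w: "w \<in> signed_perms n" and n: "n \<ge> 2"
  shows "\<exists>j\<in>{1..<n}. [\<bar>w (int j)\<bar> = \<bar>w (int n)\<bar> - sgn (w (int n))] (mod int n)"
proof -
  let ?x = "\<bar>w (int n)\<bar> - sgn (w (int n))"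
  have "residue_rep n ?x \<in> (\<lambda>j. \<bar>w (int j)\<bar>) ` {1..n}"
    using residue_rep_mem n bij_betw_imp_surj_on[OF bij_betw_abs_letters[OF w]] by simp
  then obtain j where j: "j \<in> {1..n}" "residue_rep n ?x = \<bar>w (int j)\<bar>" by (rule imageE)
  have cong: "[\<bar>w (int j)\<bar> = ?x] (mod int n)" using residue_rep_cong[of n ?x] unfolding j(2) .
  have "j \<noteq> n"
    using cong unit_step_not_cong[OF n, of "- sgn (w (int n))" "\<bar>w (int n)\<bar>"]
        sgn_signed_letter[OF w, of "int n"] n
    by (auto simp: cong_sym_eq)
  then show ?thesis using cong j(1) by auto
qed

lemma signed_arc_perm_predecessor:
  assumes arc: "w \<in> signed_arc_perms n" and i: "i \<in> {2..n}"
  shows "\<exists>j\<in>{1..<i}. [\<bar>w (int j)\<bar> = \<bar>w (int i)\<bar> - sgn (w (int i))] (mod int n)"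
proof (cases "i = n")
  case True
  then show ?thesis using last_letter_predecessor[of w n] arc i by (simp add: signed_arc_perms_iff)
next
  case False
  have w: "w \<in> signed_perms n" using arc by (simp add: signed_arc_perms_iff)
  have "cyclic_interval n (prefix_letters w (Suc i))"
    using i False by (intro cyclic_interval_prefix_letters[OF arc]) auto
  moreover have "\<bar>w (int i)\<bar> \<in> prefix_letters w (Suc i)" "\<bar>w (int 1)\<bar> \<in> prefix_letters w (Suc i)"
    unfolding prefix_letters_def using i by (intro imageI; simp)+
  moreover have "\<not> [\<bar>w (int i)\<bar> = \<bar>w (int 1)\<bar>] (mod int n)"
    using abs_letters_cong_iff[OF w, of i 1] i by simp
  ultimately obtain z s
    where z: "z \<in> prefix_letters w (Suc i)" "s = 1 \<or> s = - 1" "[\<bar>w (int i)\<bar> + s = z] (mod int n)"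
    by (rule cyclic_interval_neighbour)
  obtain j where j: "j \<in> {1..<Suc i}" "z = \<bar>w (int j)\<bar>" using z(1) unfolding prefix_letters_def by blast
  have "j \<noteq> i" using unit_step_not_cong[OF _ z(2)] z(3) i j(2) by auto
  then have less: "j \<in> {1..<i}" using j(1) by auto
  then have "z \<in> prefix_letters w i" unfolding prefix_letters_def j(2) by blast
  moreover have "i \<in> {2..<n}" using i False by simp
  ultimately have "s = - sgn (w (int i))" using z(2,3) by (intro signed_arc_perm_sign[OF arc])
  then have "[\<bar>w (int j)\<bar> = \<bar>w (int i)\<bar> - sgn (w (int i))] (mod int n)"
    using z(3) j(2) by (simp add: cong_sym_eq)
  then show ?thesis using less by blast
qed

definition unbarred_before :: "(nat \<Rightarrow> bool) \<Rightarrow> nat \<Rightarrow> int" where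
  "unbarred_before e i = int (card {j \<in> {1..<i}. e j})"

text \<open>The unbarred letters are \<open>b, b + 1, \<dots>\<close> and the barred ones \<open>b - 1, b - 2, \<dots>\<close> (modulo \<open>n\<close>),
  in the order of their positions; \<open>e\<close> tells which positions are unbarred.\<close>

definition arc_residue :: "int \<Rightarrow> (nat \<Rightarrow> bool) \<Rightarrow> nat \<Rightarrow> int" where
  "arc_residue b e i = b + unbarred_before e i - (if e i then 0 else int i)"

definition arc_perm :: "nat \<Rightarrow> int \<Rightarrow> (nat \<Rightarrow> bool) \<Rightarrow> int \<Rightarrow> int" where
  "arc_perm n b e =
     odd_extension n (\<lambda>i. (if e (nat i) then 1 else - 1) * residue_rep n (arc_residue b e (nat i)))"

lemma unbarred_before_1: "unbarred_before e 1 = 0"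
  by (simp add: unbarred_before_def)

lemma unbarred_before_Suc:
  assumes "1 \<le> i" shows "unbarred_before e (Suc i) = unbarred_before e i + (if e i then 1 else 0)"
proof -
  have "{j \<in> {1..<Suc i}. e j} = (if e i then insert i {j \<in> {1..<i}. e j} else {j \<in> {1..<i}. e j})"
    using assms by (auto simp: less_Suc_eq)
  then show ?thesis by (simp add: unbarred_before_def)
qed

lemma unbarred_before_bounds:
  assumes "1 \<le> i" "i \<le> j"
  shows "unbarred_before e i \<le> unbarred_before e j"
    and "unbarred_before e j \<le> unbarred_before e i + int j - int i"
  using assms(2)
  by (induction j rule: dec_induct) (use assms(1) in \<open>auto simp: unbarred_before_Suc\<close>)

lemma arc_residue_image:
  assumes "1 \<le> i"
  shows "arc_residue b e ` {1..<i} = {b + unbarred_before e i - int i<..<b + unbarred_before e i}"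
  using assms
proof (induction i rule: dec_induct)
  case base
  then show ?case using unbarred_before_1[of e] by (auto simp: set_eq_iff)
next
  case (step i)
  have "0 \<le> unbarred_before e i" by (simp add: unbarred_before_def)
  moreover have "{1..<Suc i} = insert i {1..<i}" using step.hyps by auto
  ultimately show ?case using step by (auto simp: arc_residue_def unbarred_before_Suc)
qed

lemma arc_residue_not_cong:
  assumes "1 \<le> j" "j < i" "i \<le> n" shows "\<not> [arc_residue b e j = arc_residue b e i] (mod int n)"
proof
  assume cong: "[arc_residue b e j = arc_residue b e i] (mod int n)"
  have "arc_residue b e j \<in> {b + unbarred_before e i - int i<..<b + unbarred_before e i}"
    unfolding arc_residue_image[of i, symmetric, OF order_trans[OF assms(1) less_imp_le[OF assms(2)]]]
    using assms(1,2) by (intro imageI) simp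
  then have "arc_residue b e j \<noteq> arc_residue b e i" "\<bar>arc_residue b e j - arc_residue b e i\<bar> < int n"
    using assms(3) by (auto simp: arc_residue_def)
  then show False using cong_close_imp_eq[OF cong] by blast
qed

lemma arc_perm_apply:
  "i \<in> {1..n} \<Longrightarrow> arc_perm n b e (int i) = (if e i then 1 else - 1) * residue_rep n (arc_residue b e i)"
  by (simp add: arc_perm_def odd_extension_def)

lemma abs_arc_perm:
  assumes "i \<in> {1..n}" shows "\<bar>arc_perm n b e (int i)\<bar> = residue_rep n (arc_residue b e i)"
  using residue_rep_mem[of n "arc_residue b e i"] assms by (simp add: arc_perm_apply abs_mult)

lemma arc_perm_pos_iff:
  assumes "i \<in> {1..n}" shows "0 < arc_perm n b e (int i) \<longleftrightarrow> e i"
  using residue_rep_mem[of n "arc_residue b e i"] assms by (simp add: arc_perm_apply)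

lemma arc_perm_signed_perm: "arc_perm n b e \<in> signed_perms n"
  unfolding arc_perm_def
proof (rule odd_extension_signed_perm)
  let ?r = "\<lambda>i. residue_rep n (arc_residue b e (nat i))"
  let ?f = "\<lambda>i. (if e (nat i) then 1 else - 1) * ?r i"
  have abs: "\<bar>?f i\<bar> = ?r i" "?r i \<in> {1..int n}" if "i \<in> {1..int n}" for i
    using residue_rep_mem[of n "arc_residue b e (nat i)"] that by (auto simp: abs_mult)
  then show "\<bar>?f i\<bar> \<in> {1..int n}" if "i \<in> {1..int n}" for i using that by metis
  show "inj_on (\<lambda>i. \<bar>?f i\<bar>) {1..int n}"
  proof (rule linorder_inj_onI)
    fix i j assume "i \<in> {1..int n}" "j \<in> {1..int n}" "i < j"
    then have "?r i \<noteq> ?r j" unfolding residue_rep_eq_iff by (intro arc_residue_not_cong) auto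
    then show "\<bar>?f i\<bar> \<noteq> \<bar>?f j\<bar>" using abs(1) \<open>i \<in> {1..int n}\<close> \<open>j \<in> {1..int n}\<close> by simp
  qed (rule linorder_linear)
qed

lemma prefix_letters_arc_perm:
  fixes i n :: nat and b :: int and e :: "nat \<Rightarrow> bool"
  assumes i: "i \<in> {1..n}"
  defines "I \<equiv> {b + unbarred_before e i - int i<..<b + unbarred_before e i}"
  shows "a \<in> prefix_letters (arc_perm n b e) i \<Longrightarrow> \<exists>x\<in>I. [a = x] (mod int n)"
    and "x \<in> I \<Longrightarrow> \<exists>a\<in>prefix_letters (arc_perm n b e) i. [x = a] (mod int n)"
proof -
  have I: "I = arc_residue b e ` {1..<i}" using arc_residue_image[of i b e] i by (simp add: I_def)
  have cong: "[\<bar>arc_perm n b e (int j)\<bar> = arc_residue b e j] (mod int n)" if "j \<in> {1..<i}" for j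
    using abs_arc_perm[of j n b e] residue_rep_cong that i by simp
  show "\<exists>x\<in>I. [a = x] (mod int n)" if "a \<in> prefix_letters (arc_perm n b e) i"
    using that cong unfolding I prefix_letters_def by blast
  show "\<exists>a\<in>prefix_letters (arc_perm n b e) i. [x = a] (mod int n)" if "x \<in> I"
    using that cong_sym[OF cong] unfolding I prefix_letters_def by blast
qed

lemma arc_perm_next_letter_not_cong:
  assumes i: "i \<in> {1..<n}" and s: "s = (if e i then 1 else - 1)"
    and a: "a \<in> prefix_letters (arc_perm n b e) i"
  shows "\<not> [\<bar>arc_perm n b e (int i)\<bar> + s = a] (mod int n)"
proof
  assume "[\<bar>arc_perm n b e (int i)\<bar> + s = a] (mod int n)"
  moreover have "[arc_residue b e i + s = \<bar>arc_perm n b e (int i)\<bar> + s] (mod int n)"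
    using abs_arc_perm[of i n b e] i by (intro cong_add) (simp_all add: residue_rep_cong cong_sym)
  moreover obtain x where x: "x \<in> {b + unbarred_before e i - int i<..<b + unbarred_before e i}"
    "[a = x] (mod int n)"
    using prefix_letters_arc_perm(1)[OF _ a] i by auto
  ultimately have "[arc_residue b e i + s = x] (mod int n)" using cong_trans by blast
  then have "arc_residue b e i + s = x"
    using x(1) i s by (intro cong_close_imp_eq) (auto simp: arc_residue_def)
  then show False using x(1) i s by (auto simp: arc_residue_def split: if_splits)
qed

lemma arc_perm_mem: "arc_perm n b e \<in> signed_arc_perms n"
  unfolding signed_arc_perms_iff
proof (intro conjI ballI impI arc_perm_signed_perm)
  let ?w = "arc_perm n b e"
  fix i assume i: "i \<in> {2..<n}"
  then have i': "i \<in> {1..n}" "i \<in> {1..<n}" by auto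
  show "cyclic_interval n (prefix_letters ?w i)"
    by (rule cyclic_interval_cong[OF prefix_letters_arc_perm[OF i'(1)]])
  have nonzero: "?w (int i) \<noteq> 0" using signed_perms_eq_0_iff[OF arc_perm_signed_perm] i by simp
  have pos_iff: "0 < ?w (int i) \<longleftrightarrow> e i" by (rule arc_perm_pos_iff[OF i'(1)])
  show "0 < ?w (int i)" if "\<exists>a\<in>prefix_letters ?w i. [\<bar>?w (int i)\<bar> - 1 = a] (mod int n)"
    using arc_perm_next_letter_not_cong[OF i'(2), of "- 1" e _ b] that pos_iff by auto
  show "?w (int i) < 0" if "\<exists>a\<in>prefix_letters ?w i. [\<bar>?w (int i)\<bar> + 1 = a] (mod int n)"
    using arc_perm_next_letter_not_cong[OF i'(2), of 1 e _ b] that pos_iff nonzero by auto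
qed

lemma signed_arc_perm_letters:
  assumes "w \<in> signed_arc_perms n" and e: "\<And>i. i \<in> {1..n} \<Longrightarrow> e i \<longleftrightarrow> 0 < w (int i)"
    and b: "[b = (if e 1 then \<bar>w 1\<bar> else \<bar>w 1\<bar> + 1)] (mod int n)" and i: "i \<in> {1..n}"
  shows "[\<bar>w (int i)\<bar> = arc_residue b e i] (mod int n)"
  using i
proof (induction i rule: less_induct)
  case (less i)
  have w: "w \<in> signed_perms n" using assms(1) by (simp add: signed_arc_perms_iff)
  let ?top = "b + unbarred_before e i" and ?s = "sgn (w (int i))"
  show ?case
  proof (cases "i = 1")
    case True
    have "[(if e 1 then \<bar>w 1\<bar> else \<bar>w 1\<bar> + 1) - (if e 1 then 0 else 1)
        = b - (if e 1 then 0 else 1)] (mod int n)"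
      by (intro cong_diff cong_sym[OF b] cong_refl)
    then show ?thesis
      using True unbarred_before_1[of e] by (auto simp: arc_residue_def split: if_splits)
  next
    case False
    then have i: "i \<in> {2..n}" using less.prems by auto
    have image: "arc_residue b e ` {1..<i} = {?top - int i<..<?top}"
      using arc_residue_image[of i b e] i by simp
    obtain j where j: "j \<in> {1..<i}" "[\<bar>w (int j)\<bar> = \<bar>w (int i)\<bar> - ?s] (mod int n)"
      using signed_arc_perm_predecessor[OF assms(1) i] by blast
    let ?x = "arc_residue b e j"
    have x: "?x \<in> {?top - int i<..<?top}" unfolding image[symmetric] using j(1) by blast
    have "[?x = \<bar>w (int j)\<bar>] (mod int n)" using less.IH[of j] j(1) i by (simp add: cong_sym_eq)
    from cong_add[OF cong_trans[OF this j(2)] cong_refl[of ?s]]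
    have cong: "[\<bar>w (int i)\<bar> = ?x + ?s] (mod int n)" by (simp add: cong_sym_eq)
    have "?x + ?s \<notin> {?top - int i<..<?top}"
    proof
      assume "?x + ?s \<in> {?top - int i<..<?top}"
      then obtain k where k: "k \<in> {1..<i}" "?x + ?s = arc_residue b e k"
        unfolding image[symmetric] by blast
      have "[\<bar>w (int k)\<bar> = arc_residue b e k] (mod int n)" using less.IH[of k] k(1) i by simp
      then have "[\<bar>w (int i)\<bar> = \<bar>w (int k)\<bar>] (mod int n)" using cong k(2) by (simp add: cong_def)
      then show False using abs_letters_cong_iff[OF w, of i k] i k(1) by simp
    qed
    moreover have "?s = (if e i then 1 else - 1)"
      using e[of i] i signed_perms_eq_0_iff[OF w, of "int i"] by (auto simp: sgn_if)
    ultimately have "?x + ?s = arc_residue b e i"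
      using x by (auto simp: arc_residue_def split: if_splits)
    then show ?thesis using cong by simp
  qed
qed

lemma arc_perm_exhaust:
  assumes "n \<ge> 2" "w \<in> signed_arc_perms n"
  obtains e b where "e \<in> {1..n} \<rightarrow>\<^sub>E UNIV" "b \<in> {1..int n}" "w = arc_perm n b e"
proof -
  define e where "e = (\<lambda>i\<in>{1..n}. 0 < w (int i))"
  define b where "b = residue_rep n (if e 1 then \<bar>w 1\<bar> else \<bar>w 1\<bar> + 1)"
  have w: "w \<in> signed_perms n" using assms(2) by (simp add: signed_arc_perms_iff)
  have e: "e i \<longleftrightarrow> 0 < w (int i)" if "i \<in> {1..n}" for i using that by (simp add: e_def)
  have "w = arc_perm n b e"
  proof (rule signed_perms_eqI[OF w arc_perm_signed_perm])
    fix i assume "i \<in> {1..int n}"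
    then obtain k where k: "i = int k" "k \<in> {1..n}" by (auto intro!: that[of "nat i"])
    have "residue_rep n \<bar>w (int k)\<bar> = residue_rep n (arc_residue b e k)"
      unfolding residue_rep_eq_iff
      by (rule signed_arc_perm_letters[OF assms(2) e _ k(2)]) (simp_all add: b_def residue_rep_cong)
    moreover have "residue_rep n \<bar>w (int k)\<bar> = \<bar>w (int k)\<bar>"
      using bij_betwE[OF bij_betw_abs_letters[OF w]] k(2) by (intro residue_rep_id) blast
    moreover have "w (int k) \<noteq> 0" using signed_perms_eq_0_iff[OF w] k(2) by simp
    ultimately show "w i = arc_perm n b e i"
      using e[OF k(2)] by (auto simp: k(1) arc_perm_apply[OF k(2)])
  qed
  moreover have "b \<in> {1..int n}" unfolding b_def using assms(1) by (intro residue_rep_mem) simp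
  moreover have "e \<in> {1..n} \<rightarrow>\<^sub>E UNIV" by (simp add: e_def)
  ultimately show ?thesis using that by blast
qed

lemma bij_betw_arc_perm:
  assumes "n \<ge> 2"
  shows "bij_betw (\<lambda>(e, b). arc_perm n b e) (({1..n} \<rightarrow>\<^sub>E UNIV) \<times> {1..int n}) (signed_arc_perms n)"
proof (rule bij_betw_imageI)
  show "inj_on (\<lambda>(e, b). arc_perm n b e) (({1..n} \<rightarrow>\<^sub>E UNIV) \<times> {1..int n})"
  proof (rule inj_onI, clarify)
    fix e e' :: "nat \<Rightarrow> bool" and b b'
    assume e: "e \<in> {1..n} \<rightarrow>\<^sub>E UNIV" "e' \<in> {1..n} \<rightarrow>\<^sub>E UNIV" and b: "b \<in> {1..int n}" "b' \<in> {1..int n}"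
      and eq: "arc_perm n b e = arc_perm n b' e'"
    have "e = e'"
    proof (rule PiE_ext[OF e])
      fix i assume "i \<in> {1..n}"
      then show "e i = e' i"
        using arc_perm_pos_iff[of i n b e] arc_perm_pos_iff[of i n b' e'] eq by simp
    qed
    have "arc_residue b e 1 - arc_residue b' e 1 = b - b'" by (simp add: arc_residue_def)
    moreover have "[arc_residue b e 1 = arc_residue b' e 1] (mod int n)"
      using abs_arc_perm[of 1 n b e] abs_arc_perm[of 1 n b' e] eq \<open>e = e'\<close> assms
      by (simp flip: residue_rep_eq_iff)
    ultimately have "[b = b'] (mod int n)" by (simp add: cong_iff_dvd_diff)
    then have "b = b'" using b by (intro cong_close_imp_eq) auto
    then show "e = e' \<and> b = b'" using \<open>e = e'\<close> by simp
  qed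
  show "(\<lambda>(e, b). arc_perm n b e) ` (({1..n} \<rightarrow>\<^sub>E UNIV) \<times> {1..int n}) = signed_arc_perms n"
  proof (intro equalityI subsetI)
    fix w assume "w \<in> signed_arc_perms n"
    then obtain e b where "e \<in> {1..n} \<rightarrow>\<^sub>E UNIV" "b \<in> {1..int n}" "w = arc_perm n b e"
      using arc_perm_exhaust[OF assms] by blast
    then show "w \<in> (\<lambda>(e, b). arc_perm n b e) ` (({1..n} \<rightarrow>\<^sub>E UNIV) \<times> {1..int n})"
      by (intro image_eqI[of _ _ "(e, b)"]) auto
  qed (use arc_perm_mem in auto)
qed

lemma finite_signed_arc_perms: "finite (signed_arc_perms n)"
  by (rule finite_subset[OF _ signed_perms.finite_group[of n]]) (auto simp: signed_arc_perms_def)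

section \<open>Descents of signed arc permutations\<close>

definition arc_descents :: "nat \<Rightarrow> (nat \<Rightarrow> bool) \<Rightarrow> nat set \<Rightarrow> nat set" where
  "arc_descents n e T = {n} \<union> {s \<in> {1..n - 1}. e s \<noteq> e (s + 1) \<or> (e s \<longleftrightarrow> s \<in> T)}"

definition arc_signs :: "nat \<Rightarrow> (nat \<Rightarrow> bool) \<Rightarrow> nat \<Rightarrow> int" where
  "arc_signs n e s = (if s \<in> {1..n} \<and> \<not> e s then - 1 else 1)"

text \<open>The positions at which the letters step between \<open>n\<close> and \<open>1\<close>.\<close>

definition arc_wraps :: "nat \<Rightarrow> int \<Rightarrow> (nat \<Rightarrow> bool) \<Rightarrow> nat set" where
  "arc_wraps n b e = {s. int n dvd (if e s then arc_residue b e s else arc_residue b e s - 1)}"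

lemma arc_perm_descent_iff:
  fixes n s :: nat and b :: int and e :: "nat \<Rightarrow> bool"
  assumes "n \<ge> 2" "s \<in> {1..n - 1}"
  defines "w \<equiv> arc_perm n b e"
  shows "less_r (w (int s + 1)) (w (int s)) \<or> (w (int s) < 0 \<and> w (int s + 1) > 0)
    \<longleftrightarrow> e s \<noteq> e (s + 1) \<or> (e s \<longleftrightarrow> s \<in> arc_wraps n b e)"
proof -
  let ?r = "\<lambda>i. residue_rep n (arc_residue b e i)"
  have s: "s \<in> {1..n}" "Suc s \<in> {1..n}" using assms(2) by auto
  have pos: "1 \<le> ?r s" "1 \<le> ?r (Suc s)" using residue_rep_mem[of n] assms(1) by simp_all
  have w: "w (int s) = (if e s then 1 else - 1) * ?r s"
    "w (int s + 1) = (if e (Suc s) then 1 else - 1) * ?r (Suc s)"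
    using arc_perm_apply[OF s(1)] arc_perm_apply[OF s(2), of b e] by (simp_all add: w_def add.commute)
  consider "e s \<noteq> e (Suc s)" | "e s" "e (Suc s)" | "\<not> e s" "\<not> e (Suc s)" by blast
  then show ?thesis
  proof cases
    case 1
    then show ?thesis using w pos by (auto simp: less_r_def)
  next
    case 2
    then have "?r (Suc s) < ?r s \<longleftrightarrow> s \<in> arc_wraps n b e"
      using residue_rep_less_Suc[OF assms(1), of "arc_residue b e s"] s
      by (simp add: arc_wraps_def arc_residue_def unbarred_before_Suc add.assoc)
    then show ?thesis using 2 w pos by (simp add: less_r_def)
  next
    case 3
    then have "arc_residue b e s = arc_residue b e (Suc s) + 1"
      using s by (simp add: arc_residue_def unbarred_before_Suc)
    then have "?r (Suc s) < ?r s \<longleftrightarrow> s \<notin> arc_wraps n b e"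
      using residue_rep_less_Suc[OF assms(1), of "arc_residue b e (Suc s)"]
        residue_rep_Suc_neq[OF assms(1), of "arc_residue b e (Suc s)"] 3 by (auto simp: arc_wraps_def)
    then show ?thesis using 3 w pos by (simp add: less_r_def)
  qed
qed

lemma sDes_arc_perm:
  assumes "n \<ge> 2"
  shows "sDes n (arc_perm n b e) = (arc_descents n e (arc_wraps n b e), arc_signs n e)"
proof -
  have "(if arc_perm n b e (int s) < 0 then - 1 else 1) = arc_signs n e s" for s
  proof (cases "s \<in> {1..n}")
    case True
    then show ?thesis
      using residue_rep_mem[of n "arc_residue b e s"] by (simp add: arc_signs_def arc_perm_apply)
  next
    case False
    then have "arc_perm n b e (int s) = int s"
      by (intro signed_perms_outside[OF arc_perm_signed_perm]) auto
    then show ?thesis using False by (auto simp: arc_signs_def)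
  qed
  moreover have "{s \<in> {1..n - 1}. less_r (arc_perm n b e (int s + 1)) (arc_perm n b e (int s)) \<or>
        (arc_perm n b e (int s) < 0 \<and> arc_perm n b e (int s + 1) > 0)}
      = {s \<in> {1..n - 1}. e s \<noteq> e (s + 1) \<or> (e s \<longleftrightarrow> s \<in> arc_wraps n b e)}"
    by (intro Collect_cong conj_cong refl arc_perm_descent_iff[OF assms])
  ultimately show ?thesis by (simp only: sDes_def arc_descents_def)
qed

definition equal_sign_positions :: "nat \<Rightarrow> (nat \<Rightarrow> bool) \<Rightarrow> nat set" where
  "equal_sign_positions n e = {s \<in> {1..n - 1}. e s = e (Suc s)}"

definition wrap_base :: "(nat \<Rightarrow> bool) \<Rightarrow> nat \<Rightarrow> int" where
  "wrap_base e s = (if e s then 0 else int s + 1) - unbarred_before e s"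

lemma arc_wraps_iff: "s \<in> arc_wraps n b e \<longleftrightarrow> [wrap_base e s = b] (mod int n)"
proof -
  have "(if e s then arc_residue b e s else arc_residue b e s - 1) = b - wrap_base e s"
    by (simp add: arc_residue_def wrap_base_def)
  then show ?thesis by (simp add: arc_wraps_def cong_iff_dvd_diff dvd_diff_commute)
qed

lemma wrap_base_bounds:
  assumes "s \<in> equal_sign_positions n e"
  defines "k \<equiv> unbarred_before e (Suc n)"
  shows "if e s then wrap_base e s \<in> {2 - k..0} else wrap_base e s \<in> {2..int n - k}"
proof -
  have s: "1 \<le> s" "Suc (Suc s) \<le> Suc n" "e (Suc s) = e s"
    using assms(1) by (auto simp: equal_sign_positions_def)
  have "unbarred_before e (Suc (Suc s)) = unbarred_before e s + (if e s then 2 else 0)"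
    using s by (simp add: unbarred_before_Suc)
  moreover note unbarred_before_bounds[of "Suc (Suc s)" "Suc n" e] unbarred_before_bounds[of 1 s e]
  ultimately show ?thesis using s(1,2) unbarred_before_1[of e] by (auto simp: wrap_base_def k_def)
qed

lemma wrap_base_neq:
  assumes "s \<in> equal_sign_positions n e" "t \<in> equal_sign_positions n e" "s < t"
  shows "wrap_base e s \<noteq> wrap_base e t"
proof -
  have s: "1 \<le> s" using assms(1) by (simp add: equal_sign_positions_def)
  note unbarred_before_bounds[of "Suc s" t e] unbarred_before_Suc[OF s, of e]
  moreover note wrap_base_bounds[OF assms(1)] wrap_base_bounds[OF assms(2)]
  ultimately show ?thesis using assms(3) by (auto simp: wrap_base_def split: if_splits)
qed

lemma inj_on_wrap_base: "inj_on (\<lambda>s. residue_rep n (wrap_base e s)) (equal_sign_positions n e)"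
proof (rule linorder_inj_onI)
  fix s t assume st: "s \<in> equal_sign_positions n e" "t \<in> equal_sign_positions n e" "s < t"
  have "\<bar>wrap_base e s - wrap_base e t\<bar> < int n"
    using wrap_base_bounds[OF st(1)] wrap_base_bounds[OF st(2)] st(1)
      unbarred_before_bounds[of 1 "Suc n" e] unbarred_before_1[of e]
    by (auto simp: equal_sign_positions_def split: if_splits)
  then show "residue_rep n (wrap_base e s) \<noteq> residue_rep n (wrap_base e t)"
    using wrap_base_neq[OF st] cong_close_imp_eq by (auto simp: residue_rep_eq_iff)
qed (rule linorder_linear)

text \<open>Rotating the letters moves the step from \<open>n\<close> to \<open>1\<close> through all pairs of adjacent positions
  of equal sign; whenever that step is not between adjacent positions, it does not affect the
  descents.\<close>

lemma sum_arc_descents: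
  fixes g :: "nat set \<Rightarrow> 'c :: comm_semiring_1"
  assumes "n \<ge> 1"
  shows "(\<Sum>b = 1..int n. g (arc_descents n e (arc_wraps n b e))) = (\<Sum>s = 1..n. g (arc_descents n e {s}))"
proof -
  let ?Q = "equal_sign_positions n e" and ?c = "\<lambda>s. residue_rep n (wrap_base e s)"
  let ?g = "\<lambda>T. g (arc_descents n e T)"
  have restrict: "arc_descents n e T = arc_descents n e {s \<in> ?Q. s \<in> T}" for T
    by (auto simp: arc_descents_def equal_sign_positions_def)
  have wraps: "s \<in> arc_wraps n b e \<longleftrightarrow> ?c s = b" if "b \<in> {1..int n}" for s b
    using residue_rep_eq_iff[of n "wrap_base e s" b] residue_rep_id[OF that]
    by (simp add: arc_wraps_iff)
  have "(\<Sum>b = 1..int n. ?g (arc_wraps n b e)) = (\<Sum>b = 1..int n. ?g {s \<in> ?Q. ?c s = b})"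
    by (intro sum.cong refl) (subst restrict, simp add: wraps)
  also have "\<dots> = (\<Sum>s\<in>?Q. ?g {s}) + of_nat (card {1..int n} - card ?Q) * ?g {}"
    using residue_rep_mem[OF assms] by (intro sum_fibres_inj_on inj_on_wrap_base) auto
  also have "\<dots> = (\<Sum>s\<in>?Q. ?g {s}) + of_nat (card {1..n} - card ?Q) * ?g {}" by simp
  also have "\<dots> = (\<Sum>s = 1..n. ?g {t \<in> ?Q. id t = s})"
    by (intro sum_fibres_inj_on[symmetric]) (auto simp: equal_sign_positions_def)
  also have "\<dots> = (\<Sum>s = 1..n. ?g {s})"
    by (intro sum.cong refl) (subst (2) restrict, simp)
  finally show ?thesis .
qed

theorem sum_signed_arc_perms:
  fixes g :: "signed_set \<Rightarrow> 'c :: comm_semiring_1"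
  assumes "n \<ge> 2"
  shows "(\<Sum>w\<in>signed_arc_perms n. g (sDes n w))
    = (\<Sum>e\<in>{1..n} \<rightarrow>\<^sub>E UNIV. \<Sum>s = 1..n. g (arc_descents n e {s}, arc_signs n e))"
proof -
  have "(\<Sum>w\<in>signed_arc_perms n. g (sDes n w))
      = (\<Sum>(e, b)\<in>({1..n} \<rightarrow>\<^sub>E UNIV) \<times> {1..int n}. g (sDes n (arc_perm n b e)))"
    unfolding sum.reindex_bij_betw[OF bij_betw_arc_perm[OF assms], symmetric]
    by (simp add: case_prod_unfold)
  also have "\<dots> = (\<Sum>e\<in>{1..n} \<rightarrow>\<^sub>E UNIV. \<Sum>b = 1..int n. g (arc_descents n e (arc_wraps n b e), arc_signs n e))"
    unfolding sDes_arc_perm[OF assms] by (rule sum.cartesian_product[symmetric])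
  also have "\<dots> = (\<Sum>e\<in>{1..n} \<rightarrow>\<^sub>E UNIV. \<Sum>s = 1..n. g (arc_descents n e {s}, arc_signs n e))"
    using assms
    by (intro sum.cong refl) (rule sum_arc_descents[where g = "\<lambda>S. g (S, arc_signs n _)"], simp)
  finally show ?thesis .
qed

section \<open>Blocks of a signed composition\<close>

definition block_interior :: "int list \<Rightarrow> nat \<Rightarrow> nat set" where
  "block_interior \<gamma> i = {partial_sum \<gamma> i + 1..<partial_sum \<gamma> (i + 1)}"

definition block_index :: "int list \<Rightarrow> nat \<Rightarrow> nat" where
  "block_index \<gamma> j = (LEAST i. j \<le> partial_sum \<gamma> (Suc i))"

lemma partial_sum_0: "partial_sum \<gamma> 0 = 0"
  by (simp add: partial_sum_def)

lemma partial_sum_Suc: "i < length \<gamma> \<Longrightarrow> partial_sum \<gamma> (Suc i) = partial_sum \<gamma> i + nat \<bar>\<gamma> ! i\<bar>"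
  by (simp add: partial_sum_def take_Suc_conv_app_nth)

lemma partial_sum_mono: "i \<le> j \<Longrightarrow> j \<le> length \<gamma> \<Longrightarrow> partial_sum \<gamma> i \<le> partial_sum \<gamma> j"
  by (induction j rule: dec_induct) (auto simp: partial_sum_Suc)

lemma finite_block_interior: "finite (block_interior \<gamma> i)"
  by (simp add: block_interior_def)

lemma card_block_interior: "i < length \<gamma> \<Longrightarrow> card (block_interior \<gamma> i) = nat \<bar>\<gamma> ! i\<bar> - 1"
  by (simp add: block_interior_def partial_sum_Suc)

lemma block_interior_mem:
  assumes "j \<in> block_interior \<gamma> i" shows "j \<in> block \<gamma> i" "Suc j \<in> block \<gamma> i"
  using assms by (auto simp: block_interior_def block_def)

context
  fixes \<gamma> :: "int list" and n :: nat
  assumes composition: "\<gamma> \<in> signed_compositions n"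
begin

lemma part_nonzero:
  assumes "i < length \<gamma>" shows "\<gamma> ! i \<noteq> 0"
  using composition nth_mem[OF assms] unfolding signed_compositions_def by force

lemma partial_sum_length: "partial_sum \<gamma> (length \<gamma>) = n"
proof -
  have "int (\<Sum>c\<leftarrow>\<gamma>. nat \<bar>c\<bar>) = (\<Sum>c\<leftarrow>\<gamma>. \<bar>c\<bar>)" by (induction \<gamma>) auto
  then show ?thesis using composition by (simp add: partial_sum_def signed_compositions_def)
qed

lemma block_end_mem: "i < length \<gamma> \<Longrightarrow> partial_sum \<gamma> (Suc i) \<in> block \<gamma> i"
  using part_nonzero[of i] by (simp add: block_def partial_sum_Suc)

lemma block_subset: "i < length \<gamma> \<Longrightarrow> block \<gamma> i \<subseteq> {1..n}"
  using partial_sum_mono[of "Suc i" "length \<gamma>" \<gamma>] partial_sum_length by (auto simp: block_def)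

lemma block_index_eq:
  assumes "i < length \<gamma>" "j \<in> block \<gamma> i" shows "block_index \<gamma> j = i"
  unfolding block_index_def
proof (rule Least_equality)
  fix k assume "j \<le> partial_sum \<gamma> (Suc k)"
  then show "i \<le> k" using partial_sum_mono[of "Suc k" i \<gamma>] assms by (force simp: block_def)
qed (use assms(2) in \<open>simp add: block_def\<close>)

lemma block_index_mem:
  assumes "j \<in> {1..n}" shows "block_index \<gamma> j < length \<gamma>" "j \<in> block \<gamma> (block_index \<gamma> j)"
proof -
  let ?i = "block_index \<gamma> j"
  have "\<gamma> \<noteq> []" using assms partial_sum_length partial_sum_0[of \<gamma>] by auto
  then have last: "j \<le> partial_sum \<gamma> (Suc (length \<gamma> - 1))" using assms partial_sum_length by simp
  have "?i \<le> length \<gamma> - 1" unfolding block_index_def by (rule Least_le) (rule last)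
  moreover have "0 < length \<gamma>" using \<open>\<gamma> \<noteq> []\<close> by simp
  ultimately show "?i < length \<gamma>" by linarith
  have "partial_sum \<gamma> ?i < j"
  proof (cases ?i)
    case 0
    then show ?thesis using assms by (simp add: partial_sum_0)
  next
    case (Suc k)
    then show ?thesis
      using not_less_Least[of k "\<lambda>i. j \<le> partial_sum \<gamma> (Suc i)"] by (simp add: block_index_def)
  qed
  moreover have "j \<le> partial_sum \<gamma> (Suc ?i)" unfolding block_index_def by (rule LeastI) (rule last)
  ultimately show "j \<in> block \<gamma> ?i" by (simp add: block_def)
qed

lemma block_index_image: "block_index \<gamma> ` {1..n} = {..<length \<gamma>}"
proof (intro equalityI subsetI)
  fix i assume "i \<in> {..<length \<gamma>}"
  then have "i = block_index \<gamma> (partial_sum \<gamma> (Suc i))" "partial_sum \<gamma> (Suc i) \<in> {1..n}"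
    using block_index_eq[OF _ block_end_mem] block_end_mem[of i] block_subset[of i] by auto
  then show "i \<in> block_index \<gamma> ` {1..n}" by (rule image_eqI)
qed (use block_index_mem in auto)

lemma disjoint_family_block_interior: "disjoint_family_on (block_interior \<gamma>) {..<length \<gamma>}"
  unfolding disjoint_family_on_def
proof (intro ballI impI)
  fix i k assume ik: "i \<in> {..<length \<gamma>}" "k \<in> {..<length \<gamma>}" "i \<noteq> k"
  then have "block_index \<gamma> j = i" if "j \<in> block_interior \<gamma> i" for j
    using block_index_eq[OF _ block_interior_mem(1)[OF that]] by simp
  moreover have "block_index \<gamma> j = k" if "j \<in> block_interior \<gamma> k" for j
    using block_index_eq[OF _ block_interior_mem(1)[OF that]] ik(2) by simp
  ultimately show "block_interior \<gamma> i \<inter> block_interior \<gamma> k = {}" using ik(3) by blast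
qed

lemma block_interior_subset: "i < length \<gamma> \<Longrightarrow> block_interior \<gamma> i \<subseteq> {1..n}"
  using block_subset block_interior_mem(1) by blast

lemma Union_block_interior:
  "{1..n} - (\<Union>i<length \<gamma>. block_interior \<gamma> i) = partial_sum \<gamma> ` {1..length \<gamma>}"
proof -
  have block_end: "j \<in> partial_sum \<gamma> ` {1..length \<gamma>} \<longleftrightarrow> j = partial_sum \<gamma> (Suc (block_index \<gamma> j))"
    if "j \<in> {1..n}" for j
  proof
    assume "j \<in> partial_sum \<gamma> ` {1..length \<gamma>}"
    then obtain i where "i < length \<gamma>" "j = partial_sum \<gamma> (Suc i)"
      by (auto simp: Suc_le_eq gr0_conv_Suc)
    then show "j = partial_sum \<gamma> (Suc (block_index \<gamma> j))"
      using block_index_eq[OF _ block_end_mem] by simp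
  next
    assume "j = partial_sum \<gamma> (Suc (block_index \<gamma> j))"
    then show "j \<in> partial_sum \<gamma> ` {1..length \<gamma>}"
      by (rule image_eqI) (use block_index_mem(1)[OF that] in simp)
  qed
  have interior: "j \<in> (\<Union>i<length \<gamma>. block_interior \<gamma> i) \<longleftrightarrow> j \<noteq> partial_sum \<gamma> (Suc (block_index \<gamma> j))"
    if j: "j \<in> {1..n}" for j
  proof
    assume "j \<in> (\<Union>i<length \<gamma>. block_interior \<gamma> i)"
    then obtain i where "i < length \<gamma>" "j \<in> block_interior \<gamma> i" by blast
    then show "j \<noteq> partial_sum \<gamma> (Suc (block_index \<gamma> j))"
      using block_index_eq[OF _ block_interior_mem(1)] by (simp add: block_interior_def)
  next
    assume "j \<noteq> partial_sum \<gamma> (Suc (block_index \<gamma> j))"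
    then have "j \<in> block_interior \<gamma> (block_index \<gamma> j)"
      using block_index_mem(2)[OF j] by (simp add: block_interior_def block_def)
    then show "j \<in> (\<Union>i<length \<gamma>. block_interior \<gamma> i)" using block_index_mem(1)[OF j] by blast
  qed
  have "partial_sum \<gamma> i \<in> {1..n}" if "i \<in> {1..length \<gamma>}" for i
  proof (cases i)
    case (Suc k)
    then show ?thesis using that block_end_mem[of k] block_subset[of k] by auto
  qed (use that in simp)
  then show ?thesis using block_end interior by blast
qed

lemma card_block_ends: "card (partial_sum \<gamma> ` {1..length \<gamma>}) = length \<gamma>"
proof -
  have "partial_sum \<gamma> i < partial_sum \<gamma> j" if "i < j" "j \<le> length \<gamma>" for i j
    using partial_sum_mono[of "Suc i" j \<gamma>] partial_sum_Suc[of i \<gamma>] part_nonzero[of i] that by simp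
  then have "inj_on (partial_sum \<gamma>) {1..length \<gamma>}" by (intro linorder_inj_onI linorder_linear) force
  then show ?thesis by (simp add: card_image)
qed

end

section \<open>The weight as a product over the blocks\<close>

definition block_weight :: "int list \<Rightarrow> (nat \<Rightarrow> bool) \<Rightarrow> nat set \<Rightarrow> nat \<Rightarrow> int" where
  "block_weight \<gamma> E S i =
     (if initial_segment (S \<inter> block_interior \<gamma> i) (block_interior \<gamma> i)
      then (- 1) ^ card (S \<inter> block_interior \<gamma> i) * (if \<not> E i \<and> \<gamma> ! i < 0 then - 1 else 1) else 0)"

lemma wt_eq_prod_block_weight:
  assumes \<gamma>: "\<gamma> \<in> signed_compositions n" and S: "fst \<sigma> \<subseteq> {1..n}"
    and E: "\<And>i j. i < length \<gamma> \<Longrightarrow> j \<in> block \<gamma> i \<Longrightarrow> sign_vector \<sigma> j = (if E i then 1 else - 1)"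
  shows "wt \<gamma> \<sigma> = (\<Prod>i<length \<gamma>. block_weight \<gamma> E (fst \<sigma>) i)"
proof -
  let ?m = "length \<gamma>" and ?J = "block_interior \<gamma>"
  have zero: "(\<exists>i<?m. (let J = {partial_sum \<gamma> i + 1..<partial_sum \<gamma> (i + 1)} in
             \<not> initial_segment (fst \<sigma> \<inter> J) J) \<or> \<not> (\<exists>x. \<forall>j\<in>block \<gamma> i. sign_vector \<sigma> j = x))
      \<longleftrightarrow> \<not> (\<forall>i<?m. initial_segment (fst \<sigma> \<inter> ?J i) (?J i))"
    using E by (auto simp: Let_def block_interior_def)
  show ?thesis
  proof (cases "\<forall>i<?m. initial_segment (fst \<sigma> \<inter> ?J i) (?J i)")
    case True
    have "fst \<sigma> - partial_sum \<gamma> ` {1..?m} = (\<Union>i<?m. fst \<sigma> \<inter> ?J i)"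
      using S block_interior_subset[OF \<gamma>] unfolding Union_block_interior[OF \<gamma>, symmetric] by blast
    also have "card \<dots> = (\<Sum>i<?m. card (fst \<sigma> \<inter> ?J i))"
      using disjoint_family_block_interior[OF \<gamma>] finite_block_interior
      by (intro card_UN_disjoint) (auto simp: disjoint_family_on_def)
    finally have descents: "card (fst \<sigma> - partial_sum \<gamma> ` {1..?m}) = (\<Sum>i<?m. card (fst \<sigma> \<inter> ?J i))" .
    have "(\<forall>j\<in>block \<gamma> i. sign_vector \<sigma> j = - 1) \<longleftrightarrow> \<not> E i" if "i < ?m" for i
      using E[OF that] block_end_mem[OF \<gamma> that] by auto
    then have "{i. i < ?m \<and> (\<forall>j\<in>block \<gamma> i. sign_vector \<sigma> j = - 1) \<and> \<gamma> ! i < 0}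
        = {i \<in> {..<?m}. \<not> E i \<and> \<gamma> ! i < 0}"
      by auto
    then have "(- 1 :: int) ^ card {i. i < ?m \<and> (\<forall>j\<in>block \<gamma> i. sign_vector \<sigma> j = - 1) \<and> \<gamma> ! i < 0}
        = (\<Prod>i\<in>{i \<in> {..<?m}. \<not> E i \<and> \<gamma> ! i < 0}. - 1)" by simp
    also have "\<dots> = (\<Prod>i<?m. if \<not> E i \<and> \<gamma> ! i < 0 then - 1 else 1)" by (rule prod.inter_filter) simp
    finally have bars: "(- 1) ^ card {i. i < ?m \<and> (\<forall>j\<in>block \<gamma> i. sign_vector \<sigma> j = - 1) \<and> \<gamma> ! i < 0}
        = (\<Prod>i<?m. if \<not> E i \<and> \<gamma> ! i < 0 then - 1 else (1 :: int))" .
    have "wt \<gamma> \<sigma> = (\<Prod>i<?m. (- 1) ^ card (fst \<sigma> \<inter> ?J i)) * (\<Prod>i<?m. if \<not> E i \<and> \<gamma> ! i < 0 then - 1 else 1)"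
      unfolding wt_def zero descents power_add power_sum bars using True by simp
    then show ?thesis using True by (simp add: block_weight_def prod.distrib)
  next
    case False
    then have "(\<Prod>i<?m. block_weight \<gamma> E (fst \<sigma>) i) = 0"
      by (intro prod_zero) (auto simp: block_weight_def)
    then show ?thesis unfolding wt_def zero using False by simp
  qed
qed

section \<open>The weights of the signed arc permutations\<close>

lemma sign_vector_arc:
  assumes "j \<in> {1..n}"
  shows "sign_vector (arc_descents n e T, arc_signs n e) j = arc_signs n e j"
proof -
  let ?next = "\<lambda>s. s \<in> arc_descents n e T \<and> j \<le> s"
  define t where "t = (LEAST s. ?next s)"
  have n: "?next n" using assms by (simp add: arc_descents_def)
  have t: "?next t" unfolding t_def using n by (rule LeastI)
  have "t \<le> n" unfolding t_def using n by (rule Least_le)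
  have const: "arc_signs n e j = arc_signs n e i" if "j \<le> i" "i \<le> t" for i
    using that
  proof (induction i rule: dec_induct)
    case (step i)
    then have "\<not> ?next i" unfolding t_def by (intro not_less_Least) simp
    then have "i \<notin> arc_descents n e T" using step by simp
    moreover have "i \<in> {1..n - 1}" using step \<open>t \<le> n\<close> assms by auto
    ultimately have "e i = e (Suc i)" by (simp add: arc_descents_def)
    then show ?case using step \<open>t \<le> n\<close> assms by (simp add: arc_signs_def)
  qed simp
  have "arc_signs n e t = arc_signs n e j" using const[of t] t by simp
  then show ?thesis unfolding sign_vector_def fst_conv snd_conv t_def .
qed

definition sign_weight :: "int \<Rightarrow> int" where
  "sign_weight x = (- 1) ^ (nat \<bar>x\<bar> - 1) * sgn x"

text \<open>The factor by which the weight of a block changes when its position \<open>s\<close> is toggled: only its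
  first position can be added to the empty set of descents, only its last one be removed from the
  full set.\<close>

definition toggle_weight :: "int list \<Rightarrow> (nat \<Rightarrow> bool) \<Rightarrow> nat \<Rightarrow> nat \<Rightarrow> int" where
  "toggle_weight \<gamma> E i s = (if s \<notin> block_interior \<gamma> i then 1
     else if s = (if E i then partial_sum \<gamma> i + 1 else partial_sum \<gamma> (i + 1) - 1) then - 1 else 0)"

lemma initial_segment_singleton:
  assumes "s \<in> {a..<b}" shows "initial_segment {s} {a..<b} \<longleftrightarrow> s = a"
proof
  assume init: "initial_segment {s} {a..<b}"
  show "s = a"
  proof (rule ccontr)
    assume "s \<noteq> a"
    then have "a \<in> {a..<b}" "a < s" using assms by auto
    then show False using init unfolding initial_segment_def by blast
  qed
qed (use assms in \<open>auto simp: initial_segment_def\<close>)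

lemma initial_segment_remove:
  assumes "s \<in> {a..<b}" shows "initial_segment ({a..<b} - {s}) {a..<b} \<longleftrightarrow> s = b - 1"
proof
  assume init: "initial_segment ({a..<b} - {s}) {a..<b}"
  show "s = b - 1"
  proof (rule ccontr)
    assume "s \<noteq> b - 1"
    then have "b - 1 \<in> {a..<b} - {s}" "s < b - 1" using assms by auto
    then show False using init assms unfolding initial_segment_def by blast
  qed
qed (use assms in \<open>auto simp: initial_segment_def\<close>)

lemma sum_toggle_weight:
  assumes "\<gamma> \<in> signed_compositions n"
  shows "(\<Sum>s = 1..n. \<Prod>i<length \<gamma>. toggle_weight \<gamma> E i s) = int (card {i. i < length \<gamma> \<and> \<bar>\<gamma> ! i\<bar> = 1})"
proof -
  have block_sum: "(\<Sum>s\<in>block_interior \<gamma> i. toggle_weight \<gamma> E i s) = (if \<bar>\<gamma> ! i\<bar> = 1 then 0 else - 1)"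
    if i: "i < length \<gamma>" for i
  proof -
    define t where "t = (if E i then partial_sum \<gamma> i + 1 else partial_sum \<gamma> (i + 1) - 1)"
    have "(\<Sum>s\<in>block_interior \<gamma> i. toggle_weight \<gamma> E i s)
        = (\<Sum>s\<in>block_interior \<gamma> i. if s = t then - 1 else 0)"
      by (intro sum.cong refl) (simp add: toggle_weight_def t_def)
    also have "\<dots> = (if t \<in> block_interior \<gamma> i then - 1 else 0)"
      by (rule sum.delta[OF finite_block_interior])
    also have "t \<in> block_interior \<gamma> i \<longleftrightarrow> \<bar>\<gamma> ! i\<bar> \<noteq> 1"
      using part_nonzero[OF assms i] partial_sum_Suc[OF i] by (auto simp: t_def block_interior_def)
    finally show ?thesis by simp
  qed
  have "(\<Sum>s = 1..n. \<Prod>i<length \<gamma>. toggle_weight \<gamma> E i s)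
      = int (card ({1..n} - (\<Union>i<length \<gamma>. block_interior \<gamma> i)))
        + (\<Sum>i<length \<gamma>. \<Sum>s\<in>block_interior \<gamma> i. toggle_weight \<gamma> E i s)"
    using block_interior_subset[OF assms]
    by (intro sum_prod_disjoint_supports disjoint_family_block_interior[OF assms])
      (auto simp: toggle_weight_def)
  also have "\<dots> = (\<Sum>i<length \<gamma>. 1 + (if \<bar>\<gamma> ! i\<bar> = 1 then 0 else - 1))"
    unfolding Union_block_interior[OF assms] card_block_ends[OF assms]
    by (simp add: block_sum sum.distrib)
  also have "\<dots> = (\<Sum>i<length \<gamma>. if \<bar>\<gamma> ! i\<bar> = 1 then 1 else 0)" by (intro sum.cong) auto
  finally show ?thesis by (simp add: sum.If_cases Collect_conj_eq lessThan_def)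
qed

lemma arc_descents_block_interior:
  assumes "\<gamma> \<in> signed_compositions n" "i < length \<gamma>" "\<And>j. j \<in> block \<gamma> i \<Longrightarrow> e j = p"
  shows "arc_descents n e {s} \<inter> block_interior \<gamma> i
    = (if p then block_interior \<gamma> i \<inter> {s} else block_interior \<gamma> i - {s})"
proof -
  have "j \<in> arc_descents n e {s} \<longleftrightarrow> (p \<longleftrightarrow> j = s)" if "j \<in> block_interior \<gamma> i" for j
  proof -
    note mem = block_interior_mem[OF that]
    have "j \<in> {1..n - 1}" "j \<noteq> n" using block_subset[OF assms(1,2)] mem by auto
    then show ?thesis using assms(3)[OF mem(1)] assms(3)[OF mem(2)] by (auto simp: arc_descents_def)
  qed
  then show ?thesis by auto
qed

lemma block_weight_arc:
  assumes \<gamma>: "\<gamma> \<in> signed_compositions n" and i: "i < length \<gamma>" and e: "\<And>j. j \<in> block \<gamma> i \<Longrightarrow> e j = E i"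
  shows "block_weight \<gamma> E (arc_descents n e {s}) i
    = (if E i then 1 else sign_weight (\<gamma> ! i)) * toggle_weight \<gamma> E i s"
proof -
  let ?J = "block_interior \<gamma> i"
  note S = arc_descents_block_interior[OF \<gamma> i e]
  have sign: "(- 1) ^ (nat \<bar>\<gamma> ! i\<bar> - 1) * (if \<gamma> ! i < 0 then - 1 else 1) = sign_weight (\<gamma> ! i)"
    using part_nonzero[OF \<gamma> i] by (simp add: sign_weight_def sgn_if)
  show ?thesis
  proof (cases "s \<in> ?J")
    case True
    then have "initial_segment {s} ?J \<longleftrightarrow> s = partial_sum \<gamma> i + 1"
      "initial_segment (?J - {s}) ?J \<longleftrightarrow> s = partial_sum \<gamma> (i + 1) - 1"
      unfolding block_interior_def by (simp_all only: initial_segment_singleton initial_segment_remove)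
    moreover have "(- 1 :: int) ^ card ?J = - ((- 1) ^ (card ?J - 1))"
      using power_minus_mult[of "card ?J" "- 1 :: int"] True finite_block_interior[of \<gamma> i]
      by (fastforce simp: card_gt_0_iff)
    ultimately show ?thesis
      using True sign
      by (cases "E i") (auto simp: block_weight_def S toggle_weight_def card_block_interior[OF i])
  next
    case False
    then have "?J \<inter> {s} = {}" "?J - {s} = ?J" by auto
    then show ?thesis
      using False sign
      by (simp add: block_weight_def S toggle_weight_def initial_segment_def card_block_interior[OF i])
  qed
qed

lemma wt_arc_eq_prod:
  assumes \<gamma>: "\<gamma> \<in> signed_compositions n" and "n \<ge> 1"
    and E: "\<And>j. j \<in> {1..n} \<Longrightarrow> e j = E (block_index \<gamma> j)"
  shows "wt \<gamma> (arc_descents n e {s}, arc_signs n e)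
    = (\<Prod>i<length \<gamma>. if E i then 1 else sign_weight (\<gamma> ! i)) * (\<Prod>i<length \<gamma>. toggle_weight \<gamma> E i s)"
proof -
  have e: "e j = E i" "j \<in> {1..n}" if "i < length \<gamma>" "j \<in> block \<gamma> i" for i j
    using E[of j] block_index_eq[OF \<gamma> that] block_subset[OF \<gamma> that(1)] that(2) by auto
  have "wt \<gamma> (arc_descents n e {s}, arc_signs n e)
      = (\<Prod>i<length \<gamma>. block_weight \<gamma> E (arc_descents n e {s}) i)"
  proof (subst wt_eq_prod_block_weight[OF \<gamma>, where E = E])
    show "fst (arc_descents n e {s}, arc_signs n e) \<subseteq> {1..n}"
      using assms(2) by (auto simp: arc_descents_def)
    show "sign_vector (arc_descents n e {s}, arc_signs n e) j = (if E i then 1 else - 1)"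
      if "i < length \<gamma>" "j \<in> block \<gamma> i" for i j
      using e[OF that] by (simp add: sign_vector_arc arc_signs_def)
  qed simp
  also have "\<dots> = (\<Prod>i<length \<gamma>. (if E i then 1 else sign_weight (\<gamma> ! i)) * toggle_weight \<gamma> E i s)"
    using e(1) by (intro prod.cong refl block_weight_arc[OF \<gamma>]) simp_all
  finally show ?thesis by (simp only: prod.distrib)
qed

lemma wt_arc_eq_0:
  assumes \<gamma>: "\<gamma> \<in> signed_compositions n"
    and jk: "j \<in> {1..n}" "k \<in> {1..n}" "block_index \<gamma> j = block_index \<gamma> k" "e j \<noteq> e k"
  shows "wt \<gamma> (arc_descents n e T, arc_signs n e) = 0"
proof -
  let ?\<sigma> = "(arc_descents n e T, arc_signs n e)" and ?i = "block_index \<gamma> j"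
  have "sign_vector ?\<sigma> j \<noteq> sign_vector ?\<sigma> k" using jk by (simp add: sign_vector_arc arc_signs_def)
  moreover have "j \<in> block \<gamma> ?i" "k \<in> block \<gamma> ?i"
    using block_index_mem(2)[OF \<gamma> jk(1)] block_index_mem(2)[OF \<gamma> jk(2)] jk(3) by simp_all
  ultimately have "\<not> (\<exists>x. \<forall>j\<in>block \<gamma> ?i. sign_vector ?\<sigma> j = x)" by metis
  then show ?thesis unfolding wt_def using block_index_mem(1)[OF \<gamma> jk(1)] by (intro if_P) blast
qed

theorem sum_wt_signed_arc_perms:
  assumes \<gamma>: "\<gamma> \<in> signed_compositions n" and n: "n \<ge> 2"
  shows "(\<Sum>w\<in>signed_arc_perms n. wt \<gamma> (sDes n w))
    = int (card {i. i < length \<gamma> \<and> \<bar>\<gamma> ! i\<bar> = 1}) * (\<Prod>i<length \<gamma>. 1 + sign_weight (\<gamma> ! i))"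
proof -
  let ?I = "{..<length \<gamma>}" and ?ones = "int (card {i. i < length \<gamma> \<and> \<bar>\<gamma> ! i\<bar> = 1})"
  let ?C = "{e \<in> {1..n} \<rightarrow>\<^sub>E (UNIV :: bool set).
    \<forall>j\<in>{1..n}. \<forall>k\<in>{1..n}. block_index \<gamma> j = block_index \<gamma> k \<longrightarrow> e j = e k}"
  define W where "W e = (\<Sum>s = 1..n. wt \<gamma> (arc_descents n e {s}, arc_signs n e))" for e
  have "(\<Sum>w\<in>signed_arc_perms n. wt \<gamma> (sDes n w)) = (\<Sum>e\<in>{1..n} \<rightarrow>\<^sub>E UNIV. W e)"
    unfolding W_def by (rule sum_signed_arc_perms[OF n])
  also have "\<dots> = (\<Sum>e\<in>?C. W e)"
  proof (intro sum.mono_neutral_right ballI)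
    fix e assume "e \<in> ({1..n} \<rightarrow>\<^sub>E UNIV) - ?C"
    then obtain j k where "j \<in> {1..n}" "k \<in> {1..n}" "block_index \<gamma> j = block_index \<gamma> k" "e j \<noteq> e k"
      by blast
    from wt_arc_eq_0[OF \<gamma> this] show "W e = 0" by (simp add: W_def)
  qed (auto simp: finite_PiE)
  also have "\<dots> = (\<Sum>E\<in>?I \<rightarrow>\<^sub>E UNIV. W (\<lambda>j\<in>{1..n}. E (block_index \<gamma> j)))"
    by (rule sum.reindex_bij_betw[OF bij_betw_PiE_comp_surj[OF block_index_image[OF \<gamma>]], symmetric])
  also have "\<dots> = (\<Sum>E\<in>?I \<rightarrow>\<^sub>E UNIV. (\<Prod>i\<in>?I. if E i then 1 else sign_weight (\<gamma> ! i)) * ?ones)"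
  proof (intro sum.cong refl)
    fix E
    have "W (\<lambda>j\<in>{1..n}. E (block_index \<gamma> j))
        = (\<Sum>s = 1..n. (\<Prod>i\<in>?I. if E i then 1 else sign_weight (\<gamma> ! i)) * (\<Prod>i\<in>?I. toggle_weight \<gamma> E i s))"
      unfolding W_def using n by (intro sum.cong refl wt_arc_eq_prod[OF \<gamma>]) simp_all
    then show "W (\<lambda>j\<in>{1..n}. E (block_index \<gamma> j)) = (\<Prod>i\<in>?I. if E i then 1 else sign_weight (\<gamma> ! i)) * ?ones"
      unfolding sum_distrib_left[symmetric] sum_toggle_weight[OF \<gamma>] .
  qed
  also have "\<dots> = (\<Prod>i\<in>?I. \<Sum>p\<in>UNIV. if p then 1 else sign_weight (\<gamma> ! i)) * ?ones"
    by (simp add: prod_sum_PiE sum_distrib_right)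
  also have "\<dots> = ?ones * (\<Prod>i\<in>?I. 1 + sign_weight (\<gamma> ! i))" by (simp add: UNIV_bool add.commute)
  finally show ?thesis .
qed

lemma type_product_composition_type:
  "0 \<notin> set \<gamma> \<Longrightarrow> type_product (composition_type \<gamma>) = (\<Prod>i<length \<gamma>. 1 + sign_weight (\<gamma> ! i))"
proof (induction \<gamma>)
  case (Cons c \<gamma>)
  have "(\<Prod>i<length (c # \<gamma>). 1 + sign_weight ((c # \<gamma>) ! i))
      = (1 + sign_weight c) * type_product (composition_type \<gamma>)"
    using Cons by (simp add: prod.lessThan_Suc_shift del: prod.lessThan_Suc)
  also have "\<dots> = type_product (composition_type (c # \<gamma>))"
    using Cons.prems by (cases c "0 :: int" rule: linorder_cases)
      (auto simp: type_product_def composition_type_def sign_weight_def mult_ac)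
  finally show ?case by simp
qed (simp add: type_product_def composition_type_def)

lemma count_ones_composition_type:
  "count (fst (composition_type \<gamma>)) 1 = card {i. i < length \<gamma> \<and> \<gamma> ! i = 1}"
proof -
  have "count (fst (composition_type \<gamma>)) 1 = length (filter (\<lambda>x. x = 1) \<gamma>)"
    by (induction \<gamma>) (auto simp: composition_type_def nat_eq_iff)
  then show ?thesis by (simp add: length_filter_conv_card)
qed

lemma sum_wt_signed_arc_perms_eq_type_product:
  assumes "\<gamma> \<in> signed_compositions n" "n \<ge> 2"
  shows "(\<Sum>w\<in>signed_arc_perms n. wt \<gamma> (sDes n w))
    = int (count (fst (composition_type \<gamma>)) 1) * type_product (composition_type \<gamma>)"
proof (cases "- 1 \<in> set \<gamma>")
  case True
  then obtain i where "i < length \<gamma>" "\<gamma> ! i = - 1" by (auto simp: in_set_conv_nth)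
  then have "(\<Prod>i<length \<gamma>. 1 + sign_weight (\<gamma> ! i)) = 0"
    by (intro prod_zero bexI[of _ i]) (simp_all add: sign_weight_def)
  then show ?thesis
    using assms
    by (simp add: sum_wt_signed_arc_perms type_product_composition_type signed_compositions_def)
next
  case False
  then have "\<bar>\<gamma> ! i\<bar> = 1 \<longleftrightarrow> \<gamma> ! i = 1" if "i < length \<gamma>" for i
    using nth_mem[OF that] by (auto simp: abs_if split: if_splits)
  then have "{i. i < length \<gamma> \<and> \<bar>\<gamma> ! i\<bar> = 1} = {i. i < length \<gamma> \<and> \<gamma> ! i = 1}" by blast
  then show ?thesis
    using assms
    by (simp add: sum_wt_signed_arc_perms type_product_composition_type count_ones_composition_type
      signed_compositions_def flip: One_nat_def)
qed

theorem fine_set_signed_arc_perms: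
  assumes "n \<ge> 2"
  shows "fine_set n (signed_arc_perms n) (sDes n)
    (induced (signed_perms (n - 1)) (signed_perms n) (ext_char (n - 1)))"
  unfolding fine_set_def
proof (intro conjI ballI impI finite_signed_arc_perms)
  fix \<gamma> w
  assume "\<gamma> \<in> signed_compositions n" "w \<in> signed_perms n" "signed_cycle_type n w = composition_type \<gamma>"
  then show "induced (signed_perms (n - 1)) (signed_perms n) (ext_char (n - 1)) w
      = of_int (\<Sum>b\<in>signed_arc_perms n. wt \<gamma> (sDes n b))"
    using assms induced_ext_char[of n w] sum_wt_signed_arc_perms_eq_type_product[of \<gamma> n] by simp
qed

section \<open>The quasisymmetric generating function\<close>

fun var_index :: "var \<Rightarrow> nat" where
  "var_index (X i) = i" | "var_index (Y i) = i"

fun var_rank :: "var \<Rightarrow> nat" where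
  "var_rank (Y i) = 2 * i" | "var_rank (X i) = 2 * i + 1"

lemma var_rank_eq_iff: "var_rank x = var_rank y \<longleftrightarrow> x = y"
  by (cases x; cases y) (auto; presburger)+

text \<open>In the order \<open>y\<^sub>0 < x\<^sub>0 < y\<^sub>1 < x\<^sub>1 < \<dots>\<close> the words counted by the quasisymmetric functions are the weakly
  increasing ones with prescribed equalities.\<close>

instantiation var :: linorder
begin

definition less_eq_var :: "var \<Rightarrow> var \<Rightarrow> bool" where
  "x \<le> y \<longleftrightarrow> var_rank x \<le> var_rank y"

definition less_var :: "var \<Rightarrow> var \<Rightarrow> bool" where
  "x < y \<longleftrightarrow> var_rank x < var_rank y"

instance
  by standard (auto simp: less_eq_var_def less_var_def var_rank_eq_iff)

end

definition increasing_word :: "nat \<Rightarrow> (nat \<Rightarrow> var) \<Rightarrow> bool" where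
  "increasing_word n v \<longleftrightarrow> (\<forall>j\<in>{1..<n}. v j \<le> v (Suc j))"

definition admissible_position :: "nat \<Rightarrow> (nat \<Rightarrow> var) \<Rightarrow> nat \<Rightarrow> bool" where
  "admissible_position n v s \<longleftrightarrow> (\<forall>j\<in>{1..<n}. v j = v (Suc j) \<longrightarrow> (is_X (v j) \<longleftrightarrow> j \<noteq> s))"

definition arc_words :: "nat \<Rightarrow> var multiset \<Rightarrow> nat \<Rightarrow> (nat \<Rightarrow> var) set" where
  "arc_words n M s = {v \<in> fillings {1..n} M. increasing_word n v \<and> admissible_position n v s}"

definition signed_word :: "nat \<Rightarrow> (nat \<Rightarrow> bool) \<Rightarrow> (nat \<Rightarrow> nat) \<Rightarrow> nat \<Rightarrow> var" where
  "signed_word n e i = (\<lambda>j\<in>{1..n}. if e j then X (i j) else Y (i j))"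

lemma wDes_arc:
  assumes "j \<in> {1..<n}"
  shows "j \<in> wDes (arc_descents n e T, arc_signs n e)
    \<longleftrightarrow> (e j \<and> \<not> e (Suc j)) \<or> (e j = e (Suc j) \<and> (e j \<longleftrightarrow> j \<in> T))"
proof -
  let ?S = "arc_descents n e T" and ?\<epsilon> = "arc_signs n e"
  have "Suc j \<in> {1..n}" using assms by auto
  from sign_vector_arc[OF this] have "?\<epsilon> (LEAST t. t \<in> ?S \<and> j < t) = ?\<epsilon> (Suc j)"
    by (simp add: sign_vector_def Suc_le_eq)
  moreover have "n \<in> ?S" "j < n" using assms by (simp_all add: arc_descents_def)
  then have "\<exists>t\<in>?S. j < t" by blast
  ultimately have "j \<in> wDes (?S, ?\<epsilon>) \<longleftrightarrow> j \<in> ?S \<and> (?\<epsilon> j = ?\<epsilon> (Suc j) \<or> (?\<epsilon> j = 1 \<and> ?\<epsilon> (Suc j) = - 1))"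
    by (simp add: wDes_def Let_def)
  moreover have "j \<in> {1..n - 1}" "j \<noteq> n" "j \<in> {1..n}" "Suc j \<in> {1..n}" using assms by auto
  ultimately show ?thesis by (auto simp: arc_descents_def arc_signs_def)
qed

lemma wDes_arc_subset: "wDes (arc_descents n e T, arc_signs n e) \<subseteq> {1..<n}"
  by (auto simp: wDes_def arc_descents_def)

lemma F_fun_step_iff:
  fixes e :: "nat \<Rightarrow> bool" and i :: "nat \<Rightarrow> nat"
  assumes "j \<in> {1..<n}"
  defines "v \<equiv> signed_word n e i"
  shows "i j \<le> i (Suc j) \<and> (j \<in> wDes (arc_descents n e {s}, arc_signs n e) \<longrightarrow> i j < i (Suc j))
    \<longleftrightarrow> v j \<le> v (Suc j) \<and> (v j = v (Suc j) \<longrightarrow> (is_X (v j) \<longleftrightarrow> j \<noteq> s))"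
proof -
  have "v j = (if e j then X (i j) else Y (i j))"
    "v (Suc j) = (if e (Suc j) then X (i (Suc j)) else Y (i (Suc j)))"
    using assms(1) by (simp_all add: v_def signed_word_def)
  then show ?thesis
    unfolding wDes_arc[OF assms(1)] less_eq_var_def by (cases "e j"; cases "e (Suc j)") auto
qed

lemma F_fun_conditions_iff:
  "(\<forall>j\<in>{1..<n}. i j \<le> i (j + 1)) \<and> (\<forall>j\<in>wDes (arc_descents n e {s}, arc_signs n e). i j < i (j + 1))
    \<longleftrightarrow> increasing_word n (signed_word n e i) \<and> admissible_position n (signed_word n e i) s"
proof -
  let ?D = "wDes (arc_descents n e {s}, arc_signs n e)"
  have "(\<forall>j\<in>{1..<n}. i j \<le> i (j + 1)) \<and> (\<forall>j\<in>?D. i j < i (j + 1))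
      \<longleftrightarrow> (\<forall>j\<in>{1..<n}. i j \<le> i (Suc j) \<and> (j \<in> ?D \<longrightarrow> i j < i (Suc j)))"
    using wDes_arc_subset[of n e "{s}"] by auto
  then show ?thesis
    unfolding increasing_word_def admissible_position_def ball_conj_distrib[symmetric]
    by (simp only: F_fun_step_iff cong: ball_cong)
qed

lemma mcoeff_F_fun_arc:
  "mcoeff (F_fun n (arc_descents n e {s}, arc_signs n e)) M
    = of_nat (card {i \<in> {1..n} \<rightarrow>\<^sub>E UNIV. signed_word n e i \<in> arc_words n M s})"
proof -
  have "image_mset (\<lambda>j. if sign_vector (arc_descents n e {s}, arc_signs n e) j = 1 then X (i j) else Y (i j))
      (mset_set {1..n}) = image_mset (signed_word n e i) (mset_set {1..n})" for i
    by (intro image_mset_cong) (simp add: sign_vector_arc arc_signs_def signed_word_def)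
  moreover have "signed_word n e i \<in> fillings {1..n} M
      \<longleftrightarrow> image_mset (signed_word n e i) (mset_set {1..n}) = M" for i
    by (simp add: fillings_def signed_word_def)
  ultimately show ?thesis
    unfolding F_fun.rep_eq arc_words_def mem_Collect_eq F_fun_conditions_iff[symmetric]
    by (simp only: conj_ac)
qed

lemma bij_betw_signed_word:
  assumes e: "e \<in> {1..n} \<rightarrow>\<^sub>E UNIV"
  shows "bij_betw (signed_word n e) ({1..n} \<rightarrow>\<^sub>E UNIV) {v \<in> {1..n} \<rightarrow>\<^sub>E UNIV. (\<lambda>j\<in>{1..n}. is_X (v j)) = e}"
proof (rule bij_betw_byWitness[where f' = "\<lambda>v. \<lambda>j\<in>{1..n}. var_index (v j)"])
  let ?index = "\<lambda>v. \<lambda>j\<in>{1..n}. var_index (v j)"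
  show "\<forall>i\<in>{1..n} \<rightarrow>\<^sub>E UNIV. ?index (signed_word n e i) = i"
  proof
    fix i :: "nat \<Rightarrow> nat" assume "i \<in> {1..n} \<rightarrow>\<^sub>E UNIV"
    then show "?index (signed_word n e i) = i"
      by (intro PiE_ext[of _ "{1..n}" "\<lambda>_. UNIV"]) (simp_all add: signed_word_def)
  qed
  show "\<forall>v\<in>{v \<in> {1..n} \<rightarrow>\<^sub>E UNIV. (\<lambda>j\<in>{1..n}. is_X (v j)) = e}. signed_word n e (?index v) = v"
  proof
    fix v assume v: "v \<in> {v \<in> {1..n} \<rightarrow>\<^sub>E UNIV. (\<lambda>j\<in>{1..n}. is_X (v j)) = e}"
    show "signed_word n e (?index v) = v"
    proof (rule PiE_ext[of _ "{1..n}" "\<lambda>_. UNIV"])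
      fix j assume j: "j \<in> {1..n}"
      then have "e j \<longleftrightarrow> is_X (v j)" using v by auto
      then show "signed_word n e (?index v) j = v j"
        using j by (cases "v j") (simp_all add: signed_word_def)
    qed (use v in \<open>simp_all add: signed_word_def\<close>)
  qed
  have "(\<lambda>j\<in>{1..n}. is_X (signed_word n e i j)) = e" for i
    by (rule PiE_ext[OF _ e]) (simp_all add: signed_word_def)
  then show "signed_word n e ` ({1..n} \<rightarrow>\<^sub>E UNIV) \<subseteq> {v \<in> {1..n} \<rightarrow>\<^sub>E UNIV. (\<lambda>j\<in>{1..n}. is_X (v j)) = e}"
    by (auto simp: signed_word_def)
qed (rule image_subsetI, simp)

lemma sum_mcoeff_F_fun_arc:
  "(\<Sum>e\<in>{1..n} \<rightarrow>\<^sub>E UNIV. mcoeff (F_fun n (arc_descents n e {s}, arc_signs n e)) M)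
    = of_nat (card (arc_words n M s))"
proof -
  let ?W = "arc_words n M s" and ?signs = "\<lambda>v. \<lambda>j\<in>{1..n}. is_X (v j)"
  have "card {i \<in> {1..n} \<rightarrow>\<^sub>E UNIV. signed_word n e i \<in> ?W} = card {v \<in> ?W. ?signs v = e}"
    if e: "e \<in> {1..n} \<rightarrow>\<^sub>E UNIV" for e
  proof -
    have "bij_betw (signed_word n e) {i \<in> {1..n} \<rightarrow>\<^sub>E UNIV. signed_word n e i \<in> ?W}
        {v \<in> {v \<in> {1..n} \<rightarrow>\<^sub>E UNIV. ?signs v = e}. v \<in> ?W}"
      by (rule bij_betw_Collect[OF bij_betw_signed_word[OF e]]) (rule refl)
    moreover have "{v \<in> {v \<in> {1..n} \<rightarrow>\<^sub>E UNIV. ?signs v = e}. v \<in> ?W} = {v \<in> ?W. ?signs v = e}"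
      by (auto simp: arc_words_def fillings_def)
    ultimately show ?thesis by (simp only: bij_betw_same_card)
  qed
  then have "(\<Sum>e\<in>{1..n} \<rightarrow>\<^sub>E UNIV. mcoeff (F_fun n (arc_descents n e {s}, arc_signs n e)) M)
      = of_nat (\<Sum>e\<in>{1..n} \<rightarrow>\<^sub>E UNIV. card {v \<in> ?W. ?signs v = e})"
    unfolding mcoeff_F_fun_arc of_nat_sum by (intro sum.cong refl) (simp only:)
  also have "(\<Sum>e\<in>{1..n} \<rightarrow>\<^sub>E UNIV. card {v \<in> ?W. ?signs v = e}) = card ?W"
    unfolding card_eq_sum using finite_fillings[of "{1..n}" M]
    by (intro sum.group) (auto simp: arc_words_def finite_PiE)
  finally show ?thesis .
qed

text \<open>For a sorted word \<open>v\<close>, an admissible position is the last one of a letter \<open>x\<close> or the first one of a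
  letter \<open>y\<close>, and removing its letter from \<open>v\<close> leaves no repeated \<open>y\<close>.\<close>

context
  fixes n :: nat and M :: "var multiset" and v :: "nat \<Rightarrow> var"
  assumes v: "v \<in> fillings {1..n} M"
    and increasing: "increasing_word n v"
begin

definition letter_positions :: "var \<Rightarrow> nat set" where
  "letter_positions x = {j \<in> {1..n}. v j = x}"

definition marked_position :: "var \<Rightarrow> nat" where
  "marked_position x = (if is_X x then Max (letter_positions x) else Min (letter_positions x))"

lemma finite_letter_positions: "finite (letter_positions x)"
  by (simp add: letter_positions_def)

lemma marked_position_mem:
  assumes "x \<in># M" shows "marked_position x \<in> letter_positions x"
proof -
  have "letter_positions x \<noteq> {}"
    using assms filling_mem[OF _ v, of x] by (auto simp: letter_positions_def)
  then show ?thesis using Max_in[OF finite_letter_positions] Min_in[OF finite_letter_positions]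
    by (simp add: marked_position_def)
qed

lemma marked_position_eq_iff:
  assumes "s \<in> {1..n}"
  shows "marked_position (v s) = s
    \<longleftrightarrow> (if is_X (v s) then \<forall>j\<in>letter_positions (v s). j \<le> s else \<forall>j\<in>letter_positions (v s). s \<le> j)"
proof -
  have s: "s \<in> letter_positions (v s)" using assms by (simp add: letter_positions_def)
  then have "letter_positions (v s) \<noteq> {}" by blast
  then show ?thesis
    using Max_eq_iff[OF finite_letter_positions] Min_eq_iff[OF finite_letter_positions] s
    by (simp add: marked_position_def)
qed

lemma repeated_adjacent:
  assumes "i \<in> letter_positions x" "j \<in> letter_positions x" "i < j"
  shows "i \<in> {1..<n}" "v i = v (Suc i)"
proof -
  have mono: "v k \<le> v l" if "1 \<le> k" "k \<le> l" "l \<le> n" for k l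
    using that(2,1,3)
  proof (induction l rule: dec_induct)
    case (step l)
    then show ?case using increasing by (auto simp: increasing_word_def intro: order_trans)
  qed simp
  show "i \<in> {1..<n}" using assms by (auto simp: letter_positions_def)
  have "v i \<le> v (Suc i)" "v (Suc i) \<le> v j" using assms by (intro mono; auto simp: letter_positions_def)+
  then show "v i = v (Suc i)" using assms by (simp add: letter_positions_def)
qed

lemma count_remove_letter:
  assumes "s \<in> {1..n}" shows "count (M - {#v s#}) x = card (letter_positions x - {s})"
  using assms by (simp add: count_filling[OF _ v] letter_positions_def card_Diff_singleton_if)

lemma marked_position_if_admissible:
  assumes s: "s \<in> {1..n}" and admissible: "admissible_position n v s"
  shows "marked_position (v s) = s" "y_squarefree (M - {#v s#})"
proof -
  have repeated: "is_X x \<longleftrightarrow> i \<noteq> s" if "i \<in> letter_positions x" "j \<in> letter_positions x" "i < j" for i j x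
  proof -
    have "is_X (v i) \<longleftrightarrow> i \<noteq> s"
      using admissible repeated_adjacent[OF that] unfolding admissible_position_def by blast
    then show ?thesis using that(1) by (simp add: letter_positions_def)
  qed
  have mem: "s \<in> letter_positions (v s)" using s by (simp add: letter_positions_def)
  show "marked_position (v s) = s"
    unfolding marked_position_eq_iff[OF s]
    using repeated[OF mem] repeated[OF _ mem] by (auto simp: not_le[symmetric])
  show "y_squarefree (M - {#v s#})"
    unfolding y_squarefree_def count_remove_letter[OF s]
  proof (intro allI impI)
    fix x assume "\<not> is_X x"
    then have "i = j" if "i \<in> letter_positions x - {s}" "j \<in> letter_positions x - {s}" for i j
      using repeated[of i x j] repeated[of j x i] that by (cases i j rule: linorder_cases) auto
    then show "card (letter_positions x - {s}) \<le> 1"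
      using finite_letter_positions by (simp add: card_le_Suc0_iff_eq)
  qed
qed

lemma admissible_if_marked_position:
  assumes s: "s \<in> {1..n}" and marked: "marked_position (v s) = s" and squarefree: "y_squarefree (M - {#v s#})"
  shows "admissible_position n v s"
  unfolding admissible_position_def
proof (intro ballI impI)
  fix j assume j: "j \<in> {1..<n}" "v j = v (Suc j)"
  let ?P = "letter_positions (v j)"
  have mem: "j \<in> ?P" "Suc j \<in> ?P" using j by (auto simp: letter_positions_def)
  have "s = j" if y: "\<not> is_X (v j)"
  proof -
    have "card (?P - {s}) \<le> Suc 0"
      using squarefree y unfolding y_squarefree_def count_remove_letter[OF s] One_nat_def by blast
    then have "\<forall>i\<in>?P - {s}. \<forall>k\<in>?P - {s}. i = k"
      by (simp add: card_le_Suc0_iff_eq finite_letter_positions)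
    then have "s = j \<or> s = Suc j" using mem n_not_Suc_n[of j] by blast
    moreover have "s \<le> j" if "s = Suc j"
      using marked marked_position_eq_iff[OF s] y mem that j(2) by auto
    ultimately show ?thesis by auto
  qed
  moreover have "j \<noteq> s" if "is_X (v j)"
  proof
    assume "j = s"
    then have "\<forall>i\<in>?P. i \<le> s" using marked marked_position_eq_iff[OF s] that by simp
    then have "Suc s \<le> s" using mem(2) \<open>j = s\<close> by blast
    then show False by simp
  qed
  ultimately show "is_X (v j) \<longleftrightarrow> j \<noteq> s" by blast
qed

lemma card_admissible_positions:
  "card {s \<in> {1..n}. admissible_position n v s}
    = card {x \<in> set_mset M. y_squarefree (M - {#x#})}"
proof -
  have "{s \<in> {1..n}. admissible_position n v s}
      = {s \<in> {1..n}. marked_position (v s) = s \<and> y_squarefree (M - {#v s#})}"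
    using marked_position_if_admissible admissible_if_marked_position
    by (intro Collect_cong conj_cong refl) blast
  moreover have "bij_betw v {s \<in> {1..n}. marked_position (v s) = s \<and> y_squarefree (M - {#v s#})}
      {x \<in> set_mset M. y_squarefree (M - {#x#})}"
  proof (rule bij_betw_byWitness[where f' = marked_position])
    have rep: "marked_position x \<in> {1..n}" "v (marked_position x) = x" if "x \<in># M" for x
      using marked_position_mem[OF that] by (simp_all add: letter_positions_def)
    then show "\<forall>x\<in>{x \<in> set_mset M. y_squarefree (M - {#x#})}. v (marked_position x) = x" by simp
    show "marked_position ` {x \<in> set_mset M. y_squarefree (M - {#x#})}
        \<subseteq> {s \<in> {1..n}. marked_position (v s) = s \<and> y_squarefree (M - {#v s#})}"
      using rep by (auto simp del: atLeastAtMost_iff)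
    have "v s \<in># M" if "s \<in> {1..n}" for s using filling_mem[OF _ v] that by blast
    then show "v ` {s \<in> {1..n}. marked_position (v s) = s \<and> y_squarefree (M - {#v s#})}
        \<subseteq> {x \<in> set_mset M. y_squarefree (M - {#x#})}" by blast
  qed simp
  ultimately show ?thesis by (simp only: bij_betw_same_card)
qed

end

lemma ex1_increasing_filling:
  assumes "size M = n"
  obtains v where "{c \<in> fillings {1..n} M. increasing_word n c} = {v}"
proof -
  have "(\<forall>j. Suc j < n \<longrightarrow> c (Suc j) \<le> c (Suc (Suc j))) \<longleftrightarrow> increasing_word n c" for c
    unfolding increasing_word_def by (force simp: gr0_conv_Suc Suc_le_eq)
  moreover have "bij_betw Suc {..<n} {1..n}" by (simp add: bij_betw_def image_Suc_lessThan)
  then obtain v where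
    "{c \<in> fillings {1..n} M. \<forall>j. Suc j < n \<longrightarrow> c (Suc j) \<le> c (Suc (Suc j))} = {v}"
    using ex1_sorted_filling[OF _ assms] by blast
  ultimately show ?thesis using that by (simp only:)
qed

lemma sum_card_arc_words:
  "(\<Sum>s = 1..n. card (arc_words n M s))
    = (if size M = n then card {x \<in> set_mset M. y_squarefree (M - {#x#})} else 0)"
proof (cases "size M = n")
  case True
  then obtain v where v: "{c \<in> fillings {1..n} M. increasing_word n c} = {v}"
    by (rule ex1_increasing_filling)
  have "arc_words n M s = (if admissible_position n v s then {v} else {})" for s
  proof -
    have "arc_words n M s = {c \<in> {v}. admissible_position n c s}"
      unfolding v[symmetric] by (auto simp: arc_words_def)
    then show ?thesis by auto
  qed
  then have "card (arc_words n M s) = of_bool (admissible_position n v s)" for s by simp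
  then have "(\<Sum>s = 1..n. card (arc_words n M s)) = card {s \<in> {1..n}. admissible_position n v s}"
    by (simp add: Int_def)
  then show ?thesis using True v card_admissible_positions[of v n M] by auto
next
  case False
  then show ?thesis using fillings_eq_empty_iff[of "{1..n}" M] by (simp add: arc_words_def)
qed

theorem sum_F_fun_signed_arc_perms:
  assumes "n \<ge> 2"
  shows "(\<Sum>w\<in>signed_arc_perms n. F_fun n (sDes n w))
    = p_plus 1 * (\<Sum>k = 0..n - 1. schur X [k] * schur Y (replicate (n - 1 - k) 1))"
proof (rule mseries_eqI)
  fix M
  have "mcoeff (\<Sum>w\<in>signed_arc_perms n. F_fun n (sDes n w)) M
      = (\<Sum>s = 1..n. \<Sum>e\<in>{1..n} \<rightarrow>\<^sub>E UNIV. mcoeff (F_fun n (arc_descents n e {s}, arc_signs n e)) M)"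
    unfolding sum_signed_arc_perms[OF assms, of "F_fun n"] mcoeff_sum by (rule sum.swap)
  also have "\<dots> = of_nat (\<Sum>s = 1..n. card (arc_words n M s))"
    by (simp only: sum_mcoeff_F_fun_arc of_nat_sum)
  also have "\<dots> = mcoeff (p_plus 1 * (\<Sum>k = 0..n - 1. schur X [k] * schur Y (replicate (n - 1 - k) 1))) M"
    unfolding sum_card_arc_words using assms by (subst mcoeff_p_plus_1_mult_sum_schur) simp_all
  finally show "mcoeff (\<Sum>w\<in>signed_arc_perms n. F_fun n (sDes n w)) M
      = mcoeff (p_plus 1 * (\<Sum>k = 0..n - 1. schur X [k] * schur Y (replicate (n - 1 - k) 1))) M" .
qed

theorem theorem8p3:
  fixes n :: nat
  assumes "n \<ge> 2"
  shows "fine_set n (signed_arc_perms n) (sDes n)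
           (induced (signed_perms (n - 1)) (signed_perms n) (ext_char (n - 1))) \<and>
         (\<Sum>w \<in> signed_arc_perms n. F_fun n (sDes n w)) =
           ch n (\<lambda>w. \<Sum>k = 0..n - 1.
             induced (signed_perms (n - 1)) (signed_perms n)
               (irr_char (n - 1) [k] (replicate (n - k - 1) 1)) w)"
proof
  let ?ind = "induced (signed_perms (n - 1)) (signed_perms n)"
  show "fine_set n (signed_arc_perms n) (sDes n) (?ind (ext_char (n - 1)))"
    by (rule fine_set_signed_arc_perms[OF assms])
  have summand: "ch n (?ind (irr_char (n - 1) [k] (replicate (n - k - 1) 1)))
      = p_plus 1 * (schur X [k] * schur Y (replicate (n - 1 - k) 1))" if "k \<in> {0..n - 1}" for k
  proof -
    have "k + (n - k - 1) = n - 1" "n - k - 1 = n - 1 - k" "n \<ge> 1" using that assms by auto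
    then show ?thesis by (simp only: ch_induced irr_char_row_column ch_ext_power_char)
  qed
  have "(\<Sum>w \<in> signed_arc_perms n. F_fun n (sDes n w))
      = (\<Sum>k = 0..n - 1. p_plus 1 * (schur X [k] * schur Y (replicate (n - 1 - k) 1)))"
    by (simp only: sum_F_fun_signed_arc_perms[OF assms] sum_distrib_left)
  also have "\<dots> = ch n (\<lambda>w. \<Sum>k = 0..n - 1. ?ind (irr_char (n - 1) [k] (replicate (n - k - 1) 1)) w)"
    unfolding ch_sum by (intro sum.cong refl summand[symmetric])
  finally show "(\<Sum>w \<in> signed_arc_perms n. F_fun n (sDes n w))
      = ch n (\<lambda>w. \<Sum>k = 0..n - 1. ?ind (irr_char (n - 1) [k] (replicate (n - k - 1) 1)) w)" .
qed

end
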